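(* Consider a hidden Markov model of order $K^*$ with parameters $(\pi^*,\mathbf Q^*,\mathbf f^* )$, a set $\mathcal F\subset \mathbf L^2(\mathcal Y,\mu)$ and subspaces $(\mathfrak P_M)_{M\in\mathcal M}$, as described in the context. Assume: (i) $(X_j)_{j\ge1}$ is a stationary ergodic Markov chain with parameters $(\pi^*,\mathbf Q^* )$; (ii) $\mathbf f^*\in\mathcal F^{K^*}$; $\mathcal F$ is closed under (orthogonal) projection on $\mathfrak P_M$ for all $M$; and $\|f\|_\infty\le C_{\mathcal F,\infty}$, $\|f\|_2\le C_{\mathcal F,2}$ for all $f\in\mathcal F$, where $C_{\mathcal F,\infty},C_{\mathcal F,2}$ are constants larger than $1$. Then there exist a sequence $(x_{K,M})_{K\in\mathbb N^*,M\in\mathcal M}$ depending only on $(C_{\mathcal F,2},C_{\mathcal F,\infty},\mathbf Q^*,L)$ and positive constants $n_0,\rho,A$ depending only on $(C_{\mathcal F,2},C_{\mathcal F,\infty},\mathbf Q^*,L)$ such that if the penalty $\widetilde{\mathrm{pen}}$ satisfies $$\forall n,\ \forall M\le n,\ \forall K\le n,\quad \widetilde{\mathrm{pen}}(n,M,K)\ge\rho\,(MK+K^2-1)\frac{\log n}{n},$$ then for every family $s=(s_{K,M})_{K\in\mathbb N^*,M\in\mathcal M}$ of elements of $\bigcup_{K\ge1}S_K$, every $n\ge n_0$ and every $x>0$, one has with probability larger than $1-e^{-x}$: $$\sup_{K'\le n,\,M'\le n}Z_{K',M'}(s)\le\frac14\qquad\text{and}\qquad\sup_{K'\le n,\,M'\le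 n}\Big(2Z_{K',M'}(s)\,x_{K',M'}^2-\widetilde{\mathrm{pen}}(n,M',K')\Big)\le A\frac xn ,$$ where $$Z_{K,M}(s)=\sup_{t\in S_{K,M}}\frac{|\nu(t-s_{K,M})|}{\|t-s_{K,M}\|_2^2+x_{K,M}^2}.$$
   Context: $L\ge1$ is a fixed integer and $(\mathcal Y,\mu)$ a measured space with $\mu$ $\sigma$-finite. $(X_j)_{j\ge1}$ is a Markov chain on $\{1,\dots,K^*\}$ with transition matrix $\mathbf Q^*$ and initial distribution $\pi^*$. Conditionally on $(X_j)_j$ the $\mathcal Y$-valued variables $(Y_j)_{j\ge1}$ are independent, and $Y_j$ given $X_j=k$ has density $f_k^*\in\mathbf L^2(\mathcal Y,\mu)$ with respect to $\mu$; $\mathbf f^*=(f^*_1,\dots,f^*_{K^*})$. For $\pi\in\mathbb R^K$, $\mathbf Q\in\mathbb R^{K\times K}$, $\mathbf f\in\mathbf L^2(\mathcal Y,\mu)^K$, $$g^{\pi,\mathbf Q,\mathbf f}=\sum_{k_1,\dots,k_L=1}^K\pi(k_1)\prod_{i=2}^L\mathbf Q(k_{i-1},k_i)\bigotimes_{i=1}^Lf_{k_i}.$$ If $\mathbf Q$ is an irreducible transition matrix with stationary distribution $\pi$, write $g^{\mathbf Q,\mathbf f}=g^{\pi,\mathbf Q,\mathbf f}$. Set $g^*=g^{\pi^*,\mathbf Q^*,\mathbf f^*}$, the density of $(Y_1,\dots,Y_L)$. $(\mathfrak P_M)_{M\in\mathcal M}$, $\mathcal M\subset\mathbb N$, is a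 nested sequence of subspaces of $\mathbf L^2(\mathcal Y,\mu)$ with $\dim\mathfrak P_M=M$ and dense union. $\mathcal Q_K$ is the set of irreducible transition matrices of size $K$; $S_{K,M}=\{g^{\mathbf Q,\mathbf f}:\mathbf Q\in\mathcal Q_K,\mathbf f\in(\mathcal F\cap\mathfrak P_M)^K\}$ and $S_K=\{g^{\mathbf Q,\mathbf f}:\mathbf Q\in\mathcal Q_K,\mathbf f\in\mathcal F^K\}$. The index $M$ always ranges over $\mathcal M$ and $K$ over the positive integers $\mathbb N^*$. With $Z_s=(Y_s,\dots,Y_{s+L-1})$, the centered empirical process based on $Y_1,\dots,Y_{n+L-1}$ is $\nu(t)=\frac1n\sum_{s=1}^nt(Z_s)-\int t\,g^*\,d\mu^{\otimes L}$. It is not assumed that $s_{K,M}\in S_{K,M}$.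
   Formalization: The numbers x_{K,M} (positive) may also depend on n and x, and M=0 is excluded from the index set; without these changes the claim is false. The constants are uniform over all measured spaces and models carried by given underlying sets. *)

theory Defs
  imports "HOL-Probability.Probability"
begin

text \<open>States of a chain of order \<open>K\<close> are the numbers \<open>1..K\<close>; vectors, matrices and tuples of
  functions indexed by states are functions on \<open>nat\<close> whose values outside \<open>{1..K}\<close> play no role.\<close>

definition transition_matrix :: "nat \<Rightarrow> (nat \<Rightarrow> nat \<Rightarrow> real) \<Rightarrow> bool" where
  "transition_matrix K Q \<longleftrightarrow>
     (\<forall>k\<in>{1..K}. (\<forall>l\<in>{1..K}. 0 \<le> Q k l) \<and> (\<Sum>l\<in>{1..K}. Q k l) = 1)"

primrec transition_power :: "nat \<Rightarrow> (nat \<Rightarrow> nat \<Rightarrow> real) \<Rightarrow> nat \<Rightarrow> nat \<Rightarrow> nat \<Rightarrow> real" where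
  "transition_power K Q 0 = (\<lambda>k l. if k = l then 1 else 0)"
| "transition_power K Q (Suc m) = (\<lambda>k l. \<Sum>j\<in>{1..K}. transition_power K Q m k j * Q j l)"

definition irreducible_transition_matrix :: "nat \<Rightarrow> (nat \<Rightarrow> nat \<Rightarrow> real) \<Rightarrow> bool" where
  "irreducible_transition_matrix K Q \<longleftrightarrow> transition_matrix K Q \<and>
     (\<forall>k\<in>{1..K}. \<forall>l\<in>{1..K}. \<exists>m. 0 < transition_power K Q m k l)"

definition stationary_distribution ::
    "nat \<Rightarrow> (nat \<Rightarrow> nat \<Rightarrow> real) \<Rightarrow> (nat \<Rightarrow> real) \<Rightarrow> bool" where
  "stationary_distribution K Q \<pi> \<longleftrightarrow>
     (\<forall>k\<in>{1..K}. 0 \<le> \<pi> k) \<and> (\<Sum>k\<in>{1..K}. \<pi> k) = 1 \<and>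
     (\<forall>l\<in>{1..K}. (\<Sum>k\<in>{1..K}. \<pi> k * Q k l) = \<pi> l)"

text \<open>\<open>L\<^sup>2\<close> is represented by functions rather than by classes modulo almost everywhere equality.\<close>

definition L2_space :: "'a measure \<Rightarrow> ('a \<Rightarrow> real) set" where
  "L2_space \<mu> = {f \<in> borel_measurable \<mu>. integrable \<mu> (\<lambda>y. (f y)\<^sup>2)}"

definition L2_norm :: "'a measure \<Rightarrow> ('a \<Rightarrow> real) \<Rightarrow> real" where
  "L2_norm \<mu> f = sqrt (\<integral>y. (f y)\<^sup>2 \<partial>\<mu>)"

text \<open>A subspace of dimension \<open>M\<close> of \<open>L\<^sup>2\<close>, given by a linear choice of representatives: the basis
  is independent modulo null functions, so \<open>V\<close> contains exactly one representative of each of its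
  classes. A choice is needed because the supremum of the empirical process over an uncountable
  set of classes depends on pointwise values.\<close>

definition L2_subspace :: "'a measure \<Rightarrow> nat \<Rightarrow> ('a \<Rightarrow> real) set \<Rightarrow> bool" where
  "L2_subspace \<mu> M V \<longleftrightarrow> (\<exists>b :: nat \<Rightarrow> 'a \<Rightarrow> real.
     (\<forall>i<M. b i \<in> L2_space \<mu>) \<and>
     (\<forall>c :: nat \<Rightarrow> real. (AE y in \<mu>. (\<Sum>i<M. c i * b i y) = 0) \<longrightarrow> (\<forall>i<M. c i = 0)) \<and>
     V = range (\<lambda>(c :: nat \<Rightarrow> real) y. \<Sum>i<M. c i * b i y))"

definition is_L2_projection ::
    "'a measure \<Rightarrow> ('a \<Rightarrow> real) set \<Rightarrow> ('a \<Rightarrow> real) \<Rightarrow> ('a \<Rightarrow> real) \<Rightarrow> bool" where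
  "is_L2_projection \<mu> V f p \<longleftrightarrow> p \<in> V \<and> (\<forall>h\<in>V. (\<integral>y. (f y - p y) * h y \<partial>\<mu>) = 0)"

text \<open>Dimension \<open>0\<close> is excluded: a penalty proportional to \<open>M * K + K\<^sup>2 - 1\<close> vanishes
  for \<open>M = 0\<close>, \<open>K = 1\<close>.\<close>

definition model_spaces :: "'a measure \<Rightarrow> nat set \<Rightarrow> (nat \<Rightarrow> ('a \<Rightarrow> real) set) \<Rightarrow> bool" where
  "model_spaces \<mu> \<M> P \<longleftrightarrow>
     \<M> \<subseteq> {1..} \<and>
     (\<forall>M\<in>\<M>. L2_subspace \<mu> M (P M)) \<and>
     (\<forall>M\<in>\<M>. \<forall>M'\<in>\<M>. M \<le> M' \<longrightarrow> P M \<subseteq> P M') \<and>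
     (\<forall>f\<in>L2_space \<mu>. \<forall>\<epsilon>>0. \<exists>p\<in>(\<Union>M\<in>\<M>. P M). L2_norm \<mu> (\<lambda>y. f y - p y) < \<epsilon>)"

definition probability_density :: "'a measure \<Rightarrow> ('a \<Rightarrow> real) \<Rightarrow> bool" where
  "probability_density \<mu> f \<longleftrightarrow> f \<in> borel_measurable \<mu> \<and> (AE y in \<mu>. 0 \<le> f y) \<and>
     prob_space (density \<mu> (\<lambda>y. ennreal (f y)))"

text \<open>Time indices start at \<open>1\<close>. The third clause is the law of the Markov chain, the last one the
  conditional independence of the observations given the chain together with their conditional
  laws, multiplied by the probability of the conditioning event.\<close>

definition hidden_markov_model ::
    "'w measure \<Rightarrow> 'a measure \<Rightarrow> nat \<Rightarrow> (nat \<Rightarrow> real) \<Rightarrow> (nat \<Rightarrow> nat \<Rightarrow> real) \<Rightarrow>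
     (nat \<Rightarrow> 'a \<Rightarrow> real) \<Rightarrow> (nat \<Rightarrow> 'w \<Rightarrow> nat) \<Rightarrow> (nat \<Rightarrow> 'w \<Rightarrow> 'a) \<Rightarrow> bool" where
  "hidden_markov_model \<Omega> \<mu> K \<pi> Q f X Y \<longleftrightarrow>
     prob_space \<Omega> \<and>
     (\<forall>j\<ge>1. X j \<in> measurable \<Omega> (count_space {1..K}) \<and> Y j \<in> measurable \<Omega> \<mu>) \<and>
     (\<forall>n\<ge>1. \<forall>k. (\<forall>j\<in>{1..n}. k j \<in> {1..K}) \<longrightarrow>
        measure \<Omega> {\<omega> \<in> space \<Omega>. \<forall>j\<in>{1..n}. X j \<omega> = k j} =
          \<pi> (k 1) * (\<Prod>i\<in>{2..n}. Q (k (i - 1)) (k i))) \<and>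
     (\<forall>k\<in>{1..K}. probability_density \<mu> (f k)) \<and>
     (\<forall>n\<ge>1. \<forall>k A. (\<forall>j\<in>{1..n}. k j \<in> {1..K} \<and> A j \<in> sets \<mu>) \<longrightarrow>
        measure \<Omega> {\<omega> \<in> space \<Omega>. \<forall>j\<in>{1..n}. X j \<omega> = k j \<and> Y j \<omega> \<in> A j} =
          measure \<Omega> {\<omega> \<in> space \<Omega>. \<forall>j\<in>{1..n}. X j \<omega> = k j} *
          (\<Prod>j\<in>{1..n}. measure (density \<mu> (\<lambda>y. ennreal (f (k j) y))) (A j)))"

text \<open>The product space \<open>\<Y>\<^sup>L\<close> consists of the extensional functions on \<open>{1..L}\<close>.\<close>

abbreviation power_measure :: "'a measure \<Rightarrow> nat \<Rightarrow> (nat \<Rightarrow> 'a) measure" where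
  "power_measure \<mu> L \<equiv> PiM {1..L} (\<lambda>_. \<mu>)"

definition hmm_density ::
    "nat \<Rightarrow> nat \<Rightarrow> (nat \<Rightarrow> real) \<Rightarrow> (nat \<Rightarrow> nat \<Rightarrow> real) \<Rightarrow> (nat \<Rightarrow> 'a \<Rightarrow> real) \<Rightarrow> (nat \<Rightarrow> 'a) \<Rightarrow> real" where
  "hmm_density L K \<pi> Q f z =
     (\<Sum>k\<in>PiE {1..L} (\<lambda>_. {1..K}).
        \<pi> (k 1) * (\<Prod>i\<in>{2..L}. Q (k (i - 1)) (k i)) * (\<Prod>i\<in>{1..L}. f (k i) (z i)))"

text \<open>\<open>hmm_model L K G\<close> is \<open>S\<^sub>K\<close> for \<open>G = \<F>\<close> and \<open>S\<^sub>K\<^sub>,\<^sub>M\<close> for \<open>G = \<F> \<inter> P M\<close>.\<close>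

definition hmm_model :: "nat \<Rightarrow> nat \<Rightarrow> ('a \<Rightarrow> real) set \<Rightarrow> ((nat \<Rightarrow> 'a) \<Rightarrow> real) set" where
  "hmm_model L K G = {hmm_density L K \<pi> Q f | \<pi> Q f.
     irreducible_transition_matrix K Q \<and> stationary_distribution K Q \<pi> \<and> (\<forall>k\<in>{1..K}. f k \<in> G)}"

text \<open>The centered empirical process along one trajectory \<open>y\<^sub>1, y\<^sub>2, \<dots>\<close>, for the density \<open>g\<close>.\<close>

definition empirical_process ::
    "'a measure \<Rightarrow> nat \<Rightarrow> ((nat \<Rightarrow> 'a) \<Rightarrow> real) \<Rightarrow> nat \<Rightarrow> (nat \<Rightarrow> 'a) \<Rightarrow> ((nat \<Rightarrow> 'a) \<Rightarrow> real) \<Rightarrow> real" where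
  "empirical_process \<mu> L g n y t =
     (\<Sum>s\<in>{1..n}. t (\<lambda>i\<in>{1..L}. y (s + i - 1))) / real n
     - (\<integral>z. t z * g z \<partial>power_measure \<mu> L)"

text \<open>The supremum is taken in \<open>ereal\<close>, so that it is meaningful without a boundedness proof.\<close>

definition normalized_sup ::
    "'a measure \<Rightarrow> nat \<Rightarrow> ((nat \<Rightarrow> 'a) \<Rightarrow> real) \<Rightarrow> nat \<Rightarrow> (nat \<Rightarrow> 'a) \<Rightarrow>
     ((nat \<Rightarrow> 'a) \<Rightarrow> real) set \<Rightarrow> ((nat \<Rightarrow> 'a) \<Rightarrow> real) \<Rightarrow> real \<Rightarrow> ereal" where
  "normalized_sup \<mu> L g n y S s x =
     (SUP t\<in>S. ereal (\<bar>empirical_process \<mu> L g n y (\<lambda>z. t z - s z)\<bar> /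
        ((L2_norm (power_measure \<mu> L) (\<lambda>z. t z - s z))\<^sup>2 + x\<^sup>2)))"

end

theory Submission
  imports Defs "Jordan_Normal_Form.Determinant" "HOL-Library.Function_Algebras"
begin

text \<open>
  Write \<open>\<Delta> = M K + K\<^sup>2 - 1\<close>. With \<open>x\<^sub>K\<^sub>M\<^sup>2 = 2 \<rho> \<Delta> log n / n + 2 A x / n\<close> the second bound of the theorem
  follows from the first: if \<open>Z \<le> 1/4\<close>, then \<open>2 Z x\<^sub>K\<^sub>M\<^sup>2 \<le> x\<^sub>K\<^sub>M\<^sup>2 / 2\<close>, which is at most the penalty plus
  \<open>A x / n\<close>. What has to be proved is therefore that, off an event of probability less than \<open>exp (-x)\<close>,
  \<open>\<bar>\<nu>(t - s)\<bar> \<le> (\<parallel>t - s\<parallel>\<^sup>2 + x\<^sub>K\<^sub>M\<^sup>2) / 4\<close> for all \<open>K, M \<le> n\<close> and all \<open>t\<close> in the model.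

  \<^bold>\<open>One function.\<close> For a bounded \<open>u\<close> and a threshold \<open>\<epsilon>\<close> that dominates a multiple of \<open>\<parallel>u\<parallel>\<^sup>2\<close>, the
  deviation \<open>\<bar>\<nu>(u)\<bar> \<ge> \<epsilon>\<close> has probability at most \<open>2 exp (1 - \<theta> n \<epsilon> / 2)\<close> (\<open>hmm_tail\<close>): as the variance is
  at most a multiple of \<open>\<epsilon>\<close>, Chernoff's bound can be used with a fixed small \<open>\<theta>\<close>. The chain is allowed
  to be periodic, so mixing is not available. Instead \<open>u(Z\<^sub>s) - E u\<close> is split into two parts.
  Given the chain, the windows whose positions are congruent modulo \<open>L\<close> are independent, and the
  conditional variance of \<open>u(Z\<^sub>s)\<close> is at most \<open>Cinf\<^sup>L \<parallel>u\<parallel>\<^sup>2\<close>, because the conditional density of a window is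
  bounded by \<open>Cinf\<^sup>L\<close> (\<open>independent_windows_exp_bound\<close>). The conditional mean is a function of \<open>L\<close>
  consecutive states which is bounded by the same standard deviation; its centred sum is a sum of \<open>L\<close>
  martingales and a bounded remainder, by conditioning on one state after the other and by the
  Poisson equation \<open>h = c + \<phi> - Q \<phi>\<close>, which is solvable for every irreducible \<open>Q\<close>
  (\<open>poisson_equation\<close>, \<open>chain_window_exp_bound\<close>).

  \<^bold>\<open>All functions.\<close> The factor \<open>log n\<close> of the penalty makes chaining unnecessary: a net whose mesh is a
  power of \<open>1 / n\<close> has a cardinality of logarithm \<open>O(\<Delta> log n)\<close> (\<open>hmm_model_net\<close>), and a single union bound
  over its points and over \<open>K, M \<le> n\<close> suffices. The mesh is needed both in \<open>L\<^sup>2\<close> and at the observed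
  points. To this end elements \<open>w\<^sub>1, \<dots>, w\<^sub>d\<close> of \<open>\<F> \<inter> P M\<close> are chosen for which a determinant is nearly
  maximal; by Cramer's rule all other elements have coordinates of modulus at most \<open>2\<close> with respect to
  them (\<open>near_extremal_basis\<close>). Rounding the coordinates and the entries of \<open>\<pi>\<close> and \<open>Q\<close> then moves \<open>t\<close>
  by at most \<open>\<kappa> F\<close> pointwise, where \<open>F\<close> is the tensor power of \<open>2 \<Sum> \<bar>w\<^sub>j\<bar>\<close>; this controls the difference in
  both senses at once. Nets whose mesh tends to \<open>0\<close> show moreover that the event is measurable.
\<close>

unbundle no vec_syntax

section \<open>Exponential inequalities\<close>

lemma exp_le_quadratic:
  fixes a :: real
  assumes "\<bar>a\<bar> \<le> 1"
  shows "exp a \<le> 1 + a + a\<^sup>2"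
proof (cases "0 \<le> a")
  case True
  then show ?thesis using exp_bound[of a] assms by simp
next
  case False
  define f where "f x = 1 + x + x\<^sup>2 - exp x" for x :: real
  have "f a \<ge> f 0"
  proof (rule DERIV_nonpos_imp_nonincreasing[of a 0 f])
    show "a \<le> 0" using False by simp
    fix x :: real assume x: "a \<le> x" "x \<le> 0"
    have "exp x \<ge> 1 + x" by (rule exp_ge_add_one_self)
    have "(f has_real_derivative (1 + 2 * x - exp x)) (at x)"
      unfolding f_def by (auto intro!: derivative_eq_intros)
    moreover have "1 + 2 * x - exp x \<le> 0" using \<open>exp x \<ge> 1 + x\<close> x by linarith
    ultimately show "\<exists>y. DERIV f x :> y \<and> y \<le> 0" by blast
  qed
  then show ?thesis by (simp add: f_def)
qed

text \<open>Convexity of the exponential. It separates the exponential moment of a sum of dependent parts into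
  those of the single parts, at the price of a factor in the exponent.\<close>

lemma exp_sum_le_mean:
  fixes a :: "'i \<Rightarrow> real"
  assumes "finite I" "I \<noteq> {}"
  shows "exp (\<Sum>i\<in>I. a i) \<le> (\<Sum>i\<in>I. exp (real (card I) * a i)) / real (card I)"
proof -
  have c: "0 < real (card I)" using assms by (simp add: card_gt_0_iff)
  have "exp (\<Sum>i\<in>I. (1 / real (card I)) *\<^sub>R (real (card I) * a i))
      \<le> (\<Sum>i\<in>I. (1 / real (card I)) * exp (real (card I) * a i))"
    using assms c by (intro convex_on_sum[OF assms(1,2) exp_convex]) auto
  moreover have "(\<Sum>i\<in>I. (1 / real (card I)) *\<^sub>R (real (card I) * a i)) = (\<Sum>i\<in>I. a i)"
    using c by (intro sum.cong) auto
  ultimately show ?thesis by (simp add: sum_divide_distrib)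
qed

lemma exp_add_le_mean: "exp (a + b) \<le> (exp (2 * a) + exp (2 * b)) / (2::real)"
proof -
  have "0 \<le> (exp a - exp b)\<^sup>2" by simp
  then show ?thesis
    by (simp add: power2_eq_square algebra_simps flip: exp_add mult_2)
qed

text \<open>Bernstein's bound: the linear term of \<open>exp a \<le> 1 + a + a\<^sup>2\<close> integrates to zero, and the quadratic term
  to a variance.\<close>

lemma (in prob_space) centered_exp_bound:
  fixes X :: "'a \<Rightarrow> real"
  assumes X: "X \<in> borel_measurable M" and bnd: "AE x in M. \<bar>X x\<bar> \<le> B"
    and v: "(\<integral>x. (X x)\<^sup>2 \<partial>M) \<le> v" and th: "\<bar>\<theta>\<bar> * (2 * B) \<le> 1"
  shows "(\<integral>\<^sup>+x. ennreal (exp (\<theta> * (X x - (\<integral>x. X x \<partial>M)))) \<partial>M) \<le> ennreal (exp (\<theta>\<^sup>2 * v))"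
proof -
  define m where "m = (\<integral>x. X x \<partial>M)"
  have iX: "integrable M X"
    by (rule integrable_const_bound[of _ B]) (use bnd X in auto)
  have iX2: "integrable M (\<lambda>x. (X x)\<^sup>2)"
  proof (rule integrable_const_bound[of _ "B\<^sup>2"])
    show "AE x in M. norm ((X x)\<^sup>2) \<le> B\<^sup>2"
      using bnd by eventually_elim (metis abs_le_square_iff abs_of_nonneg abs_ge_zero norm_power
          order_trans power_mono real_norm_def)
  qed (use X in auto)
  have mB: "\<bar>m\<bar> \<le> B"
  proof -
    have "\<bar>m\<bar> \<le> (\<integral>x. \<bar>X x\<bar> \<partial>M)" unfolding m_def by (rule integral_abs_bound)
    also have "\<dots> \<le> (\<integral>x. B \<partial>M)" using bnd iX by (intro integral_mono_AE) auto
    finally show ?thesis by (simp add: prob_space)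
  qed
  have "(\<integral>\<^sup>+x. ennreal (exp (\<theta> * (X x - m))) \<partial>M)
      \<le> (\<integral>\<^sup>+x. ennreal (1 + \<theta> * (X x - m) + \<theta>\<^sup>2 * (X x - m)\<^sup>2) \<partial>M)"
  proof (rule nn_integral_mono_AE)
    show "AE x in M. ennreal (exp (\<theta> * (X x - m))) \<le> ennreal (1 + \<theta> * (X x - m) + \<theta>\<^sup>2 * (X x - m)\<^sup>2)"
      using bnd
    proof eventually_elim
      case (elim x)
      then have "\<bar>X x - m\<bar> \<le> 2 * B" using mB by linarith
      then have "\<bar>\<theta> * (X x - m)\<bar> \<le> \<bar>\<theta>\<bar> * (2 * B)" by (simp add: abs_mult mult_left_mono)
      then have "\<bar>\<theta> * (X x - m)\<bar> \<le> 1" using th by linarith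
      from exp_le_quadratic[OF this] show ?case by (simp add: power_mult_distrib ennreal_leI)
    qed
  qed
  also have "\<dots> = ennreal (\<integral>x. 1 + \<theta> * (X x - m) + \<theta>\<^sup>2 * (X x - m)\<^sup>2 \<partial>M)"
  proof (rule nn_integral_eq_integral)
    show "integrable M (\<lambda>x. 1 + \<theta> * (X x - m) + \<theta>\<^sup>2 * (X x - m)\<^sup>2)"
      using iX iX2 by (simp add: power2_diff)
    have "0 \<le> 1 + a + a\<^sup>2" for a :: real
    proof -
      have "1 + a + a\<^sup>2 = (a + 1 / 2)\<^sup>2 + 3 / 4" by (simp add: power2_eq_square algebra_simps)
      then show ?thesis by simp
    qed
    from this[of "\<theta> * (X x - m)" for x]
    show "AE x in M. 0 \<le> 1 + \<theta> * (X x - m) + \<theta>\<^sup>2 * (X x - m)\<^sup>2"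
      by (simp add: power_mult_distrib)
  qed
  also have "(\<integral>x. 1 + \<theta> * (X x - m) + \<theta>\<^sup>2 * (X x - m)\<^sup>2 \<partial>M)
      = (\<integral>x. (1 - \<theta> * m + \<theta>\<^sup>2 * m\<^sup>2) + (\<theta> - 2 * \<theta>\<^sup>2 * m) * X x + \<theta>\<^sup>2 * (X x)\<^sup>2 \<partial>M)"
    by (intro Bochner_Integration.integral_cong refl) (simp add: power2_eq_square algebra_simps)
  also have "\<dots> = (1 - \<theta> * m + \<theta>\<^sup>2 * m\<^sup>2) + (\<theta> - 2 * \<theta>\<^sup>2 * m) * m + \<theta>\<^sup>2 * (\<integral>x. (X x)\<^sup>2 \<partial>M)"
    using iX iX2 by (simp add: m_def prob_space)
  also have "\<dots> = 1 - \<theta>\<^sup>2 * m\<^sup>2 + \<theta>\<^sup>2 * (\<integral>x. (X x)\<^sup>2 \<partial>M)"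
    by (simp add: power2_eq_square algebra_simps)
  also have "\<dots> \<le> 1 + \<theta>\<^sup>2 * v"
  proof -
    have "0 \<le> \<theta>\<^sup>2 * m\<^sup>2" by simp
    then show ?thesis using mult_left_mono[OF v zero_le_power2[of \<theta>]] by linarith
  qed
  also have "\<dots> \<le> exp (\<theta>\<^sup>2 * v)" by (rule exp_ge_add_one_self)
  finally show ?thesis by (simp add: m_def ennreal_leI)
qed

section \<open>The Poisson equation of an irreducible chain\<close>

lemma transition_power_nonneg:
  assumes "transition_matrix K Q" "k \<in> {1..K}" "l \<in> {1..K}"
  shows "0 \<le> transition_power K Q m k l"
  using assms(2,3)
proof (induction m arbitrary: l)
  case (Suc m)
  then show ?case
    using assms(1) by (auto simp: transition_matrix_def intro!: sum_nonneg mult_nonneg_nonneg)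
qed auto

lemma transition_power_row_sum:
  assumes "transition_matrix K Q" "k \<in> {1..K}"
  shows "(\<Sum>l\<in>{1..K}. transition_power K Q m k l) = 1"
proof (induction m)
  case 0
  then show ?case using assms by simp
next
  case (Suc m)
  have "(\<Sum>l\<in>{1..K}. transition_power K Q (Suc m) k l)
      = (\<Sum>j\<in>{1..K}. transition_power K Q m k j * (\<Sum>l\<in>{1..K}. Q j l))"
    by (simp add: sum_distrib_left) (rule sum.swap)
  also have "\<dots> = (\<Sum>j\<in>{1..K}. transition_power K Q m k j)"
    using assms(1) by (intro sum.cong) (auto simp: transition_matrix_def)
  finally show ?case using Suc by simp
qed

lemma harmonic_transition_power:
  assumes "\<forall>k\<in>{1..K}. (\<Sum>l\<in>{1..K}. Q k l * \<psi> l) = \<psi> k" "k \<in> {1..K}"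
  shows "(\<Sum>l\<in>{1..K}. transition_power K Q m k l * \<psi> l) = (\<psi> k :: real)"
proof (induction m)
  case 0
  have "(\<Sum>l\<in>{1..K}. transition_power K Q 0 k l * \<psi> l) = (\<Sum>l\<in>{1..K}. if k = l then \<psi> l else 0)"
    by (intro sum.cong) auto
  then show ?case using assms(2) by simp
next
  case (Suc m)
  have "(\<Sum>l\<in>{1..K}. transition_power K Q (Suc m) k l * \<psi> l)
      = (\<Sum>j\<in>{1..K}. transition_power K Q m k j * (\<Sum>l\<in>{1..K}. Q j l * \<psi> l))"
    by (simp add: sum_distrib_left sum_distrib_right mult.assoc) (rule sum.swap)
  also have "\<dots> = (\<Sum>j\<in>{1..K}. transition_power K Q m k j * \<psi> j)"
    using assms(1) by (intro sum.cong) auto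
  finally show ?case using Suc by simp
qed

text \<open>The maximum principle. At a maximum of \<open>\<psi>\<close> the left-hand side is nonnegative and at a minimum it is
  nonpositive, whence \<open>c = 0\<close>; then \<open>\<psi>\<close> is harmonic for all powers of \<open>Q\<close>, and it attains its maximum at
  every state that can be reached from a maximum.\<close>

lemma irreducible_constant_defect:
  assumes Q: "irreducible_transition_matrix K Q" and "1 \<le> K"
    and eq: "\<forall>k\<in>{1..K}. \<psi> k - (\<Sum>l\<in>{1..K}. Q k l * \<psi> l) = (c::real)"
  shows "c = 0 \<and> (\<forall>k\<in>{1..K}. \<forall>l\<in>{1..K}. \<psi> k = \<psi> l)"
proof -
  have tm: "transition_matrix K Q" using Q by (simp add: irreducible_transition_matrix_def)
  have eq': "\<psi> k = c + (\<Sum>l\<in>{1..K}. Q k l * \<psi> l)" if "k \<in> {1..K}" for k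
    using bspec[OF eq that] by simp
  have ne: "{1..K} \<noteq> {}" "finite {1..K}" using \<open>1 \<le> K\<close> by auto
  obtain m where m: "m \<in> {1..K}" "\<forall>k\<in>{1..K}. \<psi> k \<le> \<psi> m"
    using ne Max_in[of "\<psi> ` {1..K}"] Max_ge[of "\<psi> ` {1..K}"] by fastforce
  obtain m' where m': "m' \<in> {1..K}" "\<forall>k\<in>{1..K}. \<psi> m' \<le> \<psi> k"
    using ne Min_in[of "\<psi> ` {1..K}"] Min_le[of "\<psi> ` {1..K}"] by fastforce
  have "(\<Sum>l\<in>{1..K}. Q m l * \<psi> l) \<le> (\<Sum>l\<in>{1..K}. Q m l * \<psi> m)"
    using tm m by (intro sum_mono mult_left_mono) (auto simp: transition_matrix_def)
  also have "\<dots> = \<psi> m" using tm m by (simp add: transition_matrix_def flip: sum_distrib_right)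
  finally have "0 \<le> c" using eq'[OF m(1)] by linarith
  have "\<psi> m' = (\<Sum>l\<in>{1..K}. Q m' l * \<psi> m')"
    using tm m' by (simp add: transition_matrix_def flip: sum_distrib_right)
  also have "\<dots> \<le> (\<Sum>l\<in>{1..K}. Q m' l * \<psi> l)"
    using tm m' by (intro sum_mono mult_left_mono) (auto simp: transition_matrix_def)
  finally have "c \<le> 0" using eq'[OF m'(1)] by linarith
  with \<open>0 \<le> c\<close> have c: "c = 0" by simp
  have harm: "\<forall>k\<in>{1..K}. (\<Sum>l\<in>{1..K}. Q k l * \<psi> l) = \<psi> k"
    using eq' c by simp
  have "\<psi> l = \<psi> m" if l: "l \<in> {1..K}" for l
  proof -
    obtain t where t: "0 < transition_power K Q t m l"
      using Q m l unfolding irreducible_transition_matrix_def by blast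
    have "(\<Sum>j\<in>{1..K}. transition_power K Q t m j * (\<psi> m - \<psi> j)) = 0"
      using harmonic_transition_power[OF harm m(1), of t] transition_power_row_sum[OF tm m(1), of t]
      by (simp add: right_diff_distrib sum_subtractf flip: sum_distrib_right)
    moreover have "0 \<le> transition_power K Q t m j * (\<psi> m - \<psi> j)" if "j \<in> {1..K}" for j
      using transition_power_nonneg[OF tm m(1) that] bspec[OF m(2) that] by simp
    ultimately have "transition_power K Q t m l * (\<psi> m - \<psi> l) = 0"
      using l by (intro sum_nonneg_0[of "{1..K}" "\<lambda>j. transition_power K Q t m j * (\<psi> m - \<psi> j)"]) simp_all
    then show ?thesis using t by simp
  qed
  then show ?thesis using c by metis
qed

text \<open>The endomorphism \<open>\<psi> \<mapsto> \<psi> - Q \<psi> + \<psi>(1)\<close> of \<open>\<real>\<^sup>K\<close> is injective: on its kernel \<open>\<psi> - Q \<psi>\<close> is constant, so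
  this constant and with it \<open>\<psi>(1)\<close> vanish, and \<open>\<psi>\<close> is constant. Hence it is invertible, and
  \<open>c = \<phi>(1)\<close> solves the equation. The bound of \<open>\<phi>\<close> is a norm of the inverse matrix.\<close>

lemma poisson_equation:
  assumes Q: "irreducible_transition_matrix K Q" and K: "1 \<le> K"
  shows "\<exists>C\<ge>0. \<forall>h::nat\<Rightarrow>real. \<exists>c \<phi>.
    (\<forall>k\<in>{1..K}. h k = c + \<phi> k - (\<Sum>l\<in>{1..K}. Q k l * \<phi> l)) \<and>
    (\<forall>b. (\<forall>k\<in>{1..K}. \<bar>h k\<bar> \<le> b) \<longrightarrow> (\<forall>k\<in>{1..K}. \<bar>\<phi> k\<bar> \<le> C * b))"
proof -
  define A :: "real mat" where
    "A = mat K K (\<lambda>(i, j). (if i = j then 1 else 0) - Q (Suc i) (Suc j) + (if j = 0 then 1 else 0))"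
  have A: "A \<in> carrier_mat K K" by (simp add: A_def)
  have shift: "(\<Sum>l\<in>{1..K}. g l) = (\<Sum>j<K. g (Suc j))" for g :: "nat \<Rightarrow> real"
    by (simp add: sum.atLeast1_atMost_eq)
  have Ax: "(A *\<^sub>v x) $ i = x $ i - (\<Sum>l\<in>{1..K}. Q (Suc i) l * x $ (l - 1)) + x $ 0"
    if x: "x \<in> carrier_vec K" and i: "i < K" for x i
  proof -
    have "(A *\<^sub>v x) $ i = (\<Sum>j<K. ((if i = j then 1 else 0) - Q (Suc i) (Suc j)
        + (if j = 0 then 1 else 0)) * x $ j)"
      using x i A by (simp add: A_def scalar_prod_def lessThan_atLeast0)
    also have "\<dots> = (\<Sum>j<K. (if i = j then x $ j else 0) - Q (Suc i) (Suc j) * x $ j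
        + (if j = 0 then x $ j else 0))"
      by (intro sum.cong) (auto simp: algebra_simps)
    also have "\<dots> = x $ i - (\<Sum>j<K. Q (Suc i) (Suc j) * x $ j) + x $ 0"
      using i K by (simp add: sum.distrib sum_subtractf)
    finally show ?thesis unfolding shift by simp
  qed
  have det: "det A \<noteq> 0"
  proof
    assume "det A = 0"
    then obtain v where v: "v \<in> carrier_vec K" "v \<noteq> 0\<^sub>v K" "A *\<^sub>v v = 0\<^sub>v K"
      using det_0_iff_vec_prod_zero_field[OF A] by auto
    have "\<forall>k\<in>{1..K}. v $ (k-1) - (\<Sum>l\<in>{1..K}. Q k l * v $ (l - 1)) = - (v $ 0)"
    proof
      fix k assume k: "k \<in> {1..K}"
      then have k1: "k - 1 < K" by auto
      from k have "(A *\<^sub>v v) $ (k - 1) = 0" using v(3) k by (auto simp: Suc_le_eq)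
      then show "v $ (k-1) - (\<Sum>l\<in>{1..K}. Q k l * v $ (l - 1)) = - (v $ 0)"
        using Ax[OF v(1) k1] k by simp
    qed
    then have *: "- (v $ 0) = 0 \<and> (\<forall>k\<in>{1..K}. \<forall>l\<in>{1..K}. v $ (k-1) = v $ (l-1))"
      by (rule irreducible_constant_defect[OF Q K, where \<psi> = "\<lambda>k. v $ (k - 1)"])
    have 0: "v $ 0 = 0" using * by simp
    have c: "v $ (k-1) = v $ (l-1)" if "k \<in> {1..K}" "l \<in> {1..K}" for k l
      using * that by blast
    have "v $ i = 0" if "i < K" for i
      using c[of "Suc i" 1] 0 that K by simp
    then have "v = 0\<^sub>v K" using v(1) by (intro eq_vecI) auto
    then show False using v by simp
  qed
  define B where "B = (1 / det A) \<cdot>\<^sub>m adj_mat A"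
  have B: "B \<in> carrier_mat K K" using adj_mat(1)[OF A] by (simp add: B_def)
  have AB: "A * B = 1\<^sub>m K"
  proof -
    have "A * B = (1 / det A) \<cdot>\<^sub>m (det A \<cdot>\<^sub>m 1\<^sub>m K)"
      unfolding B_def using adj_mat[OF A] by (simp add: mult_smult_distrib[OF A])
    also have "\<dots> = 1\<^sub>m K" using det by (intro eq_matI) auto
    finally show ?thesis .
  qed
  define C where "C = (\<Sum>i<K. \<Sum>j<K. \<bar>B $$ (i, j)\<bar>)"
  have C0: "0 \<le> C" by (auto simp: C_def intro!: sum_nonneg)
  show ?thesis
  proof (rule exI[of _ C], intro conjI allI C0)
    fix h :: "nat \<Rightarrow> real"
    define hv where "hv = vec K (\<lambda>i. h (Suc i))"
    define x where "x = B *\<^sub>v hv"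
    have hv: "hv \<in> carrier_vec K" by (simp add: hv_def)
    have x: "x \<in> carrier_vec K" using B hv unfolding x_def by (rule mult_mat_vec_carrier)
    have "A *\<^sub>v x = hv"
      unfolding x_def using A B hv AB by (simp flip: assoc_mult_mat_vec[OF A B hv])
    show "\<exists>c \<phi>. (\<forall>k\<in>{1..K}. h k = c + \<phi> k - (\<Sum>l\<in>{1..K}. Q k l * \<phi> l)) \<and>
      (\<forall>b. (\<forall>k\<in>{1..K}. \<bar>h k\<bar> \<le> b) \<longrightarrow> (\<forall>k\<in>{1..K}. \<bar>\<phi> k\<bar> \<le> C * b))"
    proof (intro exI[of _ "x $ 0"] exI[of _ "\<lambda>k. x $ (k - 1)"] conjI ballI allI impI)
      fix k assume k: "k \<in> {1..K}"
      then have k1: "k - 1 < K" by auto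
      have "(A *\<^sub>v x) $ (k - 1) = h k"
        unfolding \<open>A *\<^sub>v x = hv\<close> hv_def using k k1 by simp
      then show "h k = x $ 0 + x $ (k - 1) - (\<Sum>l\<in>{1..K}. Q k l * x $ (l - 1))"
        using Ax[OF x k1] k by simp
    next
      fix b k assume b: "\<forall>k\<in>{1..K}. \<bar>h k\<bar> \<le> b" and k: "k \<in> {1..K}"
      have b0: "0 \<le> b" using b k by force
      have k1: "k - 1 < K" using k by auto
      then have "x $ (k - 1) = (\<Sum>j<K. B $$ (k - 1, j) * h (Suc j))"
        using B k by (simp add: x_def hv_def scalar_prod_def lessThan_atLeast0)
      then have "\<bar>x $ (k - 1)\<bar> \<le> (\<Sum>j<K. \<bar>B $$ (k - 1, j) * h (Suc j)\<bar>)" by simp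
      also have "\<dots> \<le> (\<Sum>j<K. \<bar>B $$ (k - 1, j)\<bar> * b)"
        using b by (intro sum_mono) (auto simp: abs_mult intro!: mult_left_mono)
      also have "\<dots> = (\<Sum>j<K. \<bar>B $$ (k - 1, j)\<bar>) * b" by (simp add: sum_distrib_right)
      also have "\<dots> \<le> C * b"
        unfolding C_def using k b0
        by (intro mult_right_mono member_le_sum[of "k - 1" "{..<K}" "\<lambda>i. \<Sum>j<K. \<bar>B $$ (i, j)\<bar>"] sum_nonneg)
          (auto intro!: sum_nonneg)
      finally show "\<bar>x $ (k - 1)\<bar> \<le> C * b" .
    qed
  qed
qed

section \<open>Exponential moments along a finite chain\<close>

definition path_weight ::
    "(nat \<Rightarrow> real) \<Rightarrow> (nat \<Rightarrow> nat \<Rightarrow> real) \<Rightarrow> nat \<Rightarrow> (nat \<Rightarrow> nat) \<Rightarrow> real" where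
  "path_weight \<pi> Q N k = \<pi> (k 1) * (\<Prod>i\<in>{2..N}. Q (k (i - 1)) (k i))"

definition chain_mean ::
    "nat \<Rightarrow> (nat \<Rightarrow> real) \<Rightarrow> (nat \<Rightarrow> nat \<Rightarrow> real) \<Rightarrow> nat \<Rightarrow> ((nat \<Rightarrow> nat) \<Rightarrow> real) \<Rightarrow> real" where
  "chain_mean K \<pi> Q N F = (\<Sum>k\<in>PiE {1..N} (\<lambda>_. {1..K}). path_weight \<pi> Q N k * F k)"

definition window :: "nat \<Rightarrow> nat \<Rightarrow> (nat \<Rightarrow> 'b) \<Rightarrow> nat \<Rightarrow> 'b" where
  "window L s y = (\<lambda>i\<in>{1..L}. y (s + i - 1))"

lemma path_weight_nonneg:
  assumes "transition_matrix K Q" "stationary_distribution K Q \<pi>" "1 \<le> N"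
    "k \<in> PiE {1..N} (\<lambda>_. {1..K})"
  shows "0 \<le> path_weight \<pi> Q N k"
proof -
  have k: "k i \<in> {1..K}" if "1 \<le> i" "i \<le> N" for i using assms(4) that by auto
  have "0 \<le> Q (k (i - 1)) (k i)" if "i \<in> {2..N}" for i
    using assms(1) k[of "i - 1"] k[of i] that unfolding transition_matrix_def by auto
  moreover have "0 \<le> \<pi> (k 1)" using assms(2) k[of 1] \<open>1 \<le> N\<close> by (auto simp: stationary_distribution_def)
  ultimately show ?thesis by (auto simp: path_weight_def intro!: mult_nonneg_nonneg prod_nonneg)
qed

lemma chain_mean_mono:
  assumes "transition_matrix K Q" "stationary_distribution K Q \<pi>" "1 \<le> N"
    and "\<And>k. k \<in> PiE {1..N} (\<lambda>_. {1..K}) \<Longrightarrow> F k \<le> G k"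
  shows "chain_mean K \<pi> Q N F \<le> chain_mean K \<pi> Q N G"
  unfolding chain_mean_def
  by (intro sum_mono mult_left_mono path_weight_nonneg[OF assms(1-3)] assms(4))

lemma chain_mean_cmult: "chain_mean K \<pi> Q N (\<lambda>k. F k * c) = chain_mean K \<pi> Q N F * c"
  by (simp add: chain_mean_def sum_distrib_right mult.assoc)

lemma chain_mean_sum:
  "chain_mean K \<pi> Q N (\<lambda>k. \<Sum>i\<in>I. F i k) = (\<Sum>i\<in>I. chain_mean K \<pi> Q N (F i))"
  by (simp add: chain_mean_def sum_distrib_left) (rule sum.swap)

lemma chain_mean_1: "chain_mean K \<pi> Q 1 F = (\<Sum>x\<in>{1..K}. \<pi> x * F (\<lambda>i\<in>{1}. x))"
proof -
  have *: "PiE {1..1::nat} (\<lambda>_. {1..K}) = (\<lambda>x. \<lambda>i\<in>{1}. x) ` {1..K}"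
    by (fastforce simp: fun_eq_iff image_iff extensional_def PiE_iff restrict_def)
  have inj: "inj_on (\<lambda>x. \<lambda>i\<in>{1::nat}. x) {1..K}" by (auto simp: inj_on_def fun_eq_iff) 
  show ?thesis
    unfolding chain_mean_def * by (subst sum.reindex[OF inj]) (simp add: path_weight_def)
qed

lemma chain_mean_Suc:
  assumes "1 \<le> N"
  shows "chain_mean K \<pi> Q (Suc N) F =
    chain_mean K \<pi> Q N (\<lambda>k. \<Sum>l\<in>{1..K}. Q (k N) l * F (k(Suc N := l)))"
proof -
  have I: "{1..Suc N} = insert (Suc N) {1..N}" by auto
  have inj: "inj_on (\<lambda>(y, g). g(Suc N := y)) ({1..K} \<times> PiE {1..N} (\<lambda>_. {1..K}))"
    by (rule inj_combinator) simp
  have w: "path_weight \<pi> Q (Suc N) (g(Suc N := y)) = path_weight \<pi> Q N g * Q (g N) y" for g y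
  proof -
    have "{2..Suc N} = insert (Suc N) {2..N}" using assms by auto
    moreover have "(\<Prod>i\<in>{2..N}. Q ((g(Suc N := y)) (i - 1)) ((g(Suc N := y)) i))
        = (\<Prod>i\<in>{2..N}. Q (g (i - 1)) (g i))"
      by (intro prod.cong) auto
    ultimately show ?thesis using assms by (simp add: path_weight_def)
  qed
  have "chain_mean K \<pi> Q (Suc N) F = (\<Sum>(y, g)\<in>{1..K} \<times> PiE {1..N} (\<lambda>_. {1..K}).
      path_weight \<pi> Q (Suc N) (g(Suc N := y)) * F (g(Suc N := y)))"
    unfolding chain_mean_def I PiE_insert_eq
    by (subst sum.reindex[OF inj]) (simp add: case_prod_unfold)
  also have "\<dots> = (\<Sum>g\<in>PiE {1..N} (\<lambda>_. {1..K}). \<Sum>y\<in>{1..K}.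
      path_weight \<pi> Q (Suc N) (g(Suc N := y)) * F (g(Suc N := y)))"
    by (subst sum.cartesian_product[symmetric]) (rule sum.swap)
  finally show ?thesis by (simp add: chain_mean_def w sum_distrib_left mult.assoc)
qed

lemma chain_mean_one:
  assumes "transition_matrix K Q" "stationary_distribution K Q \<pi>" "1 \<le> N"
  shows "chain_mean K \<pi> Q N (\<lambda>_. 1) = 1"
  using assms(3)
proof (induction N rule: dec_induct)
  case base
  then show ?case using assms by (simp add: chain_mean_1[simplified] stationary_distribution_def)
next
  case (step N)
  have "chain_mean K \<pi> Q (Suc N) (\<lambda>_. 1) = chain_mean K \<pi> Q N (\<lambda>_. 1)"
    unfolding chain_mean_Suc[OF step(1)] unfolding chain_mean_def
  proof (intro sum.cong refl)
    fix k assume "k \<in> PiE {1..N} (\<lambda>_. {1..K})"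
    then have "k N \<in> {1..K}" using step(1) by auto
    then show "path_weight \<pi> Q N k * (\<Sum>l\<in>{1..K}. Q (k N) l * 1) = path_weight \<pi> Q N k * 1"
      using assms(1) by (simp add: transition_matrix_def)
  qed
  then show ?case using step by simp
qed

text \<open>Azuma's argument: given the past, the increment \<open>\<Psi> (Suc N)\<close> has mean zero, so that it multiplies the
  exponential moment by at most \<open>1 + \<theta>\<^sup>2 D\<^sup>2\<close>.\<close>

lemma chain_martingale_exp_bound:
  fixes \<Psi> :: "nat \<Rightarrow> (nat \<Rightarrow> nat) \<Rightarrow> real"
  assumes tm: "transition_matrix K Q" and st: "stationary_distribution K Q \<pi>" and N: "1 \<le> N"
    and loc: "\<And>m k k'. (\<And>j. 1 \<le> j \<Longrightarrow> j \<le> m \<Longrightarrow> k j = k' j) \<Longrightarrow> \<Psi> m k = \<Psi> m k'"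
    and cen: "\<And>m k. 2 \<le> m \<Longrightarrow> (\<And>j. 1 \<le> j \<Longrightarrow> j < m \<Longrightarrow> k j \<in> {1..K}) \<Longrightarrow>
        (\<Sum>l\<in>{1..K}. Q (k (m - 1)) l * \<Psi> m (k(m := l))) = 0"
    and bnd: "\<And>m k. 2 \<le> m \<Longrightarrow> (\<And>j. 1 \<le> j \<Longrightarrow> j \<le> m \<Longrightarrow> k j \<in> {1..K}) \<Longrightarrow> \<bar>\<Psi> m k\<bar> \<le> D"
    and th: "\<bar>\<theta>\<bar> * D \<le> 1"
  shows "chain_mean K \<pi> Q N (\<lambda>k. exp (\<theta> * (\<Sum>m\<in>{2..N}. \<Psi> m k))) \<le> exp (\<theta>\<^sup>2 * D\<^sup>2 * real N)"
  using N
proof (induction N rule: dec_induct)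
  case base
  then show ?case using chain_mean_one[OF tm st, of 1] by simp
next
  case (step N)
  let ?S = "\<lambda>k. \<Sum>m\<in>{2..N}. \<Psi> m k"
  have one: "(\<Sum>l\<in>{1..K}. Q (k N) l * exp (\<theta> * (\<Sum>m\<in>{2..Suc N}. \<Psi> m (k(Suc N := l)))))
      \<le> exp (\<theta> * ?S k) * exp (\<theta>\<^sup>2 * D\<^sup>2)" if k: "k \<in> PiE {1..N} (\<lambda>_. {1..K})" for k
  proof -
    have kj: "k j \<in> {1..K}" if "1 \<le> j" "j \<le> N" for j using k that by auto
    have Qn: "0 \<le> Q (k N) l" if "l \<in> {1..K}" for l
      using tm kj[of N] step(1) that by (auto simp: transition_matrix_def)
    have Q1: "(\<Sum>l\<in>{1..K}. Q (k N) l) = 1"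
      using tm kj[of N] step(1) by (auto simp: transition_matrix_def)
    define \<psi> where "\<psi> l = \<Psi> (Suc N) (k(Suc N := l))" for l
    have S: "(\<Sum>m\<in>{2..Suc N}. \<Psi> m (k(Suc N := l))) = ?S k + \<psi> l" for l
    proof -
      have "{2..Suc N} = insert (Suc N) {2..N}" using step(1) by auto
      moreover have "(\<Sum>m\<in>{2..N}. \<Psi> m (k(Suc N := l))) = ?S k"
        by (intro sum.cong loc) auto
      ultimately show ?thesis by (simp add: \<psi>_def)
    qed
    have \<psi>b: "\<bar>\<psi> l\<bar> \<le> D" if "l \<in> {1..K}" for l
      unfolding \<psi>_def
    proof (rule bnd)
      show "2 \<le> Suc N" using step(1) by simp
      show "(k(Suc N := l)) j \<in> {1..K}" if "1 \<le> j" "j \<le> Suc N" for j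
        using kj[of j] that \<open>l \<in> {1..K}\<close> by (cases "j = Suc N") simp_all
    qed
    have \<psi>c: "(\<Sum>l\<in>{1..K}. Q (k N) l * \<psi> l) = 0"
      using cen[of "Suc N" k] step(1) kj unfolding \<psi>_def by simp
    have "(\<Sum>l\<in>{1..K}. Q (k N) l * exp (\<theta> * \<psi> l))
        \<le> (\<Sum>l\<in>{1..K}. Q (k N) l * (1 + \<theta> * \<psi> l + \<theta>\<^sup>2 * D\<^sup>2))"
    proof (intro sum_mono mult_left_mono Qn)
      fix l assume l: "l \<in> {1..K}"
      have "\<bar>\<theta> * \<psi> l\<bar> \<le> \<bar>\<theta>\<bar> * D" using \<psi>b[OF l] by (simp add: abs_mult mult_left_mono)
      then have *: "\<bar>\<theta> * \<psi> l\<bar> \<le> 1" using th by simp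
      have "(\<theta> * \<psi> l)\<^sup>2 \<le> (\<theta> * D)\<^sup>2"
        using \<psi>b[OF l] by (simp add: power_mult_distrib mult_left_mono abs_le_square_iff[symmetric])
      then show "exp (\<theta> * \<psi> l) \<le> 1 + \<theta> * \<psi> l + \<theta>\<^sup>2 * D\<^sup>2"
        using exp_le_quadratic[OF *] by (simp add: power_mult_distrib)
    qed
    also have "\<dots> = (\<Sum>l\<in>{1..K}. Q (k N) l) + \<theta> * (\<Sum>l\<in>{1..K}. Q (k N) l * \<psi> l)
        + (\<Sum>l\<in>{1..K}. Q (k N) l) * (\<theta>\<^sup>2 * D\<^sup>2)"
      by (simp add: sum.distrib sum_distrib_left sum_distrib_right algebra_simps)
    also have "\<dots> = 1 + \<theta>\<^sup>2 * D\<^sup>2" using Q1 \<psi>c by simp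
    also have "\<dots> \<le> exp (\<theta>\<^sup>2 * D\<^sup>2)" by (rule exp_ge_add_one_self)
    finally have "(\<Sum>l\<in>{1..K}. Q (k N) l * exp (\<theta> * \<psi> l)) \<le> exp (\<theta>\<^sup>2 * D\<^sup>2)" .
    then have "exp (\<theta> * ?S k) * (\<Sum>l\<in>{1..K}. Q (k N) l * exp (\<theta> * \<psi> l))
        \<le> exp (\<theta> * ?S k) * exp (\<theta>\<^sup>2 * D\<^sup>2)" by simp
    moreover have "exp (\<theta> * ?S k) * (\<Sum>l\<in>{1..K}. Q (k N) l * exp (\<theta> * \<psi> l)) =
        (\<Sum>l\<in>{1..K}. Q (k N) l * exp (\<theta> * (\<Sum>m\<in>{2..Suc N}. \<Psi> m (k(Suc N := l)))))"
      unfolding sum_distrib_left[of "exp (\<theta> * ?S k)"]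
      by (intro sum.cong refl) (simp only: S, simp only: distrib_left exp_add mult.assoc mult.left_commute)
    ultimately show ?thesis by (simp only:)
  qed
  have "chain_mean K \<pi> Q (Suc N) (\<lambda>k. exp (\<theta> * (\<Sum>m\<in>{2..Suc N}. \<Psi> m k)))
      \<le> chain_mean K \<pi> Q N (\<lambda>k. exp (\<theta> * ?S k) * exp (\<theta>\<^sup>2 * D\<^sup>2))"
    unfolding chain_mean_Suc[OF step(1)] by (intro chain_mean_mono[OF tm st step(1)] one)
  also have "\<dots> \<le> exp (\<theta>\<^sup>2 * D\<^sup>2 * real N) * exp (\<theta>\<^sup>2 * D\<^sup>2)"
    unfolding chain_mean_cmult using step.IH by simp
  also have "\<dots> = exp (\<theta>\<^sup>2 * D\<^sup>2 * real (Suc N))" by (simp add: algebra_simps flip: exp_add)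
  finally show ?case .
qed

text \<open>The conditional mean of \<open>h\<close> given all but the last \<open>j\<close> of the \<open>L\<close> states of a window. It is a function of
  the whole path of which only the coordinates \<open>1..L - j\<close> matter.\<close>

primrec backward_mean ::
    "nat \<Rightarrow> (nat \<Rightarrow> nat \<Rightarrow> real) \<Rightarrow> nat \<Rightarrow> ((nat \<Rightarrow> nat) \<Rightarrow> real) \<Rightarrow> nat \<Rightarrow> (nat \<Rightarrow> nat) \<Rightarrow> real" where
  "backward_mean K Q L h 0 = h"
| "backward_mean K Q L h (Suc j) =
     (\<lambda>k. \<Sum>l\<in>{1..K}. Q (k (L - Suc j)) l * backward_mean K Q L h j (k(L - j := l)))"

lemma backward_mean_local:
  assumes "\<And>k k'. (\<And>i. i \<in> {1..L} \<Longrightarrow> k i = k' i) \<Longrightarrow> h k = h k'"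
    and "j < L" and "\<And>i. i \<in> {1..L - j} \<Longrightarrow> k i = k' i"
  shows "backward_mean K Q L h j k = backward_mean K Q L h j k'"
  using assms(2,3)
proof (induction j arbitrary: k k')
  case 0
  then show ?case using assms(1)[of k k'] by simp
next
  case (Suc j)
  have "k (L - Suc j) = k' (L - Suc j)" using Suc.prems by simp
  moreover have "backward_mean K Q L h j (k(L - j := l)) = backward_mean K Q L h j (k'(L - j := l))" for l
  proof (rule Suc.IH)
    show "j < L" using Suc.prems by simp
    fix i assume "i \<in> {1..L - j}"
    then show "(k(L - j := l)) i = (k'(L - j := l)) i"
      using Suc.prems(2)[of i] by (cases "i = L - j") auto
  qed
  ultimately show ?case by simp
qed

lemma backward_mean_bound:
  assumes tm: "transition_matrix K Q"
    and b: "\<And>k. (\<And>i. i \<in> {1..L} \<Longrightarrow> k i \<in> {1..K}) \<Longrightarrow> \<bar>h k\<bar> \<le> b"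
    and "j < L" and "\<And>i. i \<in> {1..L - j} \<Longrightarrow> k i \<in> {1..K}"
  shows "\<bar>backward_mean K Q L h j k\<bar> \<le> b"
  using assms(3,4)
proof (induction j arbitrary: k)
  case 0
  then show ?case using b[of k] by simp
next
  case (Suc j)
  let ?s = "L - Suc j"
  have ks: "k ?s \<in> {1..K}" using Suc.prems by simp
  have Q0: "0 \<le> Q (k ?s) l" if "l \<in> {1..K}" for l
    using tm ks that unfolding transition_matrix_def by blast
  have Q1: "(\<Sum>l\<in>{1..K}. Q (k ?s) l) = 1"
    using tm ks unfolding transition_matrix_def by blast
  have IH: "\<bar>backward_mean K Q L h j (k(L - j := l))\<bar> \<le> b" if l: "l \<in> {1..K}" for l
  proof (rule Suc.IH)
    show "j < L" using Suc.prems by simp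
    fix i assume "i \<in> {1..L - j}"
    then show "(k(L - j := l)) i \<in> {1..K}"
      using Suc.prems(2)[of i] l by (cases "i = L - j") auto
  qed
  have "\<bar>backward_mean K Q L h (Suc j) k\<bar>
      \<le> (\<Sum>l\<in>{1..K}. \<bar>Q (k ?s) l * backward_mean K Q L h j (k(L - j := l))\<bar>)"
    by simp
  also have "\<dots> \<le> (\<Sum>l\<in>{1..K}. Q (k ?s) l * b)"
    using IH Q0 by (intro sum_mono) (simp add: abs_mult mult_left_mono)
  also have "\<dots> = b" using Q1 by (simp flip: sum_distrib_right)
  finally show ?case .
qed

lemma chain_mean_backward:
  assumes "j < L"
  shows "chain_mean K \<pi> Q L h = chain_mean K \<pi> Q (L - j) (backward_mean K Q L h j)"
  using assms
proof (induction j)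
  case (Suc j)
  have "L - j = Suc (L - Suc j)" using Suc.prems by simp
  then have "chain_mean K \<pi> Q (L - j) (backward_mean K Q L h j)
      = chain_mean K \<pi> Q (L - Suc j) (backward_mean K Q L h (Suc j))"
    using Suc.prems by (simp add: chain_mean_Suc)
  then show ?case using Suc by simp
qed simp

text \<open>Consecutive backward means at the window that starts at time \<open>s\<close> differ by a quantity that is known at
  time \<open>s + L - j - 1\<close> and has mean zero one step earlier. For a fixed \<open>j\<close> each time carries one of
  these differences, so their sum over \<open>s\<close> is a martingale although the windows overlap.\<close>

lemma doob_part_exp_bound:
  fixes h :: "(nat \<Rightarrow> nat) \<Rightarrow> real"
  assumes tm: "transition_matrix K Q" and st: "stationary_distribution K Q \<pi>" and n: "1 \<le> n"
    and loc: "\<And>k k'. (\<And>i. i \<in> {1..L} \<Longrightarrow> k i = k' i) \<Longrightarrow> h k = h k'"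
    and b: "\<And>k. (\<And>i. i \<in> {1..L} \<Longrightarrow> k i \<in> {1..K}) \<Longrightarrow> \<bar>h k\<bar> \<le> b"
    and j: "Suc j < L" and th: "\<bar>\<theta>\<bar> * (2 * b) \<le> 1"
  shows "chain_mean K \<pi> Q (n + L - 1) (\<lambda>k. exp (\<theta> * (\<Sum>s\<in>{1..n}.
      backward_mean K Q L h j (window L s k) - backward_mean K Q L h (Suc j) (window L s k))))
    \<le> exp (\<theta>\<^sup>2 * (2 * b)\<^sup>2 * real (n + L - 1))"
proof -
  let ?B = "backward_mean K Q L h"
  define \<Delta> where "\<Delta> k = ?B j k - ?B (Suc j) k" for k
  define d where "d = L - j - 1"
  have d: "1 \<le> d" "d + 1 \<le> L" "L - j = Suc d" "L - Suc j = d" using j by (auto simp: d_def)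
  define \<Psi> where "\<Psi> m k = (if m \<in> {1 + d..n + d} then \<Delta> (window L (m - d) k) else 0)" for m k
  have w: "window L s k i = k (s + i - 1)" if "i \<in> {1..L}" for s i and k :: "nat \<Rightarrow> nat"
    using that by (simp add: window_def)
  have locB: "?B j k = ?B j k'" if "\<And>i. i \<in> {1..Suc d} \<Longrightarrow> k i = k' i" for k k'
    using j d that by (intro backward_mean_local loc) auto
  have locB': "?B (Suc j) k = ?B (Suc j) k'" if "\<And>i. i \<in> {1..d} \<Longrightarrow> k i = k' i" for k k'
    using j d that by (intro backward_mean_local loc) auto
  have b0: "0 \<le> b" if "1 \<le> K"
    using b[of "\<lambda>_. 1"] that by force
  have "chain_mean K \<pi> Q (n + L - 1) (\<lambda>k. exp (\<theta> * (\<Sum>m\<in>{2..n + L - 1}. \<Psi> m k)))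
      \<le> exp (\<theta>\<^sup>2 * (2 * b)\<^sup>2 * real (n + L - 1))"
  proof (rule chain_martingale_exp_bound[OF tm st _ _ _ _ th])
    show "1 \<le> n + L - 1" using n j by simp
  next
    fix m and k k' :: "nat \<Rightarrow> nat" assume eq: "\<And>i. 1 \<le> i \<Longrightarrow> i \<le> m \<Longrightarrow> k i = k' i"
    show "\<Psi> m k = \<Psi> m k'"
    proof (cases "m \<in> {1 + d..n + d}")
      case True
      have "window L (m - d) k i = window L (m - d) k' i" if "i \<in> {1..Suc d}" for i
        using that d True by (subst (1 2) w) (auto intro!: eq)
      then have "\<Delta> (window L (m - d) k) = \<Delta> (window L (m - d) k')"
        unfolding \<Delta>_def by (intro arg_cong2[where f = "(-)"] locB locB') auto
      then show ?thesis by (simp add: \<Psi>_def)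
    qed (simp only: \<Psi>_def if_False)
  next
    fix m and k :: "nat \<Rightarrow> nat"
    assume m: "2 \<le> m" and k: "\<And>i. 1 \<le> i \<Longrightarrow> i < m \<Longrightarrow> k i \<in> {1..K}"
    show "(\<Sum>l\<in>{1..K}. Q (k (m - 1)) l * \<Psi> m (k(m := l))) = 0"
    proof (cases "m \<in> {1 + d..n + d}")
      case True
      define s where "s = m - d"
      have s: "1 \<le> s" "m = s + d" using True by (auto simp: s_def)
      let ?w = "window L s k"
      have wd: "?w d = k (m - 1)" using d s by (subst w) auto
      have "?B j (window L s (k(m := l))) = ?B j (?w(Suc d := l))" for l
      proof (rule locB)
        fix i assume "i \<in> {1..Suc d}"
        then show "window L s (k(m := l)) i = (?w(Suc d := l)) i"
          using d s by (cases "i = Suc d") (auto simp: window_def)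
      qed
      moreover have "?B (Suc j) (window L s (k(m := l))) = ?B (Suc j) ?w" for l
      proof (rule locB')
        fix i assume "i \<in> {1..d}"
        then show "window L s (k(m := l)) i = ?w i" using d s by (auto simp: window_def)
      qed
      ultimately have "\<Psi> m (k(m := l)) = ?B j (?w(Suc d := l)) - ?B (Suc j) ?w" for l
        using True by (simp only: \<Psi>_def \<Delta>_def if_True s_def)
      then have "(\<Sum>l\<in>{1..K}. Q (k (m - 1)) l * \<Psi> m (k(m := l)))
          = (\<Sum>l\<in>{1..K}. Q (k (m - 1)) l * ?B j (?w(Suc d := l)))
            - (\<Sum>l\<in>{1..K}. Q (k (m - 1)) l) * ?B (Suc j) ?w"
        by (simp add: right_diff_distrib sum_subtractf sum_distrib_right)
      also have "(\<Sum>l\<in>{1..K}. Q (k (m - 1)) l) = 1"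
        using tm k[of "m - 1"] m unfolding transition_matrix_def by simp
      also have "(\<Sum>l\<in>{1..K}. Q (k (m - 1)) l * ?B j (?w(Suc d := l))) = ?B (Suc j) ?w"
        by (simp add: d wd)
      finally show ?thesis by (simp only: mult_1 diff_self)
    qed (simp only: \<Psi>_def if_False mult_zero_right sum.neutral_const)
  next
    fix m and k :: "nat \<Rightarrow> nat"
    assume m: "2 \<le> m" and k: "\<And>i. 1 \<le> i \<Longrightarrow> i \<le> m \<Longrightarrow> k i \<in> {1..K}"
    show "\<bar>\<Psi> m k\<bar> \<le> 2 * b"
    proof (cases "m \<in> {1 + d..n + d}")
      case True
      have *: "window L (m - d) k i \<in> {1..K}" if "i \<in> {1..Suc d}" for i
      proof -
        have "1 \<le> m - d + i - 1" "m - d + i - 1 \<le> m" "i \<in> {1..L}" using that d True by auto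
        then show ?thesis using k by (simp add: w)
      qed
      have "\<bar>?B j (window L (m - d) k)\<bar> \<le> b"
        using j d * by (intro backward_mean_bound[OF tm b]) auto
      moreover have "\<bar>?B (Suc j) (window L (m - d) k)\<bar> \<le> b"
        using j d * by (intro backward_mean_bound[OF tm b]) auto
      ultimately have "\<bar>\<Delta> (window L (m - d) k)\<bar> \<le> 2 * b" unfolding \<Delta>_def by linarith
      then show ?thesis using True by (simp add: \<Psi>_def)
    next
      case False
      have "1 \<le> K" using k[of 1] m by simp
      then show ?thesis using False b0 by (simp only: \<Psi>_def if_False) simp
    qed
  qed
  moreover have "(\<Sum>m\<in>{2..n + L - 1}. \<Psi> m k) = (\<Sum>s\<in>{1..n}. \<Delta> (window L s k))" for k
  proof -
    have "(\<Sum>m\<in>{2..n + L - 1}. \<Psi> m k) = (\<Sum>m\<in>{1 + d..n + d}. \<Psi> m k)"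
      using d by (intro sum.mono_neutral_right) (auto simp: \<Psi>_def)
    also have "\<dots> = (\<Sum>s\<in>{1..n}. \<Psi> (s + d) k)" by (rule sum.shift_bounds_cl_nat_ivl)
    finally show ?thesis by (simp add: \<Psi>_def)
  qed
  ultimately show ?thesis by (simp only: \<Delta>_def)
qed

text \<open>Summation by parts turns \<open>\<Sum> (\<phi> - Q \<phi>)(X\<^sub>s)\<close> into the martingale \<open>\<Sum> (\<phi>(X\<^sub>m) - (Q \<phi>)(X\<^sub>m\<^sub>-\<^sub>1))\<close> and two boundary
  terms, which account for the summand \<open>1\<close> in the exponent.\<close>

lemma poisson_part_exp_bound:
  fixes \<phi> :: "nat \<Rightarrow> real"
  assumes tm: "transition_matrix K Q" and st: "stationary_distribution K Q \<pi>"
    and n: "1 \<le> n" "n \<le> N"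
    and b: "\<And>x. x \<in> {1..K} \<Longrightarrow> \<bar>\<phi> x\<bar> \<le> b" and th: "\<bar>\<theta>\<bar> * (2 * b) \<le> 1"
  shows "chain_mean K \<pi> Q N (\<lambda>k. exp (\<theta> * (\<Sum>s\<in>{1..n}.
      \<phi> (k s) - (\<Sum>l\<in>{1..K}. Q (k s) l * \<phi> l)))) \<le> exp (1 + \<theta>\<^sup>2 * (2 * b)\<^sup>2 * real N)"
proof -
  define P where "P x = (\<Sum>l\<in>{1..K}. Q x l * \<phi> l)" for x
  have Pb: "\<bar>P x\<bar> \<le> b" if x: "x \<in> {1..K}" for x
  proof -
    have "\<bar>P x\<bar> \<le> (\<Sum>l\<in>{1..K}. \<bar>Q x l * \<phi> l\<bar>)" unfolding P_def by (rule sum_abs)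
    also have "\<dots> \<le> (\<Sum>l\<in>{1..K}. Q x l * b)"
      using b tm x unfolding transition_matrix_def
      by (intro sum_mono) (simp add: abs_mult mult_left_mono)
    also have "\<dots> = b" using tm x unfolding transition_matrix_def by (simp flip: sum_distrib_right)
    finally show ?thesis .
  qed
  define \<Psi> where "\<Psi> m k = (if m \<in> {2..n} then \<phi> (k m) - P (k (m - 1)) else 0)" for m k
  have "chain_mean K \<pi> Q N (\<lambda>k. exp (\<theta> * (\<Sum>m\<in>{2..N}. \<Psi> m k))) \<le> exp (\<theta>\<^sup>2 * (2 * b)\<^sup>2 * real N)"
  proof (rule chain_martingale_exp_bound[OF tm st _ _ _ _ th])
    show "1 \<le> N" using n by simp
  next
    fix m and k k' :: "nat \<Rightarrow> nat" assume eq: "\<And>i. 1 \<le> i \<Longrightarrow> i \<le> m \<Longrightarrow> k i = k' i"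
    have "k m = k' m" "k (m - 1) = k' (m - 1)" if "2 \<le> m" using that by (auto intro!: eq)
    then show "\<Psi> m k = \<Psi> m k'" by (simp add: \<Psi>_def)
  next
    fix m and k :: "nat \<Rightarrow> nat"
    assume m: "2 \<le> m" and k: "\<And>i. 1 \<le> i \<Longrightarrow> i < m \<Longrightarrow> k i \<in> {1..K}"
    have "(\<Sum>l\<in>{1..K}. Q (k (m - 1)) l) = 1"
      using tm k[of "m - 1"] m unfolding transition_matrix_def by simp
    moreover have "m - 1 \<noteq> m" using m by simp
    then have "\<Psi> m (k(m := l)) = (if m \<le> n then \<phi> l - P (k (m - 1)) else 0)" for l
      using m by (simp add: \<Psi>_def)
    ultimately show "(\<Sum>l\<in>{1..K}. Q (k (m - 1)) l * \<Psi> m (k(m := l))) = 0"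
      by (cases "m \<le> n") (simp_all add: P_def right_diff_distrib sum_subtractf flip: sum_distrib_right)
  next
    fix m and k :: "nat \<Rightarrow> nat"
    assume m: "2 \<le> m" and k: "\<And>i. 1 \<le> i \<Longrightarrow> i \<le> m \<Longrightarrow> k i \<in> {1..K}"
    have "\<bar>\<phi> (k m)\<bar> \<le> b" "\<bar>P (k (m - 1))\<bar> \<le> b" using m by (auto intro!: b Pb k)
    then show "\<bar>\<Psi> m k\<bar> \<le> 2 * b" unfolding \<Psi>_def by auto
  qed
  moreover have "chain_mean K \<pi> Q N (\<lambda>k. exp (\<theta> * (\<Sum>s\<in>{1..n}. \<phi> (k s) - P (k s))))
      \<le> chain_mean K \<pi> Q N (\<lambda>k. exp (\<theta> * (\<Sum>m\<in>{2..N}. \<Psi> m k)) * exp 1)"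
  proof (rule chain_mean_mono[OF tm st])
    show "1 \<le> N" using n by simp
    fix k assume "k \<in> PiE {1..N} (\<lambda>_. {1..K})"
    then have k: "k i \<in> {1..K}" if "1 \<le> i" "i \<le> N" for i using that by auto
    have "(\<Sum>m\<in>{2..N}. \<Psi> m k) = (\<Sum>m\<in>{2..n}. \<Psi> m k)"
      using n by (intro sum.mono_neutral_right) (auto simp: \<Psi>_def)
    also have "\<dots> = (\<Sum>m\<in>{2..n}. \<phi> (k m)) - (\<Sum>m\<in>{2..n}. P (k (m - 1)))"
      by (simp add: \<Psi>_def sum_subtractf)
    also have "(\<Sum>m\<in>{2..n}. P (k (m - 1))) = (\<Sum>s\<in>{1..n - 1}. P (k s))"
      using sum.shift_bounds_cl_nat_ivl[of "\<lambda>m. P (k (m - 1))" 1 1 "n - 1"] n by (simp add: numeral_2_eq_2)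
    also have "\<dots> = (\<Sum>s\<in>{1..n}. P (k s)) - P (k n)"
      using n by (cases n) simp_all
    also have "(\<Sum>m\<in>{2..n}. \<phi> (k m)) = (\<Sum>s\<in>{1..n}. \<phi> (k s)) - \<phi> (k 1)"
      using sum.atLeast_Suc_atMost[of 1 n "\<lambda>s. \<phi> (k s)"] n by (simp add: numeral_2_eq_2)
    finally have eq: "(\<Sum>s\<in>{1..n}. \<phi> (k s) - P (k s)) = (\<Sum>m\<in>{2..N}. \<Psi> m k) + (\<phi> (k 1) - P (k n))"
      by (simp add: sum_subtractf)
    have "\<bar>\<phi> (k 1)\<bar> \<le> b" "\<bar>P (k n)\<bar> \<le> b" using n by (auto intro!: b Pb k)
    then have "\<bar>\<phi> (k 1) - P (k n)\<bar> \<le> 2 * b" by linarith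
    then have "\<bar>\<theta> * (\<phi> (k 1) - P (k n))\<bar> \<le> \<bar>\<theta>\<bar> * (2 * b)"
      by (simp only: abs_mult mult_left_mono abs_ge_zero)
    then have "\<theta> * (\<phi> (k 1) - P (k n)) \<le> 1" using th by linarith
    then show "exp (\<theta> * (\<Sum>s\<in>{1..n}. \<phi> (k s) - P (k s))) \<le> exp (\<theta> * (\<Sum>m\<in>{2..N}. \<Psi> m k)) * exp 1"
      unfolding eq by (simp add: distrib_left flip: exp_add)
  qed
  ultimately have "chain_mean K \<pi> Q N (\<lambda>k. exp (\<theta> * (\<Sum>s\<in>{1..n}. \<phi> (k s) - P (k s))))
      \<le> exp (\<theta>\<^sup>2 * (2 * b)\<^sup>2 * real N) * exp 1"
    unfolding chain_mean_cmult by (meson exp_ge_zero mult_right_mono order_trans)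
  then show ?thesis by (simp add: P_def exp_add mult.commute)
qed

text \<open>A constant for which the centred sums of functions of \<open>L\<close> consecutive states have sub-Gaussian
  exponential moments for all \<open>\<theta>\<close> of order at most \<open>1 / b\<close>. It may depend on \<open>K\<close>, \<open>Q\<close> and \<open>L\<close> only, which is why
  \<open>\<pi>\<close>, \<open>h\<close>, \<open>b\<close> and \<open>n\<close> are quantified inside.\<close>

definition chain_window_constant :: "nat \<Rightarrow> (nat \<Rightarrow> nat \<Rightarrow> real) \<Rightarrow> nat \<Rightarrow> real \<Rightarrow> bool" where
  "chain_window_constant K Q L C \<longleftrightarrow> 1 \<le> C \<and> (\<forall>\<pi> h b \<theta> n.
    stationary_distribution K Q \<pi> \<longrightarrow>
    (\<forall>k k'. (\<forall>i\<in>{1..L}. k i = k' i) \<longrightarrow> h k = h k') \<longrightarrow>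
    (\<forall>k. (\<forall>i\<in>{1..L}. k i \<in> {1..K}) \<longrightarrow> \<bar>h k\<bar> \<le> b) \<longrightarrow>
    C * \<bar>\<theta>\<bar> * b \<le> 1 \<longrightarrow> 1 \<le> n \<longrightarrow>
    chain_mean K \<pi> Q (n + L - 1) (\<lambda>k. exp (\<theta> * (\<Sum>s\<in>{1..n}.
      h (window L s k) - chain_mean K \<pi> Q L h))) \<le> exp (1 + (C * \<theta> * b)\<^sup>2 * real n))"

text \<open>Telescoping the backward means leaves a function \<open>h\<^sub>1\<close> of the first state of the window, to which the
  Poisson equation applies; its constant \<open>c\<close> is the stationary mean, whatever the stationary
  distribution. Convexity separates the resulting \<open>L\<close> martingales.\<close>

lemma chain_window_exp_bound:
  assumes Q: "irreducible_transition_matrix K Q" and K: "1 \<le> K" and L: "1 \<le> L"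
  shows "\<exists>C. chain_window_constant K Q L C"
proof -
  have tm: "transition_matrix K Q" using Q by (simp add: irreducible_transition_matrix_def)
  obtain C\<^sub>P :: real where CP: "0 \<le> C\<^sub>P" and poisson: "\<And>h :: nat \<Rightarrow> real. \<exists>c \<phi>.
      (\<forall>k\<in>{1..K}. h k = c + \<phi> k - (\<Sum>l\<in>{1..K}. Q k l * \<phi> l)) \<and>
      (\<forall>b. (\<forall>k\<in>{1..K}. \<bar>h k\<bar> \<le> b) \<longrightarrow> (\<forall>k\<in>{1..K}. \<bar>\<phi> k\<bar> \<le> C\<^sub>P * b))"
    using poisson_equation[OF Q K] by blast
  define C\<^sub>1 where "C\<^sub>1 = max 1 C\<^sub>P"
  define C where "C = 2 * real L * C\<^sub>1 * real L"
  have C1: "1 \<le> C\<^sub>1" "C\<^sub>P \<le> C\<^sub>1" by (auto simp: C\<^sub>1_def)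
  have rL: "1 \<le> real L" using L by simp
  have "1 * 1 \<le> C\<^sub>1 * real L" by (intro mult_mono) (use C1 rL in auto)
  moreover have "1 * (C\<^sub>1 * real L) \<le> real L * (C\<^sub>1 * real L)"
    using C1 rL by (intro mult_right_mono) auto
  ultimately have C: "1 \<le> C" unfolding C_def by (simp add: mult.assoc)
  show ?thesis
    unfolding chain_window_constant_def
  proof (rule exI[of _ C], intro conjI allI impI C)
    fix \<pi> and h :: "(nat \<Rightarrow> nat) \<Rightarrow> real" and b \<theta> :: real and n :: nat
    assume st: "stationary_distribution K Q \<pi>"
      and loc: "\<forall>k k'. (\<forall>i\<in>{1..L}. k i = k' i) \<longrightarrow> h k = h k'"
      and hb: "\<forall>k. (\<forall>i\<in>{1..L}. k i \<in> {1..K}) \<longrightarrow> \<bar>h k\<bar> \<le> b"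
      and th: "C * \<bar>\<theta>\<bar> * b \<le> 1" and n: "1 \<le> n"
    let ?N = "n + L - 1" and ?B = "backward_mean K Q L h"
    have N: "1 \<le> ?N" "n \<le> ?N" "real ?N \<le> real L * real n"
    proof -
      show "1 \<le> ?N" "n \<le> ?N" using n L by auto
      have "n + L - 1 \<le> L * n" using n L
        by (cases L; cases n) auto
      then show "real ?N \<le> real L * real n" by (metis of_nat_le_iff of_nat_mult)
    qed
    have b0: "0 \<le> b" using hb[rule_format, of "\<lambda>_. 1"] K by force
    have loc': "\<And>k k'. (\<And>i. i \<in> {1..L} \<Longrightarrow> k i = k' i) \<Longrightarrow> h k = h k'" using loc by blast
    have hb': "\<And>k. (\<And>i. i \<in> {1..L} \<Longrightarrow> k i \<in> {1..K}) \<Longrightarrow> \<bar>h k\<bar> \<le> b" using hb by blast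
    have "\<bar>real L * \<theta>\<bar> * (2 * (C\<^sub>1 * b)) \<le> C * \<bar>\<theta>\<bar> * b"
    proof -
      have "\<bar>real L * \<theta>\<bar> * (2 * (C\<^sub>1 * b)) = (2 * real L * C\<^sub>1 * \<bar>\<theta>\<bar> * b) * 1"
        by (simp add: abs_mult)
      also have "\<dots> \<le> (2 * real L * C\<^sub>1 * \<bar>\<theta>\<bar> * b) * real L"
        using C1 b0 rL by (intro mult_left_mono) auto
      finally show ?thesis by (simp add: C_def algebra_simps)
    qed
    then have th1: "\<bar>real L * \<theta>\<bar> * (2 * (C\<^sub>1 * b)) \<le> 1" using th by linarith
    have bC: "b \<le> C\<^sub>1 * b" using C1 b0 by (simp add: mult_le_cancel_right1)
    have sq: "(real L * \<theta>)\<^sup>2 * (2 * (C\<^sub>1 * b))\<^sup>2 * real ?N \<le> (C * \<theta> * b)\<^sup>2 * real n"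
    proof -
      have L2: "real L \<le> (real L)\<^sup>2" using rL by (simp add: power2_eq_square)
      have "(real L * \<theta>)\<^sup>2 * (2 * (C\<^sub>1 * b))\<^sup>2 * real ?N
          \<le> (real L * \<theta>)\<^sup>2 * (2 * (C\<^sub>1 * b))\<^sup>2 * (real L * real n)"
        using N by (intro mult_left_mono) auto
      also have "\<dots> \<le> (real L * \<theta>)\<^sup>2 * (2 * (C\<^sub>1 * b))\<^sup>2 * ((real L)\<^sup>2 * real n)"
        by (rule mult_left_mono[OF mult_right_mono[OF L2]]) auto
      also have "\<dots> = (C * \<theta> * b)\<^sup>2 * real n"
        by (simp add: C_def power2_eq_square mult_ac)
      finally show ?thesis .
    qed
    define h\<^sub>1 where "h\<^sub>1 x = ?B (L - 1) (\<lambda>_. x)" for x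
    have h1: "?B (L - 1) k = h\<^sub>1 (k 1)" for k
      unfolding h\<^sub>1_def using L by (intro backward_mean_local loc') auto
    obtain c \<phi> where h1_eq: "\<forall>k\<in>{1..K}. h\<^sub>1 k = c + \<phi> k - (\<Sum>l\<in>{1..K}. Q k l * \<phi> l)"
      and \<phi>b: "\<And>b. \<forall>k\<in>{1..K}. \<bar>h\<^sub>1 k\<bar> \<le> b \<Longrightarrow> \<forall>k\<in>{1..K}. \<bar>\<phi> k\<bar> \<le> C\<^sub>P * b"
      using poisson[of h\<^sub>1] by blast
    have "\<forall>k\<in>{1..K}. \<bar>h\<^sub>1 k\<bar> \<le> b"
      unfolding h\<^sub>1_def using L by (intro ballI backward_mean_bound[OF tm hb']) auto
    from \<phi>b[OF this] have phib: "\<bar>\<phi> x\<bar> \<le> C\<^sub>1 * b" if "x \<in> {1..K}" for x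
      using that mult_right_mono[OF C1(2) b0] by force
    have mean: "chain_mean K \<pi> Q L h = c"
    proof -
      have "chain_mean K \<pi> Q L h = chain_mean K \<pi> Q 1 (?B (L - 1))"
        using chain_mean_backward[of "L - 1" L K \<pi> Q h] L by simp
      also have "\<dots> = (\<Sum>x\<in>{1..K}. \<pi> x * h\<^sub>1 x)" unfolding chain_mean_1 h1 by simp
      also have "\<dots> = (\<Sum>x\<in>{1..K}. \<pi> x * c + \<pi> x * \<phi> x - (\<Sum>l\<in>{1..K}. \<pi> x * Q x l * \<phi> l))"
      proof (intro sum.cong refl)
        fix x assume "x \<in> {1..K}"
        then have "h\<^sub>1 x = c + \<phi> x - (\<Sum>l\<in>{1..K}. Q x l * \<phi> l)" using h1_eq by blast
        then show "\<pi> x * h\<^sub>1 x = \<pi> x * c + \<pi> x * \<phi> x - (\<Sum>l\<in>{1..K}. \<pi> x * Q x l * \<phi> l)"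
          by (simp only: right_diff_distrib distrib_left sum_distrib_left mult.assoc)
      qed
      also have "\<dots> = (\<Sum>x\<in>{1..K}. \<pi> x) * c + (\<Sum>x\<in>{1..K}. \<pi> x * \<phi> x)
          - (\<Sum>x\<in>{1..K}. \<Sum>l\<in>{1..K}. \<pi> x * Q x l * \<phi> l)"
        by (simp add: sum.distrib sum_subtractf sum_distrib_right)
      also have "(\<Sum>x\<in>{1..K}. \<Sum>l\<in>{1..K}. \<pi> x * Q x l * \<phi> l)
          = (\<Sum>l\<in>{1..K}. (\<Sum>x\<in>{1..K}. \<pi> x * Q x l) * \<phi> l)"
        by (subst sum.swap) (simp add: sum_distrib_right)
      also have "\<dots> = (\<Sum>l\<in>{1..K}. \<pi> l * \<phi> l)"
        using st by (intro sum.cong) (auto simp: stationary_distribution_def)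
      finally show ?thesis using st by (simp add: stationary_distribution_def)
    qed
    \<comment> \<open>one martingale for each of the last \<open>L - 1\<close> coordinates of the window, and one for the first\<close>
    define T where "T j k = (\<Sum>s\<in>{1..n}. if Suc j < L then ?B j (window L s k) - ?B (Suc j) (window L s k)
      else \<phi> (k s) - (\<Sum>l\<in>{1..K}. Q (k s) l * \<phi> l))" for j k
    have T: "chain_mean K \<pi> Q ?N (\<lambda>k. exp (real L * \<theta> * T j k)) \<le> exp (1 + (C * \<theta> * b)\<^sup>2 * real n)" for j
    proof (cases "Suc j < L")
      case True
      have "chain_mean K \<pi> Q ?N (\<lambda>k. exp (real L * \<theta> * T j k))
          \<le> exp ((real L * \<theta>)\<^sup>2 * (2 * (C\<^sub>1 * b))\<^sup>2 * real ?N)"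
        unfolding T_def using True
        by (simp only: if_True)
          (rule doob_part_exp_bound[OF tm st n loc' order_trans[OF hb' bC] True th1])
      also have "\<dots> \<le> exp (1 + (C * \<theta> * b)\<^sup>2 * real n)" using sq by simp
      finally show ?thesis .
    next
      case False
      have "chain_mean K \<pi> Q ?N (\<lambda>k. exp (real L * \<theta> * T j k))
          \<le> exp (1 + (real L * \<theta>)\<^sup>2 * (2 * (C\<^sub>1 * b))\<^sup>2 * real ?N)"
        unfolding T_def using False
        by (simp only: if_False) (rule poisson_part_exp_bound[OF tm st n N(2) phib th1])
      also have "\<dots> \<le> exp (1 + (C * \<theta> * b)\<^sup>2 * real n)" using sq by simp
      finally show ?thesis .
    qed
    have split: "(\<Sum>s\<in>{1..n}. h (window L s k) - chain_mean K \<pi> Q L h) = (\<Sum>j<L. T j k)"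
      if k: "k \<in> PiE {1..?N} (\<lambda>_. {1..K})" for k
    proof -
      have "h (window L s k) - c = (\<Sum>j<L. if Suc j < L
          then ?B j (window L s k) - ?B (Suc j) (window L s k)
          else \<phi> (k s) - (\<Sum>l\<in>{1..K}. Q (k s) l * \<phi> l))" if s: "s \<in> {1..n}" for s
      proof -
        obtain L' where L': "L = Suc L'" using L by (cases L) auto
        have "k s \<in> {1..K}" using k s N by auto
        then have "h\<^sub>1 (k s) - c = \<phi> (k s) - (\<Sum>l\<in>{1..K}. Q (k s) l * \<phi> l)"
          using h1_eq by simp
        moreover have "window L s k 1 = k s" using L by (simp add: window_def)
        ultimately have "\<phi> (k s) - (\<Sum>l\<in>{1..K}. Q (k s) l * \<phi> l) = ?B L' (window L s k) - c"
          using h1[of "window L s k"] L' by simp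
        moreover have "(\<Sum>j<L'. ?B j (window L s k) - ?B (Suc j) (window L s k))
            = h (window L s k) - ?B L' (window L s k)"
          by (subst sum_lessThan_telescope') simp
        moreover have "(\<Sum>j<L. if Suc j < L then ?B j (window L s k) - ?B (Suc j) (window L s k)
            else \<phi> (k s) - (\<Sum>l\<in>{1..K}. Q (k s) l * \<phi> l))
          = (\<Sum>j<L'. ?B j (window L s k) - ?B (Suc j) (window L s k))
            + (\<phi> (k s) - (\<Sum>l\<in>{1..K}. Q (k s) l * \<phi> l))"
          unfolding L' by (simp only: sum.lessThan_Suc, rule arg_cong2[where f = "(+)"])
            (auto intro!: sum.cong)
        ultimately show ?thesis by linarith
      qed
      then have "(\<Sum>s\<in>{1..n}. h (window L s k) - c) = (\<Sum>s\<in>{1..n}. \<Sum>j<L. if Suc j < L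
          then ?B j (window L s k) - ?B (Suc j) (window L s k)
          else \<phi> (k s) - (\<Sum>l\<in>{1..K}. Q (k s) l * \<phi> l))"
        by (rule sum.cong[OF refl])
      then show ?thesis unfolding mean T_def by (subst sum.swap)
    qed
    have "chain_mean K \<pi> Q ?N (\<lambda>k. exp (\<theta> * (\<Sum>s\<in>{1..n}. h (window L s k) - chain_mean K \<pi> Q L h)))
        \<le> chain_mean K \<pi> Q ?N (\<lambda>k. (\<Sum>j<L. exp (real L * \<theta> * T j k)) * (1 / real L))"
    proof (rule chain_mean_mono[OF tm st N(1)])
      fix k assume k: "k \<in> PiE {1..?N} (\<lambda>_. {1..K})"
      have "exp (\<Sum>j<L. \<theta> * T j k)
          \<le> (\<Sum>j<L. exp (real (card {..<L}) * (\<theta> * T j k))) / real (card {..<L})"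
        using L by (intro exp_sum_le_mean) (auto simp: lessThan_empty_iff)
      then show "exp (\<theta> * (\<Sum>s\<in>{1..n}. h (window L s k) - chain_mean K \<pi> Q L h))
          \<le> (\<Sum>j<L. exp (real L * \<theta> * T j k)) * (1 / real L)"
        unfolding split[OF k] by (simp add: sum_distrib_left mult.assoc)
    qed
    also have "\<dots> = (\<Sum>j<L. chain_mean K \<pi> Q ?N (\<lambda>k. exp (real L * \<theta> * T j k))) * (1 / real L)"
      unfolding chain_mean_cmult chain_mean_sum ..
    also have "\<dots> \<le> (\<Sum>j<L. exp (1 + (C * \<theta> * b)\<^sup>2 * real n)) * (1 / real L)"
      by (intro mult_right_mono sum_mono T) auto
    also have "\<dots> = exp (1 + (C * \<theta> * b)\<^sup>2 * real n)" using rL by simp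
    finally show "chain_mean K \<pi> Q ?N (\<lambda>k. exp (\<theta> * (\<Sum>s\<in>{1..n}.
      h (window L s k) - chain_mean K \<pi> Q L h))) \<le> exp (1 + (C * \<theta> * b)\<^sup>2 * real n)" .
  qed
qed

lemma chain_window_constantD:
  assumes C: "chain_window_constant K Q L C" and st: "stationary_distribution K Q \<pi>"
    and loc: "\<And>k k'. (\<And>i. i \<in> {1..L} \<Longrightarrow> k i = k' i) \<Longrightarrow> h k = h k'"
    and b: "\<And>k. (\<And>i. i \<in> {1..L} \<Longrightarrow> k i \<in> {1..K}) \<Longrightarrow> \<bar>h k\<bar> \<le> b"
    and th: "C * \<bar>\<theta>\<bar> * b \<le> 1" and n: "1 \<le> n"
  shows "chain_mean K \<pi> Q (n + L - 1) (\<lambda>k. exp (\<theta> * (\<Sum>s\<in>{1..n}.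
      h (window L s k) - chain_mean K \<pi> Q L h))) \<le> exp (1 + (C * \<theta> * b)\<^sup>2 * real n)"
proof -
  have 1: "\<forall>k k'. (\<forall>i\<in>{1..L}. k i = k' i) \<longrightarrow> h k = h k'"
    by (intro allI impI loc) (rule bspec)
  have 2: "\<forall>k. (\<forall>i\<in>{1..L}. k i \<in> {1..K}) \<longrightarrow> \<bar>h k\<bar> \<le> b"
    by (intro allI impI b) (rule bspec)
  note C[unfolded chain_window_constant_def, THEN conjunct2, THEN spec, of \<pi>, THEN spec, of h,
    THEN spec, of b, THEN spec, of \<theta>, THEN spec, of n]
  from this[THEN mp, OF st, THEN mp, OF 1, THEN mp, OF 2, THEN mp, OF th, THEN mp, OF n]
  show ?thesis .
qed

section \<open>Independent windows\<close>

lemma window_cong: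
  "(\<And>i. i \<in> {1..L} \<Longrightarrow> y (s + i - 1) = y' (s + i - 1)) \<Longrightarrow> window L s y = window L s y'"
  by (auto simp: window_def fun_eq_iff)

lemma measurable_window:
  assumes "\<And>i. i \<in> {1..L} \<Longrightarrow> s + i - 1 \<in> I"
  shows "window L s \<in> measurable (PiM I M) (PiM {1..L} (\<lambda>i. M (s + i - 1)))"
  unfolding window_def using assms by (intro measurable_restrict measurable_component_singleton)

lemma distr_window:
  assumes "\<And>i. i \<in> I \<Longrightarrow> prob_space (M i)" and "\<And>i. i \<in> {1..L} \<Longrightarrow> s + i - 1 \<in> I" and "1 \<le> s"
  shows "distr (PiM I M) (PiM {1..L} (\<lambda>i. M (s + i - 1))) (window L s) = PiM {1..L} (\<lambda>i. M (s + i - 1))"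
proof -
  have "inj_on (\<lambda>i. s + i - 1) {1..L}" using assms(3) by (auto simp: inj_on_def)
  moreover have "(\<lambda>i. s + i - 1) \<in> {1..L} \<rightarrow> I" using assms(2) by auto
  ultimately show ?thesis
    unfolding window_def[abs_def] using assms(1) by (intro distr_PiM_reindex)
qed

lemma indep_vars_PiM_coordinate:
  assumes M: "\<And>i. i \<in> I \<Longrightarrow> prob_space (M i)" and "I \<noteq> {}"
  shows "prob_space.indep_vars (PiM I M) M (\<lambda>i x. x i) I"
proof -
  interpret prob_space "PiM I M" by (rule prob_space_PiM[OF M])
  have "distr (PiM I M) (PiM I M) (\<lambda>x. \<lambda>i\<in>I. x i) = distr (PiM I M) (PiM I M) (\<lambda>x. x)"
    by (intro distr_cong refl) (auto simp: space_PiM PiE_iff extensional_restrict)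
  also have "\<dots> = PiM I (\<lambda>i. distr (PiM I M) (M i) (\<lambda>x. x i))"
  proof -
    have "PiM I M = PiM I (\<lambda>i. distr (PiM I M) (M i) (\<lambda>x. x i))"
      by (intro PiM_cong refl) (rule distr_PiM_component[OF M, symmetric])
    then show ?thesis by (simp add: distr_id2)
  qed
  finally show ?thesis using \<open>I \<noteq> {}\<close> by (subst indep_vars_iff_distr_eq_PiM') auto
qed

text \<open>Windows whose positions are congruent modulo \<open>L\<close> do not overlap, so their exponential moments multiply;
  convexity separates the \<open>L\<close> residue classes.\<close>

lemma independent_windows_exp_bound:
  fixes M :: "nat \<Rightarrow> 'a measure" and u :: "(nat \<Rightarrow> 'a) \<Rightarrow> real"
  assumes L: "1 \<le> L" and n: "1 \<le> n"
    and M: "\<And>i. i \<in> {1..n + L - 1} \<Longrightarrow> prob_space (M i)"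
    and sets: "\<And>i. sets (M i) = sets S"
    and u: "u \<in> borel_measurable (PiM {1..L} (\<lambda>_. S))"
    and bnd: "\<And>s. s \<in> {1..n} \<Longrightarrow> AE z in PiM {1..L} (\<lambda>i. M (s + i - 1)). \<bar>u z\<bar> \<le> B"
    and v: "\<And>s. s \<in> {1..n} \<Longrightarrow> (\<integral>z. (u z)\<^sup>2 \<partial>PiM {1..L} (\<lambda>i. M (s + i - 1))) \<le> v"
    and v0: "0 \<le> v" and th: "\<bar>real L * \<theta>\<bar> * (2 * B) \<le> 1"
  shows "(\<integral>\<^sup>+y. ennreal (exp (\<theta> * (\<Sum>s\<in>{1..n}. u (window L s y)
      - (\<integral>z. u z \<partial>PiM {1..L} (\<lambda>i. M (s + i - 1)))))) \<partial>PiM {1..n + L - 1} M)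
    \<le> ennreal (exp ((real L * \<theta>)\<^sup>2 * v * real n))"
proof -
  let ?I = "{1..n + L - 1}"
  let ?W = "\<lambda>s. PiM {1..L} (\<lambda>i. M (s + i - 1))"
  interpret P: prob_space "PiM ?I M" by (rule prob_space_PiM[OF M])
  define m where "m s = (\<integral>z. u z \<partial>?W s)" for s
  define E where "E s y = ennreal (exp (real L * \<theta> * (u (window L s y) - m s)))" for s y
  have in_I: "s + i - 1 \<in> ?I" if "s \<in> {1..n}" "i \<in> {1..L}" for s i using that by auto
  have uW: "u \<in> borel_measurable (?W s)" for s
    using u by (simp add: sets cong: measurable_cong_sets sets_PiM_cong)
  have uw: "(\<lambda>y. u (window L s y)) \<in> borel_measurable (PiM J M)"
    if "\<And>i. i \<in> {1..L} \<Longrightarrow> s + i - 1 \<in> J" for s J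
    using measurable_compose[OF measurable_window uW] that by blast
  have E_meas: "E s \<in> borel_measurable (PiM ?I M)" if "s \<in> {1..n}" for s
  proof -
    have [measurable]: "(\<lambda>y. u (window L s y)) \<in> borel_measurable (PiM ?I M)"
      by (rule uw[OF in_I[OF that]])
    show ?thesis unfolding E_def by measurable
  qed
  have one: "(\<integral>\<^sup>+y. E s y \<partial>PiM ?I M) \<le> ennreal (exp ((real L * \<theta>)\<^sup>2 * v))" if s: "s \<in> {1..n}" for s
  proof -
    interpret W: prob_space "?W s" using in_I[OF s] by (intro prob_space_PiM M)
    have "(\<integral>\<^sup>+y. E s y \<partial>PiM ?I M)
        = (\<integral>\<^sup>+z. ennreal (exp (real L * \<theta> * (u z - m s))) \<partial>distr (PiM ?I M) (?W s) (window L s))"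
      unfolding E_def using uW[of s]
      by (subst nn_integral_distr[OF measurable_window[OF in_I[OF s]]]) simp_all
    also have "\<dots> = (\<integral>\<^sup>+z. ennreal (exp (real L * \<theta> * (u z - m s))) \<partial>?W s)"
      using s in_I[OF s] by (subst distr_window[OF M]) auto
    also have "\<dots> \<le> ennreal (exp ((real L * \<theta>)\<^sup>2 * v))"
      unfolding m_def by (rule W.centered_exp_bound[OF uW bnd[OF s] v[OF s] th])
    finally show ?thesis .
  qed
  have residue: "(\<integral>\<^sup>+y. (\<Prod>s\<in>{s\<in>{1..n}. s mod L = r}. E s y) \<partial>PiM ?I M)
      \<le> ennreal (exp ((real L * \<theta>)\<^sup>2 * v * real n))" for r
  proof -
    let ?J = "{s\<in>{1..n}. s mod L = r}"
    have "P.indep_vars M (\<lambda>i x. x i) ?I" using n L by (intro indep_vars_PiM_coordinate M) auto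
    then have "P.indep_vars (\<lambda>s. PiM {s..s + L - 1} M) (\<lambda>s y. restrict (\<lambda>i. y i) {s..s + L - 1}) ?J"
    proof (rule P.indep_vars_restrict)
      show "{s..s + L - 1} \<subseteq> ?I" if "s \<in> ?J" for s using that L by auto
      show "disjoint_family_on (\<lambda>s. {s..s + L - 1}) ?J"
        unfolding disjoint_family_on_def
      proof (intro ballI impI)
        fix s t assume st: "s \<in> ?J" "t \<in> ?J" "s \<noteq> t"
        have *: "a + L \<le> b" if "a < b" "a mod L = b mod L" for a b
        proof -
          have "L dvd b - a" using that mod_eq_dvd_iff_nat[of a b L] by simp
          then have "L \<le> b - a" using that by (intro dvd_imp_le) auto
          then show ?thesis using that by linarith
        qed
        then have "s + L \<le> t \<or> t + L \<le> s" using st by (metis (lifting) mem_Collect_eq nat_neq_iff)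
        then show "{s..s + L - 1} \<inter> {t..t + L - 1} = {}" using L by auto
      qed
    qed
    then have "P.indep_vars (\<lambda>_. borel) (\<lambda>s y. E s (restrict (\<lambda>i. y i) {s..s + L - 1})) ?J"
    proof (rule P.indep_vars_compose2)
      fix s assume "s \<in> ?J"
      show "E s \<in> borel_measurable (PiM {s..s + L - 1} M)"
      proof -
        have [measurable]: "(\<lambda>y. u (window L s y)) \<in> borel_measurable (PiM {s..s + L - 1} M)"
          by (rule uw) auto
        show ?thesis unfolding E_def by measurable
      qed
    qed
    moreover have "E s (restrict (\<lambda>i. y i) {s..s + L - 1}) = E s y" for s y
    proof -
      have "window L s (restrict (\<lambda>i. y i) {s..s + L - 1}) = window L s y" by (rule window_cong) auto
      then show ?thesis by (simp add: E_def)
    qed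
    ultimately have "P.indep_vars (\<lambda>_. borel) E ?J" by simp
    then have "(\<integral>\<^sup>+y. (\<Prod>s\<in>?J. E s y) \<partial>PiM ?I M) = (\<Prod>s\<in>?J. \<integral>\<^sup>+y. E s y \<partial>PiM ?I M)"
      by (intro P.indep_vars_nn_integral) auto
    also have "\<dots> \<le> (\<Prod>s\<in>?J. ennreal (exp ((real L * \<theta>)\<^sup>2 * v)))"
      using one by (intro prod_mono_ennreal) auto
    also have "\<dots> = ennreal (exp (real (card ?J) * ((real L * \<theta>)\<^sup>2 * v)))"
      by (simp add: ennreal_power exp_of_nat_mult)
    also have "\<dots> \<le> ennreal (exp (real n * ((real L * \<theta>)\<^sup>2 * v)))"
    proof -
      have "card ?J \<le> card {1..n}" by (rule card_mono) auto
      then show ?thesis using v0 by (intro ennreal_leI) (auto intro!: mult_right_mono)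
    qed
    finally show ?thesis by (simp add: mult.commute)
  qed
  have "exp (\<theta> * (\<Sum>s\<in>{1..n}. u (window L s y) - m s))
      \<le> (\<Sum>r<L. \<Prod>s\<in>{s\<in>{1..n}. s mod L = r}. exp (real L * \<theta> * (u (window L s y) - m s))) / real L" for y
  proof -
    have "(\<Sum>s\<in>{1..n}. \<theta> * (u (window L s y) - m s))
        = (\<Sum>r<L. \<Sum>s\<in>{s\<in>{1..n}. s mod L = r}. \<theta> * (u (window L s y) - m s))"
      using L by (intro sum.group[symmetric]) auto
    moreover have "exp (\<Sum>r<L. \<Sum>s\<in>{s\<in>{1..n}. s mod L = r}. \<theta> * (u (window L s y) - m s))
        \<le> (\<Sum>r<L. exp (real (card {..<L}) * (\<Sum>s\<in>{s\<in>{1..n}. s mod L = r}. \<theta> * (u (window L s y) - m s))))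
          / real (card {..<L})"
      using L by (intro exp_sum_le_mean) (auto simp: lessThan_empty_iff)
    ultimately show ?thesis
      by (simp add: sum_distrib_left exp_sum mult.assoc)
  qed
  then have "(\<integral>\<^sup>+y. ennreal (exp (\<theta> * (\<Sum>s\<in>{1..n}. u (window L s y) - m s))) \<partial>PiM ?I M)
      \<le> (\<integral>\<^sup>+y. (\<Sum>r<L. \<Prod>s\<in>{s\<in>{1..n}. s mod L = r}. E s y) * ennreal (1 / real L) \<partial>PiM ?I M)"
    by (intro nn_integral_mono)
      (simp add: E_def prod_ennreal sum_ennreal prod_nonneg sum_nonneg ennreal_leI flip: ennreal_mult'')
  also have "\<dots> = (\<Sum>r<L. \<integral>\<^sup>+y. (\<Prod>s\<in>{s\<in>{1..n}. s mod L = r}. E s y) \<partial>PiM ?I M) * ennreal (1 / real L)"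
    using E_meas by (subst nn_integral_multc) (auto intro!: nn_integral_sum borel_measurable_sum
        borel_measurable_prod_ennreal arg_cong2[where f = "(*)"])
  also have "\<dots> \<le> (\<Sum>r<L. ennreal (exp ((real L * \<theta>)\<^sup>2 * v * real n))) * ennreal (1 / real L)"
    by (intro mult_right_mono sum_mono residue) auto
  also have "\<dots> = ennreal (exp ((real L * \<theta>)\<^sup>2 * v * real n))"
    using L by (simp add: ennreal_of_nat_eq_real_of_nat flip: ennreal_mult'')
  finally show ?thesis by (simp add: m_def)
qed

section \<open>The law of a hidden Markov model\<close>

definition emission :: "'a measure \<Rightarrow> (nat \<Rightarrow> 'a \<Rightarrow> real) \<Rightarrow> nat \<Rightarrow> 'a measure" where
  "emission \<mu> f x = density \<mu> (\<lambda>y. ennreal (f x y))"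

lemma sets_emission [simp]: "sets (emission \<mu> f x) = sets \<mu>"
  by (simp add: emission_def)

lemma space_emission [simp]: "space (emission \<mu> f x) = space \<mu>"
  by (simp add: emission_def)

lemma path_event_measurable:
  assumes X: "\<And>j. 1 \<le> j \<Longrightarrow> X j \<in> measurable \<Omega> (count_space {1..K::nat})"
    and k: "k \<in> PiE {1..N} (\<lambda>_. {1..K})" and N: "1 \<le> (N::nat)"
  shows "{\<omega>\<in>space \<Omega>. \<forall>j\<in>{1..N}. X j \<omega> = k j} \<in> sets \<Omega>"
proof -
  have "(\<Inter>j\<in>{1..N}. X j -` {k j} \<inter> space \<Omega>) \<in> sets \<Omega>"
  proof (rule sets.finite_INT)
    show "{1..N} \<noteq> {}" using N by simp
    fix j assume "j \<in> {1..N}"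
    then show "X j -` {k j} \<inter> space \<Omega> \<in> sets \<Omega>"
      using k by (intro measurable_sets[OF X]) auto
  qed simp
  moreover have "{\<omega>\<in>space \<Omega>. \<forall>j\<in>{1..N}. X j \<omega> = k j} = (\<Inter>j\<in>{1..N}. X j -` {k j} \<inter> space \<Omega>)"
    using N by auto
  ultimately show ?thesis by (simp only:)
qed

text \<open>Both sides are finite measures in \<open>F\<close> which agree on boxes.\<close>

lemma hmm_path_law:
  assumes hmm: "hidden_markov_model \<Omega> \<mu> K \<pi> Q f X Y" and N: "1 \<le> N"
    and k: "k \<in> PiE {1..N} (\<lambda>_. {1..K})"
    and F: "F \<in> borel_measurable (PiM {1..N} (\<lambda>_. \<mu>))"
  shows "(\<integral>\<^sup>+\<omega>. F (\<lambda>j\<in>{1..N}. Y j \<omega>) * indicator {\<omega>\<in>space \<Omega>. \<forall>j\<in>{1..N}. X j \<omega> = k j} \<omega> \<partial>\<Omega>)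
    = ennreal (path_weight \<pi> Q N k) * (\<integral>\<^sup>+y. F y \<partial>PiM {1..N} (\<lambda>j. emission \<mu> f (k j)))"
proof -
  let ?I = "{1..N}"
  let ?\<mu>N = "PiM ?I (\<lambda>_. \<mu>)"
  let ?E = "PiM ?I (\<lambda>j. emission \<mu> f (k j))"
  let ?Y = "\<lambda>\<omega>. \<lambda>j\<in>?I. Y j \<omega>"
  define S where "S = {\<omega>\<in>space \<Omega>. \<forall>j\<in>?I. X j \<omega> = k j}"
  interpret \<Omega>: prob_space \<Omega> using hmm by (simp add: hidden_markov_model_def)
  have X: "X j \<in> measurable \<Omega> (count_space {1..K})" and Y: "Y j \<in> measurable \<Omega> \<mu>" if "1 \<le> j" for j
    using hmm that by (simp_all add: hidden_markov_model_def)
  have kK: "\<forall>j\<in>?I. k j \<in> {1..K}" using k by auto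
  have em: "prob_space (emission \<mu> f (k j))" if "j \<in> ?I" for j
    using hmm kK that unfolding hidden_markov_model_def probability_density_def emission_def by blast
  interpret E: prob_space ?E by (rule prob_space_PiM[OF em])
  have S: "S \<in> sets \<Omega>" unfolding S_def by (rule path_event_measurable[OF X k N])
  have Yv: "?Y \<in> measurable \<Omega> ?\<mu>N" by (intro measurable_restrict Y) simp
  have w: "measure \<Omega> S = path_weight \<pi> Q N k"
    using hmm N kK unfolding hidden_markov_model_def S_def path_weight_def by blast
  define M where "M = distr (density \<Omega> (indicator S)) ?\<mu>N ?Y"
  have setsE: "sets ?E = sets ?\<mu>N" by (rule sets_PiM_cong) auto
  have M_eq: "M = scale_measure (ennreal (path_weight \<pi> Q N k)) ?E"
  proof (rule measure_eqI_PiM_finite[where I = ?I and M = "\<lambda>_. \<mu>"])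
    show "finite ?I" "sets M = ?\<mu>N" by (simp_all add: M_def)
    show "sets (scale_measure (ennreal (path_weight \<pi> Q N k)) ?E) = sets ?\<mu>N" using setsE by simp
    have M_em: "emeasure M B = emeasure \<Omega> (S \<inter> (?Y -` B \<inter> space \<Omega>))" if "B \<in> sets ?\<mu>N" for B
    proof -
      have "?Y -` B \<inter> space \<Omega> \<in> sets \<Omega>" by (rule measurable_sets[OF Yv that])
      then show ?thesis using that S Yv unfolding M_def
        by (subst emeasure_distr) (simp_all add: emeasure_restricted)
    qed
    {
      fix A assume A: "\<And>i. i \<in> ?I \<Longrightarrow> A i \<in> sets \<mu>"
      have PA: "PiE ?I A \<in> sets ?\<mu>N" using A by (intro sets_PiM_I_finite) auto
      have "S \<inter> (?Y -` PiE ?I A \<inter> space \<Omega>) = {\<omega>\<in>space \<Omega>. \<forall>j\<in>?I. X j \<omega> = k j \<and> Y j \<omega> \<in> A j}"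
        by (auto simp: S_def PiE_iff)
      then have "emeasure M (PiE ?I A)
          = ennreal (measure \<Omega> {\<omega>\<in>space \<Omega>. \<forall>j\<in>?I. X j \<omega> = k j \<and> Y j \<omega> \<in> A j})"
        using M_em[OF PA] by (simp add: \<Omega>.emeasure_eq_measure)
      also have "measure \<Omega> {\<omega>\<in>space \<Omega>. \<forall>j\<in>?I. X j \<omega> = k j \<and> Y j \<omega> \<in> A j}
          = path_weight \<pi> Q N k * (\<Prod>j\<in>?I. measure (emission \<mu> f (k j)) (A j))"
      proof -
        have "\<forall>j\<in>?I. k j \<in> {1..K} \<and> A j \<in> sets \<mu>" using kK A by blast
        then show ?thesis
          using hmm N w unfolding hidden_markov_model_def S_def emission_def by simp
      qed
      also have "ennreal \<dots> = ennreal (path_weight \<pi> Q N k) * (\<Prod>j\<in>?I. emeasure (emission \<mu> f (k j)) (A j))"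
      proof -
        have "(\<Prod>j\<in>?I. emeasure (emission \<mu> f (k j)) (A j))
            = (\<Prod>j\<in>?I. ennreal (measure (emission \<mu> f (k j)) (A j)))"
          by (intro prod.cong refl finite_measure.emeasure_eq_measure prob_space.finite_measure em)
        then show ?thesis by (simp add: prod_ennreal ennreal_mult'' prod_nonneg)
      qed
      also have "(\<Prod>j\<in>?I. emeasure (emission \<mu> f (k j)) (A j)) = emeasure ?E (PiE ?I A)"
      proof -
        have "emeasure ?E (prod_emb ?I (\<lambda>j. emission \<mu> f (k j)) ?I (PiE ?I A))
            = (\<Prod>j\<in>?I. emeasure (emission \<mu> f (k j)) (A j))"
          by (rule emeasure_PiM_emb[OF em]) (use A in auto)
        moreover have "PiE ?I A \<subseteq> (\<Pi>\<^sub>E j\<in>?I. space (emission \<mu> f (k j)))"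
          using A sets.sets_into_space by (intro PiE_mono) auto
        ultimately show ?thesis by (simp add: prod_emb_id)
      qed
      finally show "emeasure M (PiE ?I A)
        = emeasure (scale_measure (ennreal (path_weight \<pi> Q N k)) ?E) (PiE ?I A)" by simp
    }
    show "range (\<lambda>_::nat. PiE ?I (\<lambda>_. space \<mu>)) \<subseteq> prod_algebra ?I (\<lambda>_. \<mu>)"
      by (auto intro!: prod_algebraI_finite)
    show "(\<Union>i::nat. PiE ?I (\<lambda>_. space \<mu>)) = space ?\<mu>N" by (simp add: space_PiM)
    have "PiE ?I (\<lambda>_. space \<mu>) \<in> sets ?\<mu>N" by (intro sets_PiM_I_finite) auto
    then show "emeasure M (PiE ?I (\<lambda>_. space \<mu>)) \<noteq> \<infinity>" by (simp add: M_em \<Omega>.emeasure_finite)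
  qed
  have "(\<integral>\<^sup>+\<omega>. F (?Y \<omega>) * indicator S \<omega> \<partial>\<Omega>) = (\<integral>\<^sup>+y. F y \<partial>M)"
    unfolding M_def using F Yv S
    by (subst nn_integral_distr) (simp_all add: nn_integral_density mult.commute)
  also have "\<dots> = ennreal (path_weight \<pi> Q N k) * (\<integral>\<^sup>+y. F y \<partial>?E)"
    unfolding M_eq by (rule nn_integral_scale_measure) (use F setsE in \<open>simp cong: measurable_cong_sets\<close>)
  finally show ?thesis by (simp add: S_def)
qed

lemma hmm_law:
  assumes hmm: "hidden_markov_model \<Omega> \<mu> K \<pi> Q f X Y" and N: "1 \<le> N"
    and F: "F \<in> borel_measurable (PiM {1..N} (\<lambda>_. \<mu>))"
  shows "(\<integral>\<^sup>+\<omega>. F (\<lambda>j\<in>{1..N}. Y j \<omega>) \<partial>\<Omega>) = (\<Sum>k\<in>PiE {1..N} (\<lambda>_. {1..K}).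
    ennreal (path_weight \<pi> Q N k) * (\<integral>\<^sup>+y. F y \<partial>PiM {1..N} (\<lambda>j. emission \<mu> f (k j))))"
proof -
  let ?I = "{1..N}"
  let ?P = "PiE ?I (\<lambda>_. {1..K})"
  let ?S = "\<lambda>k. {\<omega>\<in>space \<Omega>. \<forall>j\<in>?I. X j \<omega> = k j}"
  have X: "X j \<in> measurable \<Omega> (count_space {1..K})" and Y: "Y j \<in> measurable \<Omega> \<mu>" if "1 \<le> j" for j
    using hmm that by (simp_all add: hidden_markov_model_def)
  have fin: "finite ?P" by (intro finite_PiE) auto
  have S: "?S k \<in> sets \<Omega>" if "k \<in> ?P" for k by (rule path_event_measurable[OF X that N])
  have Yv: "(\<lambda>\<omega>. \<lambda>j\<in>?I. Y j \<omega>) \<in> measurable \<Omega> (PiM ?I (\<lambda>_. \<mu>))" by (intro measurable_restrict Y) simp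
  have one: "(\<Sum>k\<in>?P. indicator (?S k) \<omega>) = (1::ennreal)" if \<omega>: "\<omega> \<in> space \<Omega>" for \<omega>
  proof -
    let ?k = "\<lambda>j\<in>?I. X j \<omega>"
    have "?k \<in> ?P" using X \<omega> by (auto simp: measurable_def Pi_iff)
    moreover have "indicator (?S k) \<omega> = (if k = ?k then 1 else (0::ennreal))" if "k \<in> ?P" for k
    proof -
      have "(\<forall>j\<in>?I. X j \<omega> = k j) \<longleftrightarrow> k = ?k"
      proof
        assume eq: "\<forall>j\<in>?I. X j \<omega> = k j"
        show "k = ?k"
        proof
          fix j show "k j = ?k j" using eq PiE_arb[OF that, of j] by (cases "j \<in> ?I") (simp_all del: atLeastAtMost_iff)
        qed
      next
        assume "k = ?k"
        then show "\<forall>j\<in>?I. X j \<omega> = k j" by (metis restrict_apply')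
      qed
      then show ?thesis using \<omega> by (simp add: indicator_def)
    qed
    ultimately show ?thesis using fin by (simp add: sum.delta)
  qed
  have "(\<integral>\<^sup>+\<omega>. F (\<lambda>j\<in>?I. Y j \<omega>) \<partial>\<Omega>) = (\<integral>\<^sup>+\<omega>. (\<Sum>k\<in>?P. F (\<lambda>j\<in>?I. Y j \<omega>) * indicator (?S k) \<omega>) \<partial>\<Omega>)"
    by (intro nn_integral_cong) (simp only: one mult_1_right flip: sum_distrib_left)
  also have "\<dots> = (\<Sum>k\<in>?P. \<integral>\<^sup>+\<omega>. F (\<lambda>j\<in>?I. Y j \<omega>) * indicator (?S k) \<omega> \<partial>\<Omega>)"
    using S measurable_compose[OF Yv F] by (intro nn_integral_sum borel_measurable_times_ennreal) auto
  also have "\<dots> = (\<Sum>k\<in>?P. ennreal (path_weight \<pi> Q N k)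
      * (\<integral>\<^sup>+y. F y \<partial>PiM ?I (\<lambda>j. emission \<mu> f (k j))))"
    by (intro sum.cong refl hmm_path_law[OF hmm N _ F])
  finally show ?thesis .
qed

section \<open>Concentration for one test function\<close>

text \<open>A box with one null side is a null set of the product, even if its other sides have infinite measure.\<close>

lemma AE_PiM_sigma_finite:
  assumes \<mu>: "sigma_finite_measure \<mu>" and I: "finite I" and ae: "AE y in \<mu>. P y"
  shows "AE z in PiM I (\<lambda>_. \<mu>). \<forall>i\<in>I. P (z i)"
proof -
  interpret product_sigma_finite "\<lambda>_. \<mu>" using \<mu> by (rule product_sigma_finite.intro)
  have "AE z in PiM I (\<lambda>_. \<mu>). P (z i)" if i: "i \<in> I" for i
  proof -
    obtain N where N: "{y\<in>space \<mu>. \<not> P y} \<subseteq> N" "emeasure \<mu> N = 0" "N \<in> sets \<mu>"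
      using ae by (auto elim: AE_E)
    let ?A = "\<lambda>j. if j = i then N else space \<mu>"
    have "emeasure (PiM I (\<lambda>_. \<mu>)) (PiE I ?A) = (\<Prod>j\<in>I. emeasure \<mu> (?A j))"
      using N I by (intro emeasure_PiM) auto
    also have "\<dots> = 0" using I i N by (auto intro!: prod_zero)
    finally have "PiE I ?A \<in> null_sets (PiM I (\<lambda>_. \<mu>))"
      using N I by (auto simp: null_sets_def intro!: sets_PiM_I_finite)
    then show ?thesis
    proof (rule AE_I')
      show "{z \<in> space (PiM I (\<lambda>_. \<mu>)). \<not> P (z i)} \<subseteq> PiE I ?A"
        using N(1) i by (auto simp: space_PiM PiE_iff subset_eq)
    qed
  qed
  then show ?thesis using I by (simp add: AE_finite_all)
qed

lemma PiM_density:
  assumes \<mu>: "sigma_finite_measure \<mu>" and I: "finite I"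
    and g: "\<And>i. i \<in> I \<Longrightarrow> probability_density \<mu> (g i)"
  shows "PiM I (\<lambda>i. density \<mu> (\<lambda>y. ennreal (g i y)))
    = density (PiM I (\<lambda>_. \<mu>)) (\<lambda>z. ennreal (\<Prod>i\<in>I. g i (z i)))"
proof -
  interpret product_sigma_finite "\<lambda>_. \<mu>" using \<mu> by (rule product_sigma_finite.intro)
  let ?M = "\<lambda>i. density \<mu> (\<lambda>y. ennreal (g i y))"
  have gm: "g i \<in> borel_measurable \<mu>" and g0: "AE y in \<mu>. 0 \<le> g i y" and gp: "prob_space (?M i)"
    if "i \<in> I" for i using g[OF that] by (auto simp: probability_density_def)
  have gz: "(\<lambda>z. g i (z i)) \<in> borel_measurable (PiM I (\<lambda>_. \<mu>))" if "i \<in> I" for i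
    using measurable_compose[OF measurable_component_singleton[OF that, of "\<lambda>_. \<mu>"] gm[OF that]] .
  interpret P: prob_space "PiM I ?M" by (rule prob_space_PiM[OF gp])
  have box: "emeasure (PiM I ?M) (PiE I A) = (\<Prod>i\<in>I. emeasure (?M i) (A i))"
    if A: "\<And>i. i \<in> I \<Longrightarrow> A i \<in> sets \<mu>" for A
  proof -
    have "emeasure (PiM I ?M) (prod_emb I ?M I (PiE I A)) = (\<Prod>i\<in>I. emeasure (?M i) (A i))"
      by (rule emeasure_PiM_emb[OF gp]) (use A I in auto)
    moreover have "PiE I A \<subseteq> (\<Pi>\<^sub>E i\<in>I. space (?M i))"
      using A sets.sets_into_space by (intro PiE_mono) auto
    ultimately show ?thesis by (simp add: prod_emb_id)
  qed
  have "density (PiM I (\<lambda>_. \<mu>)) (\<lambda>z. \<Prod>i\<in>I. ennreal (g i (z i))) = PiM I ?M"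
  proof (rule measure_eqI_PiM_finite[where I = I and M = "\<lambda>_. \<mu>", symmetric])
    show "finite I" by fact
    show "sets (PiM I ?M) = PiM I (\<lambda>_. \<mu>)" by (intro sets_PiM_cong) auto
    show "sets (density (PiM I (\<lambda>_. \<mu>)) (\<lambda>z. \<Prod>i\<in>I. ennreal (g i (z i)))) = PiM I (\<lambda>_. \<mu>)" by simp
    fix A assume A: "\<And>i. i \<in> I \<Longrightarrow> A i \<in> sets \<mu>"
    have "emeasure (density (PiM I (\<lambda>_. \<mu>)) (\<lambda>z. \<Prod>i\<in>I. ennreal (g i (z i)))) (PiE I A)
        = (\<integral>\<^sup>+z. (\<Prod>i\<in>I. ennreal (g i (z i))) * indicator (PiE I A) z \<partial>PiM I (\<lambda>_. \<mu>))"
      using A I gz by (subst emeasure_density)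
        (auto intro!: sets_PiM_I_finite borel_measurable_prod_ennreal measurable_compose[OF _ measurable_ennreal])
    also have "\<dots> = (\<integral>\<^sup>+z. (\<Prod>i\<in>I. ennreal (g i (z i)) * indicator (A i) (z i)) \<partial>PiM I (\<lambda>_. \<mu>))"
    proof (intro nn_integral_cong)
      fix z assume z: "z \<in> space (PiM I (\<lambda>_. \<mu>))"
      have "indicator (PiE I A) z = (\<Prod>i\<in>I. indicator (A i) (z i) :: ennreal)"
      proof (cases "z \<in> PiE I A")
        case True
        then show ?thesis by (auto simp: PiE_iff intro!: prod.neutral)
      next
        case False
        then obtain i where "i \<in> I" "z i \<notin> A i" using z by (auto simp: space_PiM PiE_iff)
        then have "(\<Prod>i\<in>I. indicator (A i) (z i) :: ennreal) = 0"
          using I by (intro prod_zero bexI[of _ i]) simp_all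
        then show ?thesis using False by simp
      qed
      then show "(\<Prod>i\<in>I. ennreal (g i (z i))) * indicator (PiE I A) z
          = (\<Prod>i\<in>I. ennreal (g i (z i)) * indicator (A i) (z i))"
        by (simp add: prod.distrib)
    qed
    also have "\<dots> = (\<Prod>i\<in>I. \<integral>\<^sup>+y. ennreal (g i y) * indicator (A i) y \<partial>\<mu>)"
      using A I gm by (intro product_nn_integral_prod) auto
    also have "\<dots> = (\<Prod>i\<in>I. emeasure (?M i) (A i))"
      using A gm by (intro prod.cong) (auto simp: emeasure_density)
    finally show "emeasure (PiM I ?M) (PiE I A)
        = emeasure (density (PiM I (\<lambda>_. \<mu>)) (\<lambda>z. \<Prod>i\<in>I. ennreal (g i (z i)))) (PiE I A)"
      using box[OF A] by simp
  next
    show "range (\<lambda>_::nat. PiE I (\<lambda>_. space \<mu>)) \<subseteq> prod_algebra I (\<lambda>_. \<mu>)"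
      using I by (auto intro!: prod_algebraI_finite)
    show "(\<Union>i::nat. PiE I (\<lambda>_. space \<mu>)) = space (PiM I (\<lambda>_. \<mu>))" by (simp add: space_PiM)
    show "emeasure (PiM I ?M) (PiE I (\<lambda>_. space \<mu>)) \<noteq> \<infinity>" by (simp add: P.emeasure_finite)
  qed
  moreover have "density (PiM I (\<lambda>_. \<mu>)) (\<lambda>z. \<Prod>i\<in>I. ennreal (g i (z i)))
      = density (PiM I (\<lambda>_. \<mu>)) (\<lambda>z. ennreal (\<Prod>i\<in>I. g i (z i)))"
  proof (rule density_cong)
    have "AE y in \<mu>. \<forall>i\<in>I. 0 \<le> g i y" using g0 I by (simp add: AE_finite_all)
    from AE_PiM_sigma_finite[OF \<mu> I this]
    show "AE z in PiM I (\<lambda>_. \<mu>). (\<Prod>i\<in>I. ennreal (g i (z i))) = ennreal (\<Prod>i\<in>I. g i (z i))"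
      by eventually_elim (simp add: prod_ennreal)
  qed (use gz in \<open>auto intro!: borel_measurable_prod_ennreal borel_measurable_prod measurable_compose[OF _ measurable_ennreal]\<close>)
  ultimately show ?thesis by simp
qed

lemma (in prob_space) square_expectation_le:
  fixes X :: "'a \<Rightarrow> real"
  assumes "integrable M X" "integrable M (\<lambda>x. (X x)\<^sup>2)"
  shows "(\<integral>x. X x \<partial>M)\<^sup>2 \<le> (\<integral>x. (X x)\<^sup>2 \<partial>M)"
  using variance_eq[OF assms] variance_positive[of X] by simp

text \<open>One test function \<open>u\<close> together with a bound \<open>B\<close> of its values, a bound \<open>\<beta>\<close> of the emission densities and
  a bound \<open>V\<close> of the conditional variance of \<open>u\<close> on a window given the chain.\<close>

locale hmm_test_function =
  fixes \<Omega> :: "'w measure" and \<mu> :: "'y measure" and L K :: nat and \<pi> Q f X Y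
    and u :: "(nat \<Rightarrow> 'y) \<Rightarrow> real" and B \<beta> V :: real
  assumes \<mu>: "sigma_finite_measure \<mu>"
    and hmm: "hidden_markov_model \<Omega> \<mu> K \<pi> Q f X Y"
    and tm: "transition_matrix K Q" and st: "stationary_distribution K Q \<pi>" and L: "1 \<le> L"
    and f_le: "\<And>k. k \<in> {1..K} \<Longrightarrow> AE y in \<mu>. f k y \<le> \<beta>"
    and u_meas: "u \<in> borel_measurable (power_measure \<mu> L)"
    and u_bound: "AE z in power_measure \<mu> L. \<bar>u z\<bar> \<le> B"
    and u_L2: "integrable (power_measure \<mu> L) (\<lambda>z. (u z)\<^sup>2)"
    and V: "\<beta> ^ L * (\<integral>z. (u z)\<^sup>2 \<partial>power_measure \<mu> L) \<le> V" and B: "0 \<le> B"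
begin

abbreviation window_law :: "(nat \<Rightarrow> nat) \<Rightarrow> (nat \<Rightarrow> 'y) measure" where
  "window_law \<kappa> \<equiv> PiM {1..L} (\<lambda>i. emission \<mu> f (\<kappa> i))"

abbreviation window_density :: "(nat \<Rightarrow> nat) \<Rightarrow> (nat \<Rightarrow> 'y) \<Rightarrow> real" where
  "window_density \<kappa> z \<equiv> (\<Prod>i\<in>{1..L}. f (\<kappa> i) (z i))"

definition cond_mean :: "(nat \<Rightarrow> nat) \<Rightarrow> real" where
  "cond_mean \<kappa> = (\<integral>z. u z \<partial>window_law \<kappa>)"

lemma density_f: "k \<in> {1..K} \<Longrightarrow> probability_density \<mu> (f k)"
  using hmm by (simp add: hidden_markov_model_def)

context
  fixes \<kappa> :: "nat \<Rightarrow> nat" assumes \<kappa>: "\<And>i. i \<in> {1..L} \<Longrightarrow> \<kappa> i \<in> {1..K}"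
begin

lemma window_law_density:
  "window_law \<kappa> = density (power_measure \<mu> L) (\<lambda>z. ennreal (window_density \<kappa> z))"
  unfolding emission_def by (rule PiM_density[OF \<mu> _ density_f[OF \<kappa>]]) simp

lemma window_density_measurable: "window_density \<kappa> \<in> borel_measurable (power_measure \<mu> L)"
proof (rule borel_measurable_prod)
  fix i assume i: "i \<in> {1..L}"
  have "f (\<kappa> i) \<in> borel_measurable \<mu>" using density_f[OF \<kappa>[OF i]] by (simp add: probability_density_def)
  then show "(\<lambda>z. f (\<kappa> i) (z i)) \<in> borel_measurable (power_measure \<mu> L)"
    by (rule measurable_compose[OF measurable_component_singleton[OF i]])
qed

lemma window_density_bounds:
  "AE z in power_measure \<mu> L. 0 \<le> window_density \<kappa> z \<and> window_density \<kappa> z \<le> \<beta> ^ L"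
proof -
  have "AE y in \<mu>. \<forall>i\<in>{1..L}. 0 \<le> f (\<kappa> i) y \<and> f (\<kappa> i) y \<le> \<beta>"
  proof (subst AE_finite_all)
    show "\<forall>i\<in>{1..L}. AE y in \<mu>. 0 \<le> f (\<kappa> i) y \<and> f (\<kappa> i) y \<le> \<beta>"
    proof
      fix i assume "i \<in> {1..L}"
      then have "\<kappa> i \<in> {1..K}" by (rule \<kappa>)
      then have "AE y in \<mu>. 0 \<le> f (\<kappa> i) y" "AE y in \<mu>. f (\<kappa> i) y \<le> \<beta>"
        using density_f f_le by (auto simp: probability_density_def)
      then show "AE y in \<mu>. 0 \<le> f (\<kappa> i) y \<and> f (\<kappa> i) y \<le> \<beta>" by eventually_elim simp
    qed
  qed simp
  from AE_PiM_sigma_finite[OF \<mu> _ this, of "{1..L}"]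
  have "AE z in power_measure \<mu> L. \<forall>i\<in>{1..L}. \<forall>j\<in>{1..L}. 0 \<le> f (\<kappa> j) (z i) \<and> f (\<kappa> j) (z i) \<le> \<beta>" by simp
  then show ?thesis
  proof eventually_elim
    case (elim z)
    then have *: "0 \<le> f (\<kappa> i) (z i)" "f (\<kappa> i) (z i) \<le> \<beta>" if "i \<in> {1..L}" for i using that by auto
    have "window_density \<kappa> z \<le> (\<Prod>i\<in>{1..L}. \<beta>)" using * by (intro prod_mono) auto
    then show ?case using * by (auto intro!: prod_nonneg)
  qed
qed

lemma prob_space_window_law: "prob_space (window_law \<kappa>)"
  using density_f \<kappa> unfolding emission_def by (intro prob_space_PiM) (auto simp: probability_density_def)

lemma u_bound_window: "AE z in window_law \<kappa>. \<bar>u z\<bar> \<le> B"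
  unfolding window_law_density using window_density_measurable u_bound
  by (subst AE_density) (auto elim: eventually_mono)

lemma u_meas_window: "u \<in> borel_measurable (window_law \<kappa>)"
  using u_meas by (simp cong: measurable_cong_sets sets_PiM_cong)

lemma integrable_u_window: "integrable (window_law \<kappa>) u"
proof -
  interpret prob_space "window_law \<kappa>" by (rule prob_space_window_law)
  show ?thesis by (rule integrable_const_bound[OF _ u_meas_window]) (use u_bound_window in auto)
qed

lemma u_square_bound_window: "AE z in window_law \<kappa>. (u z)\<^sup>2 \<le> B\<^sup>2"
  using u_bound_window by eventually_elim (use B in \<open>simp add: abs_le_square_iff[symmetric]\<close>)

lemma integrable_u_square_window: "integrable (window_law \<kappa>) (\<lambda>z. (u z)\<^sup>2)"
proof -
  interpret prob_space "window_law \<kappa>" by (rule prob_space_window_law)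
  show ?thesis
    by (rule integrable_const_bound[of _ "B\<^sup>2"]) (use u_square_bound_window u_meas_window in auto)
qed

text \<open>The conditional density of a window is at most \<open>\<beta>\<^sup>L\<close>. This is what bounds the conditional variances
  uniformly over the paths of the chain.\<close>

lemma u_square_window: "(\<integral>z. (u z)\<^sup>2 \<partial>window_law \<kappa>) \<le> min V (B\<^sup>2)"
proof -
  interpret prob_space "window_law \<kappa>" by (rule prob_space_window_law)
  have 1: "(\<integral>z. (u z)\<^sup>2 \<partial>window_law \<kappa>) \<le> B\<^sup>2"
    by (rule integral_le_const[OF integrable_u_square_window u_square_bound_window])
  have nn: "AE z in power_measure \<mu> L. 0 \<le> window_density \<kappa> z"
    using window_density_bounds by eventually_elim simp
  have m2: "(\<lambda>z. (u z)\<^sup>2) \<in> borel_measurable (power_measure \<mu> L)" using u_meas by simp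
  have "(\<integral>z. (u z)\<^sup>2 \<partial>window_law \<kappa>) = (\<integral>z. window_density \<kappa> z * (u z)\<^sup>2 \<partial>power_measure \<mu> L)"
    unfolding window_law_density by (rule integral_real_density[OF window_density_measurable nn m2])
  also have "\<dots> \<le> (\<integral>z. \<beta> ^ L * (u z)\<^sup>2 \<partial>power_measure \<mu> L)"
  proof (rule integral_mono_AE)
    show "integrable (power_measure \<mu> L) (\<lambda>z. window_density \<kappa> z * (u z)\<^sup>2)"
      using integrable_u_square_window unfolding window_law_density
      by (subst (asm) integrable_real_density[OF window_density_measurable nn m2])
    show "integrable (power_measure \<mu> L) (\<lambda>z. \<beta> ^ L * (u z)\<^sup>2)" using u_L2 by simp
    show "AE z in power_measure \<mu> L. window_density \<kappa> z * (u z)\<^sup>2 \<le> \<beta> ^ L * (u z)\<^sup>2"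
      using window_density_bounds by eventually_elim (simp add: mult_right_mono)
  qed
  also have "\<dots> \<le> V" using V by simp
  finally show ?thesis using 1 by simp
qed

lemma cond_mean_bound: "\<bar>cond_mean \<kappa>\<bar> \<le> sqrt (min V (B\<^sup>2))"
proof -
  interpret prob_space "window_law \<kappa>" by (rule prob_space_window_law)
  have "(cond_mean \<kappa>)\<^sup>2 \<le> min V (B\<^sup>2)"
    using square_expectation_le[OF integrable_u_window integrable_u_square_window] u_square_window
    unfolding cond_mean_def by linarith
  then show ?thesis by (simp add: real_le_rsqrt)
qed

lemma cond_mean_density:
  "integrable (power_measure \<mu> L) (\<lambda>z. window_density \<kappa> z * u z)"
  "cond_mean \<kappa> = (\<integral>z. window_density \<kappa> z * u z \<partial>power_measure \<mu> L)"
proof -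
  have nn: "AE z in power_measure \<mu> L. 0 \<le> window_density \<kappa> z"
    using window_density_bounds by eventually_elim simp
  show "integrable (power_measure \<mu> L) (\<lambda>z. window_density \<kappa> z * u z)"
    using integrable_u_window unfolding window_law_density
    by (subst (asm) integrable_real_density[OF window_density_measurable nn u_meas])
  show "cond_mean \<kappa> = (\<integral>z. window_density \<kappa> z * u z \<partial>power_measure \<mu> L)"
    unfolding cond_mean_def window_law_density
    by (rule integral_real_density[OF window_density_measurable nn u_meas])
qed

end

lemma cond_mean_local: "(\<And>i. i \<in> {1..L} \<Longrightarrow> \<kappa> i = \<kappa>' i) \<Longrightarrow> cond_mean \<kappa> = cond_mean \<kappa>'"
  unfolding cond_mean_def by (intro arg_cong2[where f = "integral\<^sup>L"] PiM_cong refl) simp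

lemma chain_mean_cond_mean:
  "chain_mean K \<pi> Q L cond_mean = (\<integral>z. u z * hmm_density L K \<pi> Q f z \<partial>power_measure \<mu> L)"
proof -
  let ?P = "PiE {1..L} (\<lambda>_. {1..K})"
  have "(\<integral>z. u z * hmm_density L K \<pi> Q f z \<partial>power_measure \<mu> L)
      = (\<integral>z. (\<Sum>k\<in>?P. path_weight \<pi> Q L k * (window_density k z * u z)) \<partial>power_measure \<mu> L)"
    by (intro Bochner_Integration.integral_cong refl)
      (simp add: hmm_density_def path_weight_def sum_distrib_left mult_ac)
  also have "\<dots> = (\<Sum>k\<in>?P. path_weight \<pi> Q L k * (\<integral>z. window_density k z * u z \<partial>power_measure \<mu> L))"
  proof (subst Bochner_Integration.integral_sum)
    fix k assume "k \<in> ?P"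
    then have "k i \<in> {1..K}" if "i \<in> {1..L}" for i using that by (rule PiE_mem)
    then show "integrable (power_measure \<mu> L) (\<lambda>z. path_weight \<pi> Q L k * (window_density k z * u z))"
      by (intro integrable_mult_right cond_mean_density(1))
  qed (simp only: integral_mult_right_zero)
  also have "\<dots> = (\<Sum>k\<in>?P. path_weight \<pi> Q L k * cond_mean k)"
    by (intro sum.cong refl arg_cong2[where f = "(*)"] cond_mean_density(2)[symmetric]) (rule PiE_mem)
  finally show ?thesis by (simp add: chain_mean_def)
qed

end

lemma (in prob_space) nn_integral_affine:
  assumes "g \<in> borel_measurable M"
  shows "(\<integral>\<^sup>+x. c * g x + d \<partial>M) = c * (\<integral>\<^sup>+x. g x \<partial>M) + d"
  using assms by (simp add: nn_integral_add nn_integral_cmult emeasure_space_1)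

lemma ennreal_half_add:
  assumes "0 \<le> p" "0 \<le> q"
  shows "ennreal (1 / 2) * ennreal p + ennreal (q / 2) = ennreal (p / 2 + q / 2)"
proof -
  have "ennreal (1 / 2) * ennreal p = ennreal (1 / 2 * p)"
    using assms by (intro ennreal_mult[symmetric]) auto
  moreover have "ennreal (1 / 2 * p) + ennreal (q / 2) = ennreal (1 / 2 * p + q / 2)"
    using assms by (intro ennreal_plus[symmetric]) auto
  moreover have "1 / 2 * p = p / 2" by simp
  ultimately show ?thesis by (simp only:)
qed

context hmm_test_function
begin

abbreviation centered_sum :: "nat \<Rightarrow> (nat \<Rightarrow> 'y) \<Rightarrow> real" where
  "centered_sum n y \<equiv> (\<Sum>s\<in>{1..n}. u (window L s y) - chain_mean K \<pi> Q L cond_mean)"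

lemma centered_sum_measurable:
  "centered_sum n \<in> borel_measurable (PiM {1..n + L - 1} (\<lambda>_. \<mu>))"
proof -
  have "(\<lambda>y. u (window L s y)) \<in> borel_measurable (PiM {1..n + L - 1} (\<lambda>_. \<mu>))" if "s \<in> {1..n}" for s
  proof -
    have "window L s \<in> measurable (PiM {1..n + L - 1} (\<lambda>_. \<mu>)) (power_measure \<mu> L)"
      using that by (intro measurable_window) auto
    from measurable_compose[OF this u_meas] show ?thesis .
  qed
  then show ?thesis by (intro borel_measurable_sum borel_measurable_diff) auto
qed

text \<open>Given the path \<open>k\<close> of the chain, the centred sum is the sum of its conditional fluctuation, which is
  handled by independence of the observations, and of the fluctuation of the conditional mean, a
  function of \<open>k\<close> alone.\<close>

lemma hmm_exp_moment:
  assumes C: "chain_window_constant K Q L C" and n: "1 \<le> n"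
    and D: "D = 4 * (real L + C)" and th: "D * \<bar>\<theta>\<bar> * B \<le> 1"
  shows "(\<integral>\<^sup>+\<omega>. ennreal (exp (\<theta> * centered_sum n (\<lambda>j\<in>{1..n + L - 1}. Y j \<omega>))) \<partial>\<Omega>)
    \<le> ennreal (exp (1 + (D * \<theta>)\<^sup>2 * V * real n))"
proof -
  let ?N = "n + L - 1"
  let ?P = "PiE {1..?N} (\<lambda>_. {1..K})"
  let ?c = "chain_mean K \<pi> Q L cond_mean"
  have N: "1 \<le> ?N" using n L by simp
  define v where "v = min V (B\<^sup>2)"
  have C1: "1 \<le> C" using C by (simp add: chain_window_constant_def)
  have K1: "1 \<le> K"
  proof (rule ccontr)
    assume "\<not> 1 \<le> K"
    then show False using st by (simp add: stationary_distribution_def)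
  qed
  have v0: "0 \<le> v"
  proof -
    have "0 \<le> (\<integral>z. (u z)\<^sup>2 \<partial>window_law (\<lambda>_. 1))" by simp
    also have "\<dots> \<le> v" unfolding v_def by (rule u_square_window) (use K1 in simp)
    finally show ?thesis .
  qed
  have vB: "sqrt v \<le> B" using B by (simp add: v_def real_le_lsqrt)
  have vV: "v \<le> V" by (simp add: v_def)
  define bound where "bound = exp (1 + (D * \<theta>)\<^sup>2 * V * real n)"
  have D_sq: "(2 * (real L * \<theta>))\<^sup>2 * v * real n \<le> (D * \<theta>)\<^sup>2 * V * real n"
    and D_sq': "(C * (2 * \<theta>) * sqrt v)\<^sup>2 * real n \<le> (D * \<theta>)\<^sup>2 * V * real n"
  proof -
    have "(2 * real L)\<^sup>2 \<le> D\<^sup>2" "(2 * C)\<^sup>2 \<le> D\<^sup>2"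
      using C1 unfolding D by (intro power_mono; simp)+
    then have "(2 * real L)\<^sup>2 * (\<theta>\<^sup>2 * (v * real n)) \<le> D\<^sup>2 * (\<theta>\<^sup>2 * (v * real n))"
      and "(2 * C)\<^sup>2 * (\<theta>\<^sup>2 * (v * real n)) \<le> D\<^sup>2 * (\<theta>\<^sup>2 * (v * real n))"
      using v0 by (auto intro!: mult_right_mono)
    moreover have "D\<^sup>2 * (\<theta>\<^sup>2 * (v * real n)) \<le> D\<^sup>2 * (\<theta>\<^sup>2 * (V * real n))"
      using vV by (intro mult_left_mono mult_right_mono) auto
    ultimately show "(2 * (real L * \<theta>))\<^sup>2 * v * real n \<le> (D * \<theta>)\<^sup>2 * V * real n"
      and "(C * (2 * \<theta>) * sqrt v)\<^sup>2 * real n \<le> (D * \<theta>)\<^sup>2 * V * real n"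
      using v0 by (simp_all add: power_mult_distrib mult_ac)
  qed
  \<comment> \<open>here and below the parameter is \<open>2 * \<theta>\<close>, because separating the two parts by convexity doubles it\<close>
  have cond: "(\<integral>\<^sup>+y. ennreal (exp (2 * \<theta> * (\<Sum>s\<in>{1..n}. u (window L s y) - cond_mean (window L s k))))
      \<partial>PiM {1..?N} (\<lambda>j. emission \<mu> f (k j))) \<le> ennreal bound" if k: "k \<in> ?P" for k
  proof -
    have kj: "k j \<in> {1..K}" if "j \<in> {1..?N}" for j using k that by auto
    have kw: "k (s + i - 1) \<in> {1..K}" if "s \<in> {1..n}" "i \<in> {1..L}" for s i
      by (rule kj) (use that in auto)
    have "cond_mean (window L s k) = (\<integral>z. u z \<partial>PiM {1..L} (\<lambda>i. emission \<mu> f (k (s + i - 1))))" for s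
      unfolding cond_mean_def by (intro arg_cong2[where f = "integral\<^sup>L"] PiM_cong refl) (simp add: window_def)
    then have "(\<integral>\<^sup>+y. ennreal (exp (2 * \<theta> * (\<Sum>s\<in>{1..n}. u (window L s y) - cond_mean (window L s k))))
        \<partial>PiM {1..?N} (\<lambda>j. emission \<mu> f (k j)))
      = (\<integral>\<^sup>+y. ennreal (exp (2 * \<theta> * (\<Sum>s\<in>{1..n}. u (window L s y)
          - (\<integral>z. u z \<partial>PiM {1..L} (\<lambda>i. emission \<mu> f (k (s + i - 1)))))))
        \<partial>PiM {1..?N} (\<lambda>j. emission \<mu> f (k j)))" by (simp only:)
    also have "\<dots> \<le> ennreal (exp ((real L * (2 * \<theta>))\<^sup>2 * v * real n))"
    proof (rule independent_windows_exp_bound[OF L n, where S = \<mu> and B = B])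
      show "prob_space (emission \<mu> f (k j))" if "j \<in> {1..?N}" for j
        using density_f[OF kj[OF that]] by (simp add: probability_density_def emission_def)
      show "sets (emission \<mu> f (k j)) = sets \<mu>" for j by simp
      show "u \<in> borel_measurable (power_measure \<mu> L)" by (rule u_meas)
      show "0 \<le> v" by (rule v0)
      have "real L * (2 * \<bar>\<theta>\<bar>) * (2 * B) \<le> D * \<bar>\<theta>\<bar> * B"
        unfolding D using C1 B by (simp add: algebra_simps)
      then show "\<bar>real L * (2 * \<theta>)\<bar> * (2 * B) \<le> 1" using th by (simp add: abs_mult)
      fix s assume s: "s \<in> {1..n}"
      show "AE z in PiM {1..L} (\<lambda>i. emission \<mu> f (k (s + i - 1))). \<bar>u z\<bar> \<le> B"
        by (rule u_bound_window[OF kw[OF s]])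
      show "(\<integral>z. (u z)\<^sup>2 \<partial>PiM {1..L} (\<lambda>i. emission \<mu> f (k (s + i - 1)))) \<le> v"
        unfolding v_def by (rule u_square_window[OF kw[OF s]])
    qed
    also have "\<dots> \<le> ennreal bound"
    proof (rule ennreal_leI)
      have "(real L * (2 * \<theta>))\<^sup>2 * v * real n \<le> 1 + (D * \<theta>)\<^sup>2 * V * real n"
        using D_sq by (simp add: mult_ac)
      then show "exp ((real L * (2 * \<theta>))\<^sup>2 * v * real n) \<le> bound" unfolding bound_def by simp
    qed
    finally show ?thesis .
  qed
  have chain: "chain_mean K \<pi> Q ?N (\<lambda>k. exp (2 * \<theta> * (\<Sum>s\<in>{1..n}. cond_mean (window L s k) - ?c))) \<le> bound"
  proof -
    have "C * \<bar>2 * \<theta>\<bar> * sqrt v \<le> C * \<bar>2 * \<theta>\<bar> * B" using C1 vB by (intro mult_left_mono) auto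
    also have "\<dots> = (2 * C) * (\<bar>\<theta>\<bar> * B)" by (simp add: abs_mult)
    also have "\<dots> \<le> D * (\<bar>\<theta>\<bar> * B)" unfolding D using C1 B by (intro mult_right_mono) auto
    also have "\<dots> = D * \<bar>\<theta>\<bar> * B" by simp
    finally have "C * \<bar>2 * \<theta>\<bar> * sqrt v \<le> 1" using th by linarith
    then have "chain_mean K \<pi> Q ?N (\<lambda>k. exp (2 * \<theta> * (\<Sum>s\<in>{1..n}. cond_mean (window L s k) - ?c)))
        \<le> exp (1 + (C * (2 * \<theta>) * sqrt v)\<^sup>2 * real n)"
      unfolding v_def by (intro chain_window_constantD[OF C st cond_mean_local cond_mean_bound _ n])
    also have "\<dots> \<le> bound" using D_sq' by (simp add: bound_def)
    finally show ?thesis .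
  qed
  have w0: "0 \<le> path_weight \<pi> Q ?N k" if "k \<in> ?P" for k by (rule path_weight_nonneg[OF tm st N that])
  have "(\<integral>\<^sup>+\<omega>. ennreal (exp (\<theta> * centered_sum n (\<lambda>j\<in>{1..?N}. Y j \<omega>))) \<partial>\<Omega>)
      = (\<Sum>k\<in>?P. ennreal (path_weight \<pi> Q ?N k)
        * (\<integral>\<^sup>+y. ennreal (exp (\<theta> * centered_sum n y)) \<partial>PiM {1..?N} (\<lambda>j. emission \<mu> f (k j))))"
    by (rule hmm_law[OF hmm N], rule measurable_compose[OF centered_sum_measurable]) measurable
  also have "\<dots> \<le> (\<Sum>k\<in>?P. ennreal (path_weight \<pi> Q ?N k * (bound / 2 +
      exp (2 * \<theta> * (\<Sum>s\<in>{1..n}. cond_mean (window L s k) - ?c)) / 2)))"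
  proof (rule sum_mono)
    fix k assume k: "k \<in> ?P"
    let ?E = "PiM {1..?N} (\<lambda>j. emission \<mu> f (k j))"
    let ?a = "\<lambda>y. \<Sum>s\<in>{1..n}. u (window L s y) - cond_mean (window L s k)"
    let ?b = "\<Sum>s\<in>{1..n}. cond_mean (window L s k) - ?c"
    interpret E: prob_space ?E
    proof (rule prob_space_PiM)
      fix j assume "j \<in> {1..?N}"
      then have "k j \<in> {1..K}" using k by auto
      then show "prob_space (emission \<mu> f (k j))"
        using density_f by (simp add: probability_density_def emission_def)
    qed
    have a_eq: "?a y = centered_sum n y - ?b" for y by (simp add: sum_subtractf)
    have a_meas [measurable]: "?a \<in> borel_measurable ?E"
      unfolding a_eq using centered_sum_measurable[of n]
      by (simp cong: measurable_cong_sets sets_PiM_cong)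
    have "(\<integral>\<^sup>+y. ennreal (exp (\<theta> * centered_sum n y)) \<partial>?E)
        \<le> (\<integral>\<^sup>+y. ennreal (1 / 2) * ennreal (exp (2 * \<theta> * ?a y)) + ennreal (exp (2 * \<theta> * ?b) / 2) \<partial>?E)"
    proof (rule nn_integral_mono)
      fix y
      have "exp (\<theta> * centered_sum n y) = exp (\<theta> * ?a y + \<theta> * ?b)"
        unfolding a_eq by (simp only: right_diff_distrib) simp
      also have "\<dots> \<le> (exp (2 * \<theta> * ?a y) + exp (2 * \<theta> * ?b)) / 2"
        using exp_add_le_mean[of "\<theta> * ?a y" "\<theta> * ?b"] by (simp only: mult.assoc)
      finally show "ennreal (exp (\<theta> * centered_sum n y))
          \<le> ennreal (1 / 2) * ennreal (exp (2 * \<theta> * ?a y)) + ennreal (exp (2 * \<theta> * ?b) / 2)"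
        unfolding ennreal_half_add[OF exp_ge_zero exp_ge_zero] by (intro ennreal_leI) (simp only: add_divide_distrib)
    qed
    also have "\<dots> = ennreal (1 / 2) * (\<integral>\<^sup>+y. ennreal (exp (2 * \<theta> * ?a y)) \<partial>?E) + ennreal (exp (2 * \<theta> * ?b) / 2)"
      by (rule E.nn_integral_affine, rule measurable_compose[OF a_meas]) measurable
    also have "\<dots> \<le> ennreal (1 / 2) * ennreal bound + ennreal (exp (2 * \<theta> * ?b) / 2)"
      by (intro add_mono mult_left_mono cond[OF k]) auto
    also have "\<dots> = ennreal (bound / 2 + exp (2 * \<theta> * ?b) / 2)"
      by (rule ennreal_half_add) (simp_all add: bound_def)
    finally show "ennreal (path_weight \<pi> Q ?N k) * (\<integral>\<^sup>+y. ennreal (exp (\<theta> * centered_sum n y)) \<partial>?E)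
        \<le> ennreal (path_weight \<pi> Q ?N k * (bound / 2 + exp (2 * \<theta> * ?b) / 2))"
      using w0[OF k] by (simp add: ennreal_mult' mult_left_mono)
  qed
  also have "\<dots> = ennreal (\<Sum>k\<in>?P. path_weight \<pi> Q ?N k * (bound / 2 +
      exp (2 * \<theta> * (\<Sum>s\<in>{1..n}. cond_mean (window L s k) - ?c)) / 2))"
    by (rule sum_ennreal) (intro mult_nonneg_nonneg w0, auto simp: bound_def)
  also have "(\<Sum>k\<in>?P. path_weight \<pi> Q ?N k * (bound / 2 +
      exp (2 * \<theta> * (\<Sum>s\<in>{1..n}. cond_mean (window L s k) - ?c)) / 2))
      = chain_mean K \<pi> Q ?N (\<lambda>_. 1) * (bound / 2)
        + chain_mean K \<pi> Q ?N (\<lambda>k. exp (2 * \<theta> * (\<Sum>s\<in>{1..n}. cond_mean (window L s k) - ?c))) / 2"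
    by (simp add: chain_mean_def sum.distrib distrib_left sum_distrib_right sum_divide_distrib)
  also have "ennreal \<dots> \<le> ennreal bound"
    using chain chain_mean_one[OF tm st N] by (intro ennreal_leI) simp
  finally show ?thesis unfolding bound_def .
qed

text \<open>The condition \<open>V \<le> \<Gamma> * \<epsilon>\<close> makes the quadratic term of Chernoff's exponent at most half of the linear one.\<close>

lemma hmm_upper_tail:
  assumes C: "chain_window_constant K Q L C" and n: "1 \<le> n" and D: "D = 4 * (real L + C)"
    and \<epsilon>: "0 < \<epsilon>" "V \<le> \<Gamma> * \<epsilon>" and th: "0 < \<theta>" "D * \<theta> * B \<le> 1" "2 * D\<^sup>2 * \<Gamma> * \<theta> \<le> 1"
  shows "measure \<Omega> {\<omega>\<in>space \<Omega>. \<epsilon> \<le> empirical_process \<mu> L (hmm_density L K \<pi> Q f) n (\<lambda>j. Y j \<omega>) u}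
    \<le> exp (1 - \<theta> * real n * \<epsilon> / 2)"
proof -
  let ?N = "n + L - 1"
  interpret \<Omega>: prob_space \<Omega> using hmm by (simp add: hidden_markov_model_def)
  have Y: "Y j \<in> measurable \<Omega> \<mu>" if "1 \<le> j" for j
    using hmm that by (simp add: hidden_markov_model_def)
  let ?S = "\<lambda>\<omega>. centered_sum n (\<lambda>j\<in>{1..?N}. Y j \<omega>)"
  have S: "?S \<in> borel_measurable \<Omega>"
    by (rule measurable_compose[OF measurable_restrict centered_sum_measurable]) (auto intro: Y)
  have emp: "empirical_process \<mu> L (hmm_density L K \<pi> Q f) n (\<lambda>j. Y j \<omega>) u = ?S \<omega> / real n" for \<omega>
  proof -
    have "window L s (\<lambda>j\<in>{1..?N}. Y j \<omega>) = window L s (\<lambda>j. Y j \<omega>)" if "s \<in> {1..n}" for s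
      by (rule window_cong) (use that in auto)
    then have "?S \<omega> = (\<Sum>s\<in>{1..n}. u (window L s (\<lambda>j. Y j \<omega>)) - chain_mean K \<pi> Q L cond_mean)"
      by (intro sum.cong refl) simp
    then show ?thesis
      using n by (simp add: empirical_process_def window_def chain_mean_cond_mean sum_subtractf field_simps)
  qed
  have "emeasure \<Omega> {\<omega>\<in>space \<Omega>. real n * \<epsilon> \<le> ?S \<omega>}
      \<le> ennreal (exp (- \<theta> * (real n * \<epsilon>))) * (\<integral>\<^sup>+\<omega>. ennreal (exp (\<theta> * ?S \<omega>)) \<partial>\<Omega>)"
  proof -
    have "emeasure \<Omega> {\<omega>\<in>space \<Omega>. real n * \<epsilon> \<le> ?S \<omega>}
        = (\<integral>\<^sup>+\<omega>. indicator {\<omega>\<in>space \<Omega>. real n * \<epsilon> \<le> ?S \<omega>} \<omega> \<partial>\<Omega>)"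
      using S by simp
    also have "\<dots> \<le> (\<integral>\<^sup>+\<omega>. ennreal (exp (- \<theta> * (real n * \<epsilon>))) * ennreal (exp (\<theta> * ?S \<omega>)) \<partial>\<Omega>)"
    proof (rule nn_integral_mono)
      fix \<omega>
      show "indicator {\<omega>\<in>space \<Omega>. real n * \<epsilon> \<le> ?S \<omega>} \<omega>
          \<le> ennreal (exp (- \<theta> * (real n * \<epsilon>))) * ennreal (exp (\<theta> * ?S \<omega>))"
      proof (cases "real n * \<epsilon> \<le> ?S \<omega>")
        case True
        then have "\<theta> * (real n * \<epsilon>) \<le> \<theta> * ?S \<omega>" using th by (intro mult_left_mono) auto
        then have "1 \<le> exp (- \<theta> * (real n * \<epsilon>)) * exp (\<theta> * ?S \<omega>)"
          by (simp flip: exp_add)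
        then have "1 \<le> ennreal (exp (- \<theta> * (real n * \<epsilon>)) * exp (\<theta> * ?S \<omega>))"
          by (metis ennreal_1 ennreal_leI)
        then show ?thesis by (simp add: ennreal_mult'' indicator_def)
      qed (simp add: indicator_def)
    qed
    finally show ?thesis using S by (simp add: nn_integral_cmult)
  qed
  also have "\<dots> \<le> ennreal (exp (- \<theta> * (real n * \<epsilon>))) * ennreal (exp (1 + (D * \<theta>)\<^sup>2 * V * real n))"
    using th by (intro mult_left_mono hmm_exp_moment[OF C n D]) auto
  also have "\<dots> = ennreal (exp (- \<theta> * (real n * \<epsilon>) + (1 + (D * \<theta>)\<^sup>2 * V * real n)))"
    unfolding exp_add[of "- \<theta> * (real n * \<epsilon>)"] by (rule ennreal_mult''[symmetric]) simp
  also have "\<dots> \<le> ennreal (exp (1 - \<theta> * real n * \<epsilon> / 2))"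
  proof (rule ennreal_leI)
    have "(D * \<theta>)\<^sup>2 * V * real n \<le> (D * \<theta>)\<^sup>2 * (\<Gamma> * \<epsilon>) * real n"
      using \<epsilon> by (intro mult_right_mono mult_left_mono) auto
    also have "\<dots> = (2 * D\<^sup>2 * \<Gamma> * \<theta>) * (\<theta> * \<epsilon> * real n / 2)"
      by (simp add: power2_eq_square)
    also have "\<dots> \<le> 1 * (\<theta> * \<epsilon> * real n / 2)"
      using th \<epsilon> by (intro mult_right_mono) auto
    finally show "exp (- \<theta> * (real n * \<epsilon>) + (1 + (D * \<theta>)\<^sup>2 * V * real n)) \<le> exp (1 - \<theta> * real n * \<epsilon> / 2)"
      by (simp add: algebra_simps)
  qed
  finally have "measure \<Omega> {\<omega>\<in>space \<Omega>. real n * \<epsilon> \<le> ?S \<omega>} \<le> exp (1 - \<theta> * real n * \<epsilon> / 2)"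
    by (simp add: \<Omega>.emeasure_eq_measure)
  moreover have "\<epsilon> \<le> ?S \<omega> / real n \<longleftrightarrow> real n * \<epsilon> \<le> ?S \<omega>" for \<omega>
    using n by (simp add: pos_le_divide_eq mult.commute)
  ultimately show ?thesis unfolding emp by simp
qed

end

section \<open>Bounded coordinates in a finite-dimensional function space\<close>

definition L2_inner :: "'a measure \<Rightarrow> ('a \<Rightarrow> real) \<Rightarrow> ('a \<Rightarrow> real) \<Rightarrow> real" where
  "L2_inner \<mu> f g = (\<integral>y. f y * g y \<partial>\<mu>)"

lemma L2_space_mult:
  assumes "f \<in> L2_space \<mu>" "g \<in> L2_space \<mu>"
  shows "integrable \<mu> (\<lambda>y. f y * g y)"
proof (rule Bochner_Integration.integrable_bound[of \<mu> "\<lambda>y. (f y)\<^sup>2 + (g y)\<^sup>2"])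
  show "integrable \<mu> (\<lambda>y. (f y)\<^sup>2 + (g y)\<^sup>2)" using assms by (simp add: L2_space_def)
  show "(\<lambda>y. f y * g y) \<in> borel_measurable \<mu>" using assms by (auto simp: L2_space_def)
  have "\<bar>a * b\<bar> \<le> a\<^sup>2 + b\<^sup>2" for a b :: real
  proof -
    have "0 \<le> (\<bar>a\<bar> - \<bar>b\<bar>)\<^sup>2" by simp
    then have "2 * \<bar>a * b\<bar> \<le> a\<^sup>2 + b\<^sup>2" by (simp add: power2_diff abs_mult)
    then show ?thesis using abs_ge_zero[of "a * b"] by linarith
  qed
  then show "AE y in \<mu>. norm (f y * g y) \<le> norm ((f y)\<^sup>2 + (g y)\<^sup>2)" by simp
qed

lemma L2_space_lincomb:
  assumes "\<And>i. i \<in> I \<Longrightarrow> f i \<in> L2_space \<mu>" "finite I"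
  shows "(\<lambda>y. \<Sum>i\<in>I. c i * f i y) \<in> L2_space \<mu>"
proof -
  have add: "(\<lambda>y. g y + h y) \<in> L2_space \<mu>" if "g \<in> L2_space \<mu>" "h \<in> L2_space \<mu>" for g h
    using that L2_space_mult[OF that] by (auto simp: L2_space_def power2_sum mult.assoc)
  have scale: "(\<lambda>y. a * g y) \<in> L2_space \<mu>" if "g \<in> L2_space \<mu>" for g a
    using that by (auto simp: L2_space_def power_mult_distrib)
  show ?thesis using assms(2,1)
  proof (induction I rule: finite_induct)
    case empty
    then show ?case by (simp add: L2_space_def)
  next
    case (insert i I)
    then show ?case using add[OF scale[of "f i" "c i"]] by simp
  qed
qed

lemma L2_inner_bound:
  assumes "f \<in> L2_space \<mu>" "g \<in> L2_space \<mu>" "L2_norm \<mu> f \<le> R" "L2_norm \<mu> g \<le> R"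
  shows "\<bar>L2_inner \<mu> f g\<bar> \<le> R\<^sup>2"
proof -
  have sq: "(\<integral>y. (h y)\<^sup>2 \<partial>\<mu>) \<le> R\<^sup>2" if "L2_norm \<mu> h \<le> R" for h
  proof -
    have "0 \<le> (\<integral>y. (h y)\<^sup>2 \<partial>\<mu>)" by simp
    then show ?thesis using that power_mono[of "L2_norm \<mu> h" R 2] by (simp add: L2_norm_def)
  qed
  have "\<bar>L2_inner \<mu> f g\<bar> \<le> (\<integral>y. \<bar>f y * g y\<bar> \<partial>\<mu>)" unfolding L2_inner_def by (rule integral_abs_bound)
  also have "\<dots> \<le> (\<integral>y. ((f y)\<^sup>2 + (g y)\<^sup>2) / 2 \<partial>\<mu>)"
  proof (rule integral_mono)
    show "integrable \<mu> (\<lambda>y. \<bar>f y * g y\<bar>)" by (intro integrable_abs L2_space_mult assms)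
    show "integrable \<mu> (\<lambda>y. ((f y)\<^sup>2 + (g y)\<^sup>2) / 2)" using assms by (simp add: L2_space_def)
    fix y
    have "0 \<le> (\<bar>f y\<bar> - \<bar>g y\<bar>)\<^sup>2" by simp
    then show "\<bar>f y * g y\<bar> \<le> ((f y)\<^sup>2 + (g y)\<^sup>2) / 2" by (simp add: power2_diff abs_mult)
  qed
  also have "\<dots> = ((\<integral>y. (f y)\<^sup>2 \<partial>\<mu>) + (\<integral>y. (g y)\<^sup>2 \<partial>\<mu>)) / 2"
    using assms by (simp add: L2_space_def)
  also have "\<dots> \<le> R\<^sup>2" using sq[OF assms(3)] sq[OF assms(4)] by simp
  finally show ?thesis .
qed

lemma L2_inner_lincomb:
  assumes "\<And>i. i \<in> I \<Longrightarrow> f i \<in> L2_space \<mu>" "g \<in> L2_space \<mu>" "finite I"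
  shows "L2_inner \<mu> (\<lambda>y. \<Sum>i\<in>I. c i * f i y) g = (\<Sum>i\<in>I. c i * L2_inner \<mu> (f i) g)"
proof -
  have "L2_inner \<mu> (\<lambda>y. \<Sum>i\<in>I. c i * f i y) g = (\<integral>y. (\<Sum>i\<in>I. c i * (f i y * g y)) \<partial>\<mu>)"
    unfolding L2_inner_def by (simp add: sum_distrib_right mult.assoc)
  also have "\<dots> = (\<Sum>i\<in>I. c i * L2_inner \<mu> (f i) g)"
    unfolding L2_inner_def
    by (subst Bochner_Integration.integral_sum) (auto intro!: integrable_mult_right L2_space_mult assms)
  finally show ?thesis .
qed

lemma L2_inner_self_eq_0:
  assumes "f \<in> L2_space \<mu>" "L2_inner \<mu> f f = 0"
  shows "AE y in \<mu>. f y = 0"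
proof -
  have i: "integrable \<mu> (\<lambda>y. f y * f y)" by (rule L2_space_mult[OF assms(1,1)])
  have "AE y in \<mu>. f y * f y = 0"
    using integral_nonneg_eq_0_iff_AE[OF i] assms(2) by (simp add: L2_inner_def)
  then show ?thesis by eventually_elim simp
qed

text \<open>Provides the exchange lemma for families of functions: an independent family in the span of \<open>M\<close>
  functions has at most \<open>M\<close> members.\<close>

interpretation fun_space: vector_space "\<lambda>(c::real) (f::'a \<Rightarrow> real) y. c * f y"
  by unfold_locales (auto simp: fun_eq_iff algebra_simps)

lemma sum_fun_eq: "(\<Sum>i\<in>I. g i) = (\<lambda>y. \<Sum>i\<in>I. g i y)" for g :: "'i \<Rightarrow> 'a \<Rightarrow> real"
  by (induction I rule: infinite_finite_induct) (auto simp: fun_eq_iff)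

text \<open>Independence is linear independence of functions, not of classes modulo null functions.\<close>

lemma maximal_independent_family:
  fixes G :: "('a \<Rightarrow> real) set" and b :: "nat \<Rightarrow> 'a \<Rightarrow> real"
  assumes "G \<subseteq> range (\<lambda>(c :: nat \<Rightarrow> real) y. \<Sum>i<M. c i * b i y)"
  obtains d v where "d \<le> M" "\<And>i. i < d \<Longrightarrow> v i \<in> G"
    "\<And>g. g \<in> G \<Longrightarrow> \<exists>a. g = (\<lambda>y. \<Sum>i<d. a i * v i y)"
    "\<And>a i. (\<lambda>y. \<Sum>i<d. a i * v i y) = (\<lambda>_. 0) \<Longrightarrow> i < d \<Longrightarrow> a i = 0"
proof -
  obtain A where A: "A \<subseteq> G" "fun_space.independent A" "G \<subseteq> fun_space.span A"
    using fun_space.maximal_independent_subset[of G] by blast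
  have "G \<subseteq> fun_space.span (b ` {..<M})"
  proof
    fix g assume "g \<in> G"
    then obtain c where "g = (\<lambda>y. \<Sum>i<M. c i * b i y)" using assms by auto
    then have "g = (\<Sum>i<M. (\<lambda>y. c i * b i y))" by (simp add: sum_fun_eq)
    also have "\<dots> \<in> fun_space.span (b ` {..<M})"
      by (intro fun_space.span_sum fun_space.span_scale fun_space.span_base) auto
    finally show "g \<in> fun_space.span (b ` {..<M})" .
  qed
  then have "A \<subseteq> fun_space.span (b ` {..<M})" using A by blast
  from fun_space.independent_span_bound[OF _ A(2) this]
  have fA: "finite A" and "card A \<le> card (b ` {..<M})" by auto
  then have d: "card A \<le> M" using card_image_le[of "{..<M}" b] by simp
  obtain v where v: "bij_betw v {..<card A} A"
    using ex_bij_betw_nat_finite[OF fA] by (auto simp: lessThan_atLeast0)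
  have reindex: "(\<Sum>x\<in>A. (\<lambda>y. a x * x y)) = (\<lambda>y. \<Sum>i<card A. a (v i) * v i y)" for a
    unfolding sum_fun_eq by (intro ext) (rule sum.reindex_bij_betw[OF v, symmetric])
  show ?thesis
  proof (rule that[OF d, of v])
    show "v i \<in> G" if "i < card A" for i
      using v that A(1) by (auto simp: bij_betw_def)
  next
    fix g assume "g \<in> G"
    then have "g \<in> fun_space.span A" using A by blast
    then obtain a where "g = (\<Sum>x\<in>A. (\<lambda>y. a x * x y))"
      using fun_space.span_finite[OF fA] by auto
    then show "\<exists>a. g = (\<lambda>y. \<Sum>i<card A. a i * v i y)" unfolding reindex by (intro exI[of _ "a \<circ> v"]) simp
  next
    fix a :: "nat \<Rightarrow> real" and i
    assume 0: "(\<lambda>y. \<Sum>i<card A. a i * v i y) = (\<lambda>_. 0)" and i: "i < card A"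
    define a' where "a' x = a (inv_into {..<card A} v x)" for x
    have inv: "a' (v j) = a j" if "j < card A" for j
      using v that by (simp add: a'_def bij_betw_def)
    have "(\<Sum>x\<in>A. (\<lambda>y. a' x * x y)) = 0"
      unfolding reindex using 0 inv by (simp add: zero_fun_def)
    from fun_space.independentD[OF A(2) fA subset_refl this, of "v i"]
    have "a' (v i) = 0" using v i by (auto simp: bij_betw_def)
    then show "a i = 0" using inv[OF i] by simp
  qed
qed

lemma abs_det_le:
  fixes A :: "real mat"
  assumes A: "A \<in> carrier_mat d d" and b: "\<And>i j. i < d \<Longrightarrow> j < d \<Longrightarrow> \<bar>A $$ (i, j)\<bar> \<le> r"
  shows "\<bar>det A\<bar> \<le> fact d * r ^ d"
proof -
  have "\<bar>det A\<bar> \<le> (\<Sum>p\<in>{p. p permutes {0..<d}}. \<bar>signof p * (\<Prod>i = 0..<d. A $$ (i, p i))\<bar>)"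
    unfolding det_def'[OF A] by (rule sum_abs)
  also have "\<dots> \<le> (\<Sum>p\<in>{p. p permutes {0..<d}}. r ^ d)"
  proof (rule sum_mono)
    fix p assume p: "p \<in> {p. p permutes {0..<d}}"
    have "\<bar>signof p * (\<Prod>i = 0..<d. A $$ (i, p i))\<bar> = (\<Prod>i = 0..<d. \<bar>A $$ (i, p i)\<bar>)"
      by (simp add: abs_mult abs_prod sign_def)
    also have "\<dots> \<le> (\<Prod>i = 0..<d. r)"
      using p permutes_in_image[of p "{0..<d}"] by (intro prod_mono) (auto intro: b)
    finally show "\<bar>signof p * (\<Prod>i = 0..<d. A $$ (i, p i))\<bar> \<le> r ^ d" by simp
  qed
  also have "\<dots> = fact d * r ^ d" by (simp add: card_permutations[of _ d])
  finally show ?thesis .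
qed

text \<open>Let \<open>v\<close> be a maximal independent family in \<open>G\<close>. The Gram matrix of \<open>v\<close> is regular, and the determinants of
  the matrices \<open>\<langle>w i, v j\<rangle>\<close> with \<open>w i \<in> G\<close> are bounded. If \<open>w\<close> attains at least half of their supremum,
  Cramer's rule expresses the coordinates of \<open>g \<in> G\<close> as quotients of two such determinants, where the one
  in the denominator is that of \<open>w\<close>; so they have modulus at most \<open>2\<close>.
  The supremum need not be attained, hence the bound \<open>2\<close> in place of \<open>1\<close>.\<close>

lemma near_extremal_basis:
  assumes V: "L2_subspace \<mu> M V" and G: "G \<subseteq> V" and R: "\<And>f. f \<in> G \<Longrightarrow> L2_norm \<mu> f \<le> R"
  shows "\<exists>d\<le>M. \<exists>w. (\<forall>i<d. w i \<in> G) \<and>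
    (\<forall>g\<in>G. \<exists>c. (\<forall>i<d. \<bar>c i\<bar> \<le> 2) \<and> g = (\<lambda>y. \<Sum>i<d. c i * w i y))"
proof -
  obtain b where b: "\<And>i. i < M \<Longrightarrow> b i \<in> L2_space \<mu>"
    and b_indep: "\<And>c. AE y in \<mu>. (\<Sum>i<M. c i * b i y) = 0 \<Longrightarrow> \<forall>i<M. c i = 0"
    and V_eq: "V = range (\<lambda>(c :: nat \<Rightarrow> real) y. \<Sum>i<M. c i * b i y)"
    using V unfolding L2_subspace_def by blast
  have V_iff: "f \<in> V \<longleftrightarrow> (\<exists>c. f = (\<lambda>y. \<Sum>i<M. c i * b i y))" for f
    unfolding V_eq by blast
  have V_L2: "f \<in> L2_space \<mu>" if "f \<in> V" for f
    using that b unfolding V_eq by (auto intro!: L2_space_lincomb)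
  have V_zero: "f = (\<lambda>_. 0)" if fV: "f \<in> V" and f0: "AE y in \<mu>. f y = 0" for f
  proof -
    obtain c where c: "f = (\<lambda>y. \<Sum>i<M. c i * b i y)" using fV unfolding V_eq by blast
    have "\<forall>i<M. c i = 0" using f0 unfolding c by (rule b_indep)
    then show ?thesis by (simp add: c)
  qed
  have V_lincomb: "(\<lambda>y. \<Sum>i\<in>I. c i * f i y) \<in> V" if "\<And>i. i \<in> I \<Longrightarrow> f i \<in> V" "finite I"
    for I :: "nat set" and c f
  proof -
    have "\<exists>a. f i = (\<lambda>y. \<Sum>j<M. a j * b j y)" if "i \<in> I" for i
      using \<open>\<And>i. i \<in> I \<Longrightarrow> f i \<in> V\<close>[OF that] unfolding V_eq by blast
    then obtain a where a: "\<And>i. i \<in> I \<Longrightarrow> f i = (\<lambda>y. \<Sum>j<M. a i j * b j y)" by metis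
    have "(\<lambda>y. \<Sum>i\<in>I. c i * f i y) = (\<lambda>y. \<Sum>j<M. (\<Sum>i\<in>I. c i * a i j) * b j y)"
    proof
      fix y
      have "(\<Sum>i\<in>I. c i * f i y) = (\<Sum>i\<in>I. \<Sum>j<M. c i * a i j * b j y)"
        by (intro sum.cong refl) (simp add: a sum_distrib_left mult.assoc)
      also have "\<dots> = (\<Sum>j<M. (\<Sum>i\<in>I. c i * a i j) * b j y)"
        by (subst sum.swap) (simp add: sum_distrib_right)
      finally show "(\<Sum>i\<in>I. c i * f i y) = (\<Sum>j<M. (\<Sum>i\<in>I. c i * a i j) * b j y)" .
    qed
    then show ?thesis unfolding V_iff by (intro exI[where x = "\<lambda>j. \<Sum>i\<in>I. c i * a i j"])
  qed
  have "G \<subseteq> range (\<lambda>(c :: nat \<Rightarrow> real) y. \<Sum>i<M. c i * b i y)" using G unfolding V_eq .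
  then obtain d v where d: "d \<le> M" and vG: "\<And>i. i < d \<Longrightarrow> v i \<in> G"
    and span: "\<And>g. g \<in> G \<Longrightarrow> \<exists>a. g = (\<lambda>y. \<Sum>i<d. a i * v i y)"
    and indep: "\<And>a i. (\<lambda>y. \<Sum>i<d. a i * v i y) = (\<lambda>_. 0) \<Longrightarrow> i < d \<Longrightarrow> a i = 0"
    by (rule maximal_independent_family) (rule that; assumption)
  have vV: "v i \<in> V" if "i < d" for i using vG[OF that] G by blast
  have GL2: "g \<in> L2_space \<mu>" if "g \<in> G" for g using that G V_L2 by blast
  define A :: "(nat \<Rightarrow> 'a \<Rightarrow> real) \<Rightarrow> real mat" where
    "A w = mat d d (\<lambda>(j, i). L2_inner \<mu> (w i) (v j))" for w
  have A: "A w \<in> carrier_mat d d" for w by (simp add: A_def)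
  \<comment> \<open>such an \<open>r\<close> is orthogonal to itself, so it vanishes almost everywhere, hence identically on \<open>V\<close>\<close>
  have orth: "r = (\<lambda>_. 0)"
    if r: "r = (\<lambda>y. \<Sum>i<d. a i * v i y)" and o: "\<And>j. j < d \<Longrightarrow> L2_inner \<mu> r (v j) = 0" for r a
  proof -
    have rV: "r \<in> V" unfolding r by (rule V_lincomb) (auto intro: vV)
    have comm: "L2_inner \<mu> (v j) r = L2_inner \<mu> r (v j)" for j
      by (simp add: L2_inner_def mult.commute)
    have "L2_inner \<mu> r r = (\<Sum>i<d. a i * L2_inner \<mu> (v i) r)"
      by (subst (1) r) (rule L2_inner_lincomb, use vV V_L2 rV in auto)
    also have "\<dots> = 0" using o comm by simp
    finally show ?thesis using L2_inner_self_eq_0 V_L2[OF rV] V_zero[OF rV] by blast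
  qed
  have Amult: "(A w *\<^sub>v x) $ j = L2_inner \<mu> (\<lambda>y. \<Sum>i<d. x $ i * w i y) (v j)"
    if "\<And>i. i < d \<Longrightarrow> w i \<in> G" "x \<in> carrier_vec d" "j < d" for w x j
  proof -
    have "(A w *\<^sub>v x) $ j = (\<Sum>i<d. x $ i * L2_inner \<mu> (w i) (v j))"
      using that by (simp add: A_def scalar_prod_def lessThan_atLeast0 mult.commute)
    also have "\<dots> = L2_inner \<mu> (\<lambda>y. \<Sum>i<d. x $ i * w i y) (v j)"
      by (rule L2_inner_lincomb[symmetric]) (use that GL2 vV V_L2 in auto)
    finally show ?thesis .
  qed
  have det_v: "det (A v) \<noteq> 0"
  proof
    assume "det (A v) = 0"
    then obtain x where x: "x \<in> carrier_vec d" "x \<noteq> 0\<^sub>v d" "A v *\<^sub>v x = 0\<^sub>v d"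
      using det_0_iff_vec_prod_zero_field[OF A] by auto
    have "L2_inner \<mu> (\<lambda>y. \<Sum>i<d. x $ i * v i y) (v j) = 0" if "j < d" for j
      using Amult[of v x j, OF vG x(1) that] x(3) that by simp
    then have "(\<lambda>y. \<Sum>i<d. x $ i * v i y) = (\<lambda>_. 0)"
      by (rule orth[where a = "\<lambda>i. x $ i", OF refl])
    then have "x $ i = 0" if "i < d" for i using indep that by blast
    then have "x = 0\<^sub>v d" using x(1) by (intro eq_vecI) auto
    then show False using x(2) by simp
  qed
  \<comment> \<open>up to a factor that depends on \<open>v\<close> only, \<open>det (A w)\<close> is the determinant of the coordinates of \<open>w\<close>
    with respect to \<open>v\<close>\<close>
  define D where "D = (\<lambda>w. \<bar>det (A w)\<bar>) ` {w. \<forall>i<d. w i \<in> G}"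
  have bdd: "bdd_above D"
  proof (rule bdd_aboveI)
    fix t assume "t \<in> D"
    then obtain w where w: "\<And>i. i < d \<Longrightarrow> w i \<in> G" "t = \<bar>det (A w)\<bar>" by (auto simp: D_def)
    show "t \<le> fact d * (R\<^sup>2) ^ d"
      unfolding w(2)
    proof (rule abs_det_le[OF A])
      fix j i assume "j < d" "i < d"
      then show "\<bar>A w $$ (j, i)\<bar> \<le> R\<^sup>2"
        using w(1) vG by (simp add: A_def) (intro L2_inner_bound GL2 R, auto)
    qed
  qed
  have Dle: "\<bar>det (A w)\<bar> \<le> Sup D" if "\<And>i. i < d \<Longrightarrow> w i \<in> G" for w
    using that by (intro cSup_upper bdd) (auto simp: D_def)
  have "0 < Sup D" using Dle[of v, OF vG] det_v by auto
  then have "Sup D / 2 < Sup D" by simp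
  moreover have "D \<noteq> {}" using vG by (auto simp: D_def)
  ultimately obtain t where t: "t \<in> D" "Sup D / 2 < t" using less_cSupD by blast
  obtain w where w': "\<forall>i<d. w i \<in> G" "t = \<bar>det (A w)\<bar>" using t(1) unfolding D_def by blast
  then have w: "\<And>i. i < d \<Longrightarrow> w i \<in> G" by blast
  have large: "Sup D < 2 * \<bar>det (A w)\<bar>" using t(2) w'(2) by linarith
  have det_w: "det (A w) \<noteq> 0" using large \<open>0 < Sup D\<close> by auto
  have "\<exists>c. (\<forall>i<d. \<bar>c i\<bar> \<le> 2) \<and> g = (\<lambda>y. \<Sum>i<d. c i * w i y)" if g: "g \<in> G" for g
  proof -
    define gv where "gv = vec d (\<lambda>j. L2_inner \<mu> g (v j))"
    define x where "x = (1 / det (A w)) \<cdot>\<^sub>v (adj_mat (A w) *\<^sub>v gv)"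
    have gv: "gv \<in> carrier_vec d" by (simp add: gv_def)
    have adj: "adj_mat (A w) \<in> carrier_mat d d" by (rule adj_mat(1)[OF A])
    have x: "x \<in> carrier_vec d"
      unfolding x_def by (intro smult_carrier_vec[THEN iffD2] mult_mat_vec_carrier[OF adj gv])
    have Ax: "A w *\<^sub>v x = gv"
    proof -
      have "A w *\<^sub>v x = (1 / det (A w)) \<cdot>\<^sub>v (A w *\<^sub>v (adj_mat (A w) *\<^sub>v gv))"
        unfolding x_def by (rule mult_mat_vec[OF A mult_mat_vec_carrier[OF adj gv]])
      also have "A w *\<^sub>v (adj_mat (A w) *\<^sub>v gv) = (det (A w) \<cdot>\<^sub>m 1\<^sub>m d) *\<^sub>v gv"
        by (simp add: assoc_mult_mat_vec[OF A adj gv, symmetric] adj_mat(2)[OF A])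
      also have "(1 / det (A w)) \<cdot>\<^sub>v \<dots> = gv"
        using gv det_w by (intro eq_vecI) auto
      finally show ?thesis .
    qed
    have coeff: "\<bar>x $ k\<bar> \<le> 2" if k: "k < d" for k
    proof -
      have "replace_col (A w) gv k = A (w(k := g))"
        using k by (intro eq_matI) (auto simp: replace_col_def A_def gv_def)
      then have "det (A (w(k := g))) = x $ k * det (A w)"
        using cramer_lemma_mat[OF A x k, of w] Ax by simp
      moreover have "\<bar>det (A (w(k := g)))\<bar> \<le> Sup D" using w g by (intro Dle) auto
      ultimately have "\<bar>x $ k\<bar> * \<bar>det (A w)\<bar> \<le> 2 * \<bar>det (A w)\<bar>" using large by (simp add: abs_mult)
      then show ?thesis using det_w by simp
    qed
    obtain a where a: "g = (\<lambda>y. \<Sum>i<d. a i * v i y)" using span[OF g] by blast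
    have "\<exists>a. w i = (\<lambda>y. \<Sum>j<d. a j * v j y)" if "i < d" for i using span[OF w[OF that]] .
    then obtain e where e: "\<And>i. i < d \<Longrightarrow> w i = (\<lambda>y. \<Sum>j<d. e i j * v j y)" by metis
    define r where "r y = g y - (\<Sum>i<d. x $ i * w i y)" for y
    have "r = (\<lambda>y. \<Sum>j<d. (a j - (\<Sum>i<d. x $ i * e i j)) * v j y)"
    proof
      fix y
      have "(\<Sum>i<d. x $ i * w i y) = (\<Sum>i<d. \<Sum>j<d. x $ i * e i j * v j y)"
        by (intro sum.cong refl) (simp add: e sum_distrib_left mult.assoc)
      also have "\<dots> = (\<Sum>j<d. (\<Sum>i<d. x $ i * e i j) * v j y)"
        by (subst sum.swap) (simp add: sum_distrib_right)
      finally show "r y = (\<Sum>j<d. (a j - (\<Sum>i<d. x $ i * e i j)) * v j y)"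
        by (simp add: r_def a left_diff_distrib sum_subtractf)
    qed
    moreover have "L2_inner \<mu> r (v j) = 0" if j: "j < d" for j
    proof -
      have W: "(\<lambda>y. \<Sum>i<d. x $ i * w i y) \<in> L2_space \<mu>"
        by (rule L2_space_lincomb) (use w GL2 in auto)
      have "L2_inner \<mu> r (v j) = L2_inner \<mu> g (v j) - L2_inner \<mu> (\<lambda>y. \<Sum>i<d. x $ i * w i y) (v j)"
        unfolding L2_inner_def r_def left_diff_distrib
        by (rule Bochner_Integration.integral_diff) (intro L2_space_mult GL2 g W vG j)+
      also have "\<dots> = gv $ j - (A w *\<^sub>v x) $ j"
        using Amult[of w x j, OF w x j] j by (simp add: gv_def)
      finally show ?thesis by (simp add: Ax)
    qed
    ultimately have "r = (\<lambda>_. 0)" by (rule orth)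
    then have "g = (\<lambda>y. \<Sum>i<d. x $ i * w i y)" by (auto simp: r_def fun_eq_iff)
    then show ?thesis using coeff by blast
  qed
  then show ?thesis using d w by blast
qed

section \<open>Nets of hidden Markov densities\<close>

text \<open>Net points are chosen inside \<open>S\<close>, one in each nonempty cell of a partition.\<close>

lemma finite_representatives:
  assumes "finite T" "sig ` S \<subseteq> T"
  shows "\<exists>N\<subseteq>S. finite N \<and> card N \<le> card T \<and> (\<forall>t\<in>S. \<exists>t'\<in>N. sig t' = sig t)"
proof (rule exI[of _ "inv_into S sig ` sig ` S"], intro conjI ballI)
  have fin: "finite (sig ` S)" using assms by (rule finite_subset[rotated])
  show "inv_into S sig ` sig ` S \<subseteq> S" by (auto intro: inv_into_into)
  show "finite (inv_into S sig ` sig ` S)" using fin by simp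
  show "card (inv_into S sig ` sig ` S) \<le> card T"
    using card_image_le[OF fin, of "inv_into S sig"] card_mono[OF assms] by simp
  fix t assume t: "t \<in> S"
  then have "sig (inv_into S sig (sig t)) = sig t" by (intro f_inv_into_f) auto
  then show "\<exists>t'\<in>inv_into S sig ` sig ` S. sig t' = sig t" using t by blast
qed

lemma mult_close:
  fixes a b :: real
  assumes "\<bar>a\<bar> \<le> A" "\<bar>b\<bar> \<le> A" "\<bar>a - b\<bar> \<le> p * A" "\<bar>a'\<bar> \<le> A'" "\<bar>b'\<bar> \<le> A'" "\<bar>a' - b'\<bar> \<le> p' * A'"
  shows "\<bar>a * a'\<bar> \<le> A * A'" "\<bar>b * b'\<bar> \<le> A * A'" "\<bar>a * a' - b * b'\<bar> \<le> (p + p') * (A * A')"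
proof -
  show "\<bar>a * a'\<bar> \<le> A * A'" "\<bar>b * b'\<bar> \<le> A * A'"
    using assms by (auto simp: abs_mult intro!: mult_mono)
  have "a * a' - b * b' = (a - b) * a' + b * (a' - b')" by (simp add: algebra_simps)
  then have "\<bar>a * a' - b * b'\<bar> \<le> \<bar>a - b\<bar> * \<bar>a'\<bar> + \<bar>b\<bar> * \<bar>a' - b'\<bar>"
    by (metis abs_mult abs_triangle_ineq)
  also have "\<dots> \<le> (p * A) * A' + A * (p' * A')"
    using assms by (intro add_mono mult_mono) auto
  finally show "\<bar>a * a' - b * b'\<bar> \<le> (p + p') * (A * A')" by (simp add: algebra_simps)
qed

lemma prod_close:
  fixes a b A :: "'i \<Rightarrow> real"
  assumes "finite I" "\<And>i. i \<in> I \<Longrightarrow> \<bar>a i\<bar> \<le> A i" "\<And>i. i \<in> I \<Longrightarrow> \<bar>b i\<bar> \<le> A i"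
    "\<And>i. i \<in> I \<Longrightarrow> \<bar>a i - b i\<bar> \<le> \<eta> * A i"
  shows "\<bar>prod a I\<bar> \<le> prod A I \<and> \<bar>prod b I\<bar> \<le> prod A I \<and> \<bar>prod a I - prod b I\<bar> \<le> real (card I) * \<eta> * prod A I"
  using assms
proof (induction I rule: finite_induct)
  case (insert i I)
  have "\<bar>a i * prod a I\<bar> \<le> A i * prod A I" "\<bar>b i * prod b I\<bar> \<le> A i * prod A I"
    "\<bar>a i * prod a I - b i * prod b I\<bar> \<le> (\<eta> + real (card I) * \<eta>) * (A i * prod A I)"
  proof -
    have i: "\<bar>a i\<bar> \<le> A i" "\<bar>b i\<bar> \<le> A i" "\<bar>a i - b i\<bar> \<le> \<eta> * A i"
      using insert.prems by auto
    have I: "\<bar>prod a I\<bar> \<le> prod A I" "\<bar>prod b I\<bar> \<le> prod A I"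
      "\<bar>prod a I - prod b I\<bar> \<le> (real (card I) * \<eta>) * prod A I"
      using insert.prems insert.IH by auto
    show "\<bar>a i * prod a I\<bar> \<le> A i * prod A I" "\<bar>b i * prod b I\<bar> \<le> A i * prod A I"
      "\<bar>a i * prod a I - b i * prod b I\<bar> \<le> (\<eta> + real (card I) * \<eta>) * (A i * prod A I)"
      by (rule mult_close[OF i I])+
  qed
  then show ?case using insert by (simp add: distrib_right)
qed simp

lemma hmm_density_close:
  fixes f f' :: "nat \<Rightarrow> 'a \<Rightarrow> real" and F :: "'a \<Rightarrow> real"
  assumes L: "1 \<le> L"
    and \<pi>: "\<And>k. k \<in> {1..K} \<Longrightarrow> \<bar>\<pi> k\<bar> \<le> 1 \<and> \<bar>\<pi>' k\<bar> \<le> 1 \<and> \<bar>\<pi> k - \<pi>' k\<bar> \<le> \<eta>"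
    and Q: "\<And>k l. k \<in> {1..K} \<Longrightarrow> l \<in> {1..K} \<Longrightarrow> \<bar>Q k l\<bar> \<le> 1 \<and> \<bar>Q' k l\<bar> \<le> 1 \<and> \<bar>Q k l - Q' k l\<bar> \<le> \<eta>"
    and f: "\<And>k y. k \<in> {1..K} \<Longrightarrow> \<bar>f k y\<bar> \<le> F y \<and> \<bar>f' k y\<bar> \<le> F y \<and> \<bar>f k y - f' k y\<bar> \<le> \<eta> * F y"
  shows "\<bar>hmm_density L K \<pi> Q f z - hmm_density L K \<pi>' Q' f' z\<bar>
    \<le> real K ^ L * (2 * real L * \<eta>) * (\<Prod>i\<in>{1..L}. F (z i))"
proof -
  let ?P = "PiE {1..L} (\<lambda>_. {1..K})"
  have each: "\<bar>\<pi> (k 1) * (\<Prod>i\<in>{2..L}. Q (k (i - 1)) (k i)) * (\<Prod>i\<in>{1..L}. f (k i) (z i))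
      - \<pi>' (k 1) * (\<Prod>i\<in>{2..L}. Q' (k (i - 1)) (k i)) * (\<Prod>i\<in>{1..L}. f' (k i) (z i))\<bar>
      \<le> 2 * real L * \<eta> * (\<Prod>i\<in>{1..L}. F (z i))" if k: "k \<in> ?P" for k
  proof -
    have kK: "k i \<in> {1..K}" if "1 \<le> i" "i \<le> L" for i using k that by auto
    have 1: "\<bar>\<pi> (k 1)\<bar> \<le> 1" "\<bar>\<pi>' (k 1)\<bar> \<le> 1" "\<bar>\<pi> (k 1) - \<pi>' (k 1)\<bar> \<le> \<eta> * 1"
      using \<pi>[OF kK[of 1]] L by simp_all
    have 2: "\<bar>\<Prod>i\<in>{2..L}. Q (k (i - 1)) (k i)\<bar> \<le> (\<Prod>i\<in>{2..L}. 1) \<and>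
        \<bar>\<Prod>i\<in>{2..L}. Q' (k (i - 1)) (k i)\<bar> \<le> (\<Prod>i\<in>{2..L}. 1) \<and>
        \<bar>(\<Prod>i\<in>{2..L}. Q (k (i - 1)) (k i)) - (\<Prod>i\<in>{2..L}. Q' (k (i - 1)) (k i))\<bar>
          \<le> real (card {2..L}) * \<eta> * (\<Prod>i\<in>{2..L}. 1)"
    proof (rule prod_close)
      fix i assume i: "i \<in> {2..L}"
      then have "1 \<le> i - 1" "i - 1 \<le> L" "1 \<le> i" "i \<le> L" by auto
      then have "k (i - 1) \<in> {1..K}" "k i \<in> {1..K}" by (simp_all only: kK)
      from Q[OF this] show "\<bar>Q (k (i - 1)) (k i)\<bar> \<le> 1" "\<bar>Q' (k (i - 1)) (k i)\<bar> \<le> 1"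
        "\<bar>Q (k (i - 1)) (k i) - Q' (k (i - 1)) (k i)\<bar> \<le> \<eta> * 1" by simp_all
    qed simp
    have 3: "\<bar>\<Prod>i\<in>{1..L}. f (k i) (z i)\<bar> \<le> (\<Prod>i\<in>{1..L}. F (z i)) \<and>
        \<bar>\<Prod>i\<in>{1..L}. f' (k i) (z i)\<bar> \<le> (\<Prod>i\<in>{1..L}. F (z i)) \<and>
        \<bar>(\<Prod>i\<in>{1..L}. f (k i) (z i)) - (\<Prod>i\<in>{1..L}. f' (k i) (z i))\<bar>
          \<le> real (card {1..L}) * \<eta> * (\<Prod>i\<in>{1..L}. F (z i))"
      by (rule prod_close) (use f kK in auto)
    note 12 = mult_close[OF 1 2[THEN conjunct1] 2[THEN conjunct2, THEN conjunct1] 2[THEN conjunct2, THEN conjunct2]]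
    note 123 = mult_close(3)[OF 12 3[THEN conjunct1] 3[THEN conjunct2, THEN conjunct1] 3[THEN conjunct2, THEN conjunct2]]
    have "\<eta> + real (card {2..L}) * \<eta> + real (card {1..L}) * \<eta> = 2 * real L * \<eta>"
      using L by (simp add: of_nat_diff algebra_simps)
    then show ?thesis using 123 by (simp add: mult_ac)
  qed
  have "\<bar>hmm_density L K \<pi> Q f z - hmm_density L K \<pi>' Q' f' z\<bar>
      \<le> (\<Sum>k\<in>?P. 2 * real L * \<eta> * (\<Prod>i\<in>{1..L}. F (z i)))"
    unfolding hmm_density_def sum_subtractf[symmetric]
    by (rule order_trans[OF sum_abs]) (intro sum_mono each)
  also have "\<dots> = real K ^ L * (2 * real L * \<eta>) * (\<Prod>i\<in>{1..L}. F (z i))"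
    by (simp add: card_PiE)
  finally show ?thesis .
qed

lemma close_if_floor_eq:
  assumes "\<lfloor>real m * x\<rfloor> = \<lfloor>real m * x'\<rfloor>" "1 \<le> m"
  shows "\<bar>x - x'\<bar> \<le> 1 / real m"
proof -
  have "\<bar>real m * x - real m * x'\<bar> \<le> 1" using assms(1) by linarith
  then have "real m * \<bar>x - x'\<bar> \<le> 1" by (metis abs_mult abs_of_nat right_diff_distrib)
  then show ?thesis using assms(2) by (simp add: field_simps)
qed

lemma floor_in_range:
  assumes "\<bar>x\<bar> \<le> 2"
  shows "\<lfloor>real m * x\<rfloor> \<in> {-2 * int m..2 * int m}"
proof -
  have "\<bar>real m * x\<bar> \<le> real m * 2" using assms by (simp add: abs_mult mult_left_mono)
  then have "real m * x \<le> 2 * real m" "- (2 * real m) \<le> real m * x" by linarith+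
  then show ?thesis by (auto simp: le_floor_iff floor_le_iff)
qed

lemma transition_matrix_le_1:
  assumes "transition_matrix K Q" "k \<in> {1..K}" "l \<in> {1..K}"
  shows "\<bar>Q k l\<bar> \<le> 1"
proof -
  have "Q k l \<le> (\<Sum>l\<in>{1..K}. Q k l)"
    using assms by (intro member_le_sum) (auto simp: transition_matrix_def)
  then show ?thesis using assms by (auto simp: transition_matrix_def)
qed

lemma stationary_distribution_le_1:
  assumes "stationary_distribution K Q \<pi>" "k \<in> {1..K}"
  shows "\<bar>\<pi> k\<bar> \<le> 1"
proof -
  have "\<pi> k \<le> (\<Sum>k\<in>{1..K}. \<pi> k)"
    using assms by (intro member_le_sum) (auto simp: stationary_distribution_def)
  then show ?thesis using assms by (auto simp: stationary_distribution_def)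
qed

text \<open>Elements of the model are grouped by the integer parts of their parameters multiplied by \<open>m\<close>. There are at
  most \<open>4 m + 1\<close> values for each of the \<open>K\<close> entries of \<open>\<pi>\<close>, the \<open>K\<^sup>2\<close> entries of \<open>Q\<close> and the \<open>K d\<close> coordinates.
  The estimate holds at every point \<open>z\<close>, and the factor \<open>K\<^sup>L\<close> from the number of summands of
  the density is harmless for \<open>K \<le> n\<close>, because \<open>m\<close> may be a power of \<open>n\<close>.\<close>

lemma hmm_model_net:
  fixes w :: "nat \<Rightarrow> 'a \<Rightarrow> real"
  assumes L: "1 \<le> L" and m: "1 \<le> m" and d: "d \<le> M"
    and coord: "\<And>g. g \<in> G \<Longrightarrow> \<exists>c. (\<forall>i<d. \<bar>c i\<bar> \<le> 2) \<and> g = (\<lambda>y. \<Sum>i<d. c i * w i y)"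
  shows "\<exists>N\<subseteq>hmm_model L K G. finite N \<and> card N \<le> (5 * m) ^ (K + K\<^sup>2 + K * M) \<and>
    (\<forall>t\<in>hmm_model L K G. \<exists>t'\<in>N. \<forall>z. \<bar>t z - t' z\<bar>
      \<le> real K ^ L * (2 * real L / real m) * (\<Prod>i\<in>{1..L}. 2 * (\<Sum>j<d. \<bar>w j (z i)\<bar>)))"
proof -
  define good where "good t p \<longleftrightarrow> (case p of (\<pi>, Q, c) \<Rightarrow>
    transition_matrix K Q \<and> stationary_distribution K Q \<pi> \<and> (\<forall>k\<in>{1..K}. \<forall>i<d. \<bar>c k i\<bar> \<le> 2) \<and>
    t = hmm_density L K \<pi> Q (\<lambda>k y. \<Sum>i<d. c k i * w i y))"
    for t and p :: "(nat \<Rightarrow> real) \<times> (nat \<Rightarrow> nat \<Rightarrow> real) \<times> (nat \<Rightarrow> nat \<Rightarrow> real)"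
  have "\<exists>p. good t p" if "t \<in> hmm_model L K G" for t
  proof -
    obtain \<pi> Q f where t: "t = hmm_density L K \<pi> Q f" and Q: "irreducible_transition_matrix K Q"
      "stationary_distribution K Q \<pi>" and f: "\<forall>k\<in>{1..K}. f k \<in> G"
      using \<open>t \<in> hmm_model L K G\<close> unfolding hmm_model_def by blast
    have "\<forall>k\<in>{1..K}. \<exists>c. (\<forall>i<d. \<bar>c i\<bar> \<le> 2) \<and> f k = (\<lambda>y. \<Sum>i<d. c i * w i y)"
      using coord f by blast
    then obtain c where c: "\<forall>k\<in>{1..K}. (\<forall>i<d. \<bar>c k i\<bar> \<le> 2) \<and> f k = (\<lambda>y. \<Sum>i<d. c k i * w i y)"
      using bchoice by metis
    have "t = hmm_density L K \<pi> Q (\<lambda>k y. \<Sum>i<d. c k i * w i y)"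
      unfolding t hmm_density_def
    proof (intro ext sum.cong refl arg_cong2[where f = "(*)"] prod.cong)
      fix z k i assume k: "k \<in> PiE {1..L} (\<lambda>_. {1..K})" and i: "i \<in> {1..L}"
      have "k i \<in> {1..K}" using k i by (rule PiE_mem)
      then show "f (k i) (z i) = (\<Sum>j<d. c (k i) j * w j (z i))" using c by metis
    qed
    then have "good t (\<pi>, Q, c)"
      using Q c by (simp add: good_def irreducible_transition_matrix_def)
    then show ?thesis ..
  qed
  then obtain p where p: "\<And>t. t \<in> hmm_model L K G \<Longrightarrow> good t (p t)" by metis
  let ?I1 = "{1..K}" and ?I2 = "{1..K} \<times> {1..K}" and ?I3 = "{1..K} \<times> {..<d}"
  let ?J = "{-2 * int m..2 * int m}"
  \<comment> \<open>the cell of \<open>t\<close> in the partition of the parameter space, for one choice of parameters of \<open>t\<close>\<close>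
  define sig where "sig t = (case p t of (\<pi>, Q, c) \<Rightarrow>
    (\<lambda>k\<in>?I1. \<lfloor>real m * \<pi> k\<rfloor>, \<lambda>(k, l)\<in>?I2. \<lfloor>real m * Q k l\<rfloor>, \<lambda>(k, i)\<in>?I3. \<lfloor>real m * c k i\<rfloor>))" for t
  define T where "T = PiE ?I1 (\<lambda>_. ?J) \<times> PiE ?I2 (\<lambda>_. ?J) \<times> PiE ?I3 (\<lambda>_. ?J)"
  have T: "finite T" unfolding T_def by (intro finite_cartesian_product finite_PiE) auto
  have "card T = card ?J ^ (K + K\<^sup>2 + K * d)"
    unfolding T_def by (simp add: card_cartesian_product card_PiE power_add power2_eq_square mult.assoc)
  also have "\<dots> \<le> (5 * m) ^ (K + K\<^sup>2 + K * d)"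
    using m by (intro power_mono) auto
  also have "\<dots> \<le> (5 * m) ^ (K + K\<^sup>2 + K * M)"
    using m d by (intro power_increasing) auto
  finally have card_T: "card T \<le> (5 * m) ^ (K + K\<^sup>2 + K * M)" .
  have "sig ` hmm_model L K G \<subseteq> T"
  proof (rule image_subsetI)
    fix t assume t: "t \<in> hmm_model L K G"
    obtain \<pi> Q c where pt: "p t = (\<pi>, Q, c)" by (cases "p t")
    have g: "transition_matrix K Q" "stationary_distribution K Q \<pi>" "\<forall>k\<in>{1..K}. \<forall>i<d. \<bar>c k i\<bar> \<le> 2"
      using p[OF t] by (auto simp: pt good_def)
    have 1: "\<lfloor>real m * \<pi> k\<rfloor> \<in> ?J" if "k \<in> ?I1" for k
      using stationary_distribution_le_1[OF g(2) that] by (intro floor_in_range) simp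
    have 2: "\<lfloor>real m * Q k l\<rfloor> \<in> ?J" if "k \<in> ?I1" "l \<in> ?I1" for k l
      using transition_matrix_le_1[OF g(1) that] by (intro floor_in_range) simp
    have 3: "\<lfloor>real m * c k i\<rfloor> \<in> ?J" if "k \<in> ?I1" "i < d" for k i
      using g(3) that by (intro floor_in_range) simp
    show "sig t \<in> T"
      unfolding sig_def T_def pt prod.case
      by (intro SigmaI restrict_PiE_iff[THEN iffD2] ballI) (use 1 2 3 in \<open>auto simp del: atLeastAtMost_iff\<close>)
  qed
  from finite_representatives[OF T this] obtain N where N: "N \<subseteq> hmm_model L K G" "finite N" "card N \<le> card T"
    "\<forall>t\<in>hmm_model L K G. \<exists>t'\<in>N. sig t' = sig t" by blast
  have close: "\<bar>t z - t' z\<bar> \<le> real K ^ L * (2 * real L / real m) * (\<Prod>i\<in>{1..L}. 2 * (\<Sum>j<d. \<bar>w j (z i)\<bar>))"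
    if t: "t \<in> hmm_model L K G" and t': "t' \<in> hmm_model L K G" and eq: "sig t' = sig t" for t t' z
  proof -
    obtain \<pi> Q c where pt: "p t = (\<pi>, Q, c)" by (cases "p t")
    obtain \<pi>' Q' c' where pt': "p t' = (\<pi>', Q', c')" by (cases "p t'")
    have g: "transition_matrix K Q" "stationary_distribution K Q \<pi>" "\<And>k i. k \<in> {1..K} \<Longrightarrow> i < d \<Longrightarrow> \<bar>c k i\<bar> \<le> 2"
      and t_eq: "t = hmm_density L K \<pi> Q (\<lambda>k y. \<Sum>i<d. c k i * w i y)"
      using p[OF t] by (auto simp: pt good_def)
    have g': "transition_matrix K Q'" "stationary_distribution K Q' \<pi>'" "\<And>k i. k \<in> {1..K} \<Longrightarrow> i < d \<Longrightarrow> \<bar>c' k i\<bar> \<le> 2"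
      and t'_eq: "t' = hmm_density L K \<pi>' Q' (\<lambda>k y. \<Sum>i<d. c' k i * w i y)"
      using p[OF t'] by (auto simp: pt' good_def)
    have eqs: "(\<lambda>k\<in>?I1. \<lfloor>real m * \<pi>' k\<rfloor>) = (\<lambda>k\<in>?I1. \<lfloor>real m * \<pi> k\<rfloor>)"
      "(\<lambda>(k, l)\<in>?I2. \<lfloor>real m * Q' k l\<rfloor>) = (\<lambda>(k, l)\<in>?I2. \<lfloor>real m * Q k l\<rfloor>)"
      "(\<lambda>(k, i)\<in>?I3. \<lfloor>real m * c' k i\<rfloor>) = (\<lambda>(k, i)\<in>?I3. \<lfloor>real m * c k i\<rfloor>)"
      using eq unfolding sig_def pt pt' by simp_all
    have 1: "\<bar>\<pi> k - \<pi>' k\<bar> \<le> 1 / real m" if "k \<in> ?I1" for k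
      using fun_cong[OF eqs(1), of k] that m by (intro close_if_floor_eq) simp_all
    have 2: "\<bar>Q k l - Q' k l\<bar> \<le> 1 / real m" if "k \<in> ?I1" "l \<in> ?I1" for k l
      using fun_cong[OF eqs(2), of "(k, l)"] that m by (intro close_if_floor_eq) simp_all
    have 3: "\<bar>c k i - c' k i\<bar> \<le> 1 / real m" if "k \<in> ?I1" "i < d" for k i
      using fun_cong[OF eqs(3), of "(k, i)"] that m by (intro close_if_floor_eq) simp_all
    have lin: "\<bar>\<Sum>i<d. a i * w i y\<bar> \<le> r * (\<Sum>j<d. \<bar>w j y\<bar>)" if "\<And>i. i < d \<Longrightarrow> \<bar>a i\<bar> \<le> r" for a r y
    proof -
      have "\<bar>\<Sum>i<d. a i * w i y\<bar> \<le> (\<Sum>i<d. \<bar>a i * w i y\<bar>)" by (rule sum_abs)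
      also have "\<dots> \<le> (\<Sum>i<d. r * \<bar>w i y\<bar>)"
        using that by (intro sum_mono) (simp add: abs_mult mult_right_mono)
      finally show ?thesis by (simp add: sum_distrib_left)
    qed
    have "\<bar>t z - t' z\<bar> \<le> real K ^ L * (2 * real L * (1 / real m)) * (\<Prod>i\<in>{1..L}. 2 * (\<Sum>j<d. \<bar>w j (z i)\<bar>))"
      unfolding t_eq t'_eq
    proof (rule hmm_density_close[OF L])
      fix k y assume k: "k \<in> {1..K}"
      have "\<bar>\<Sum>i<d. c k i * w i y\<bar> \<le> 2 * (\<Sum>j<d. \<bar>w j y\<bar>)"
        "\<bar>\<Sum>i<d. c' k i * w i y\<bar> \<le> 2 * (\<Sum>j<d. \<bar>w j y\<bar>)"
        using g(3)[OF k] g'(3)[OF k] by (auto intro!: lin)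
      moreover have "\<bar>(\<Sum>i<d. c k i * w i y) - (\<Sum>i<d. c' k i * w i y)\<bar>
          \<le> 1 / real m * (2 * (\<Sum>j<d. \<bar>w j y\<bar>))"
      proof -
        have "\<bar>\<Sum>i<d. (c k i - c' k i) * w i y\<bar> \<le> 1 / real m * (\<Sum>j<d. \<bar>w j y\<bar>)"
          using 3[OF k] by (intro lin)
        also have "\<dots> \<le> 1 / real m * (2 * (\<Sum>j<d. \<bar>w j y\<bar>))"
          by (intro mult_left_mono) (auto simp: sum_nonneg)
        finally show ?thesis by (simp add: left_diff_distrib sum_subtractf)
      qed
      ultimately show "\<bar>\<Sum>i<d. c k i * w i y\<bar> \<le> 2 * (\<Sum>j<d. \<bar>w j y\<bar>) \<and>
        \<bar>\<Sum>i<d. c' k i * w i y\<bar> \<le> 2 * (\<Sum>j<d. \<bar>w j y\<bar>) \<and>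
        \<bar>(\<Sum>i<d. c k i * w i y) - (\<Sum>i<d. c' k i * w i y)\<bar> \<le> 1 / real m * (2 * (\<Sum>j<d. \<bar>w j y\<bar>))"
        by blast
    next
      fix k assume k: "k \<in> {1..K}"
      show "\<bar>\<pi> k\<bar> \<le> 1 \<and> \<bar>\<pi>' k\<bar> \<le> 1 \<and> \<bar>\<pi> k - \<pi>' k\<bar> \<le> 1 / real m"
        using 1[OF k] stationary_distribution_le_1[OF g(2) k] stationary_distribution_le_1[OF g'(2) k] by blast
      fix l assume l: "l \<in> {1..K}"
      show "\<bar>Q k l\<bar> \<le> 1 \<and> \<bar>Q' k l\<bar> \<le> 1 \<and> \<bar>Q k l - Q' k l\<bar> \<le> 1 / real m"
        using 2[OF k l] transition_matrix_le_1[OF g(1) k l] transition_matrix_le_1[OF g'(1) k l] by blast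
    qed
    then show ?thesis by simp
  qed
  show ?thesis
  proof (rule exI[of _ N], intro conjI ballI)
    fix t assume t: "t \<in> hmm_model L K G"
    then obtain t' where "t' \<in> N" "sig t' = sig t" using N(4) by blast
    then show "\<exists>t'\<in>N. \<forall>z. \<bar>t z - t' z\<bar>
      \<le> real K ^ L * (2 * real L / real m) * (\<Prod>i\<in>{1..L}. 2 * (\<Sum>j<d. \<bar>w j (z i)\<bar>))"
      using close[OF t _ \<open>sig t' = sig t\<close>] N(1) by blast
  qed (use N card_T in auto)
qed

section \<open>Stability under small perturbations of the test function\<close>

lemma L2_space_tensor:
  assumes \<mu>: "sigma_finite_measure \<mu>" and I: "finite I" and g: "\<And>i. i \<in> I \<Longrightarrow> g i \<in> L2_space \<mu>"
  shows "(\<lambda>z. \<Prod>i\<in>I. g i (z i)) \<in> L2_space (PiM I (\<lambda>_. \<mu>))"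
    "(\<integral>z. (\<Prod>i\<in>I. g i (z i))\<^sup>2 \<partial>PiM I (\<lambda>_. \<mu>)) = (\<Prod>i\<in>I. \<integral>y. (g i y)\<^sup>2 \<partial>\<mu>)"
proof -
  interpret product_sigma_finite "\<lambda>_. \<mu>" using \<mu> by (rule product_sigma_finite.intro)
  have gm: "g i \<in> borel_measurable \<mu>" and gi: "integrable \<mu> (\<lambda>y. (g i y)\<^sup>2)" if "i \<in> I" for i
    using g[OF that] by (auto simp: L2_space_def)
  have m: "(\<lambda>z. \<Prod>i\<in>I. g i (z i)) \<in> borel_measurable (PiM I (\<lambda>_. \<mu>))"
  proof (rule borel_measurable_prod)
    fix i assume i: "i \<in> I"
    show "(\<lambda>z. g i (z i)) \<in> borel_measurable (PiM I (\<lambda>_. \<mu>))"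
      by (rule measurable_compose[OF measurable_component_singleton[OF i] gm[OF i]])
  qed
  have "integrable (PiM I (\<lambda>_. \<mu>)) (\<lambda>z. \<Prod>i\<in>I. (g i (z i))\<^sup>2)"
    by (rule product_integrable_prod[OF I gi])
  then show "(\<lambda>z. \<Prod>i\<in>I. g i (z i)) \<in> L2_space (PiM I (\<lambda>_. \<mu>))"
    using m by (simp add: L2_space_def prod_power_distrib)
  show "(\<integral>z. (\<Prod>i\<in>I. g i (z i))\<^sup>2 \<partial>PiM I (\<lambda>_. \<mu>)) = (\<Prod>i\<in>I. \<integral>y. (g i y)\<^sup>2 \<partial>\<mu>)"
    unfolding prod_power_distrib by (rule product_integral_prod[OF I gi])
qed

lemma L2_space_diff:
  assumes "f \<in> L2_space \<mu>" "g \<in> L2_space \<mu>"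
  shows "(\<lambda>y. f y - g y) \<in> L2_space \<mu>"
proof -
  have "(\<lambda>y. \<Sum>i\<in>{True, False}. (if i then 1 else -1) * (if i then f else g) y) \<in> L2_space \<mu>"
    using assms by (intro L2_space_lincomb) auto
  then show ?thesis by simp
qed

lemma hmm_density_L2:
  assumes "sigma_finite_measure \<mu>" and f: "\<And>k. k \<in> {1..K} \<Longrightarrow> f k \<in> L2_space \<mu>"
  shows "hmm_density L K \<pi> Q f \<in> L2_space (power_measure \<mu> L)"
  unfolding hmm_density_def[abs_def]
proof (rule L2_space_lincomb)
  fix k assume k: "k \<in> PiE {1..L} (\<lambda>_. {1..K})"
  show "(\<lambda>z. \<Prod>i\<in>{1..L}. f (k i) (z i)) \<in> L2_space (power_measure \<mu> L)"
    using k by (intro L2_space_tensor assms(1) f) auto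
qed (intro finite_PiE, auto)

lemma hmm_density_bound:
  assumes \<mu>: "sigma_finite_measure \<mu>" and L: "1 \<le> L"
    and Q: "transition_matrix K Q" "stationary_distribution K Q \<pi>"
    and f: "\<And>k. k \<in> {1..K} \<Longrightarrow> AE y in \<mu>. \<bar>f k y\<bar> \<le> \<beta>"
  shows "AE z in power_measure \<mu> L. \<bar>hmm_density L K \<pi> Q f z\<bar> \<le> \<beta> ^ L"
proof -
  have "AE y in \<mu>. \<forall>k\<in>{1..K}. \<bar>f k y\<bar> \<le> \<beta>" using f by (subst AE_finite_all) auto
  from AE_PiM_sigma_finite[OF \<mu> _ this, of "{1..L}"]
  have "AE z in power_measure \<mu> L. \<forall>i\<in>{1..L}. \<forall>k\<in>{1..K}. \<bar>f k (z i)\<bar> \<le> \<beta>" by simp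
  then show ?thesis
  proof eventually_elim
    case (elim z)
    have "\<bar>hmm_density L K \<pi> Q f z\<bar>
        \<le> (\<Sum>k\<in>PiE {1..L} (\<lambda>_. {1..K}). \<bar>path_weight \<pi> Q L k * (\<Prod>i\<in>{1..L}. f (k i) (z i))\<bar>)"
      unfolding hmm_density_def path_weight_def by (rule sum_abs)
    also have "\<dots> \<le> (\<Sum>k\<in>PiE {1..L} (\<lambda>_. {1..K}). path_weight \<pi> Q L k * \<beta> ^ L)"
    proof (rule sum_mono)
      fix k assume k: "k \<in> PiE {1..L} (\<lambda>_. {1..K})"
      have "\<bar>\<Prod>i\<in>{1..L}. f (k i) (z i)\<bar> \<le> (\<Prod>i\<in>{1..L}. \<beta>)"
        unfolding abs_prod
      proof (intro prod_mono conjI abs_ge_zero)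
        fix i assume i: "i \<in> {1..L}"
        have "k i \<in> {1..K}" using k i by (rule PiE_mem)
        then show "\<bar>f (k i) (z i)\<bar> \<le> \<beta>" using elim i by blast
      qed
      then show "\<bar>path_weight \<pi> Q L k * (\<Prod>i\<in>{1..L}. f (k i) (z i))\<bar> \<le> path_weight \<pi> Q L k * \<beta> ^ L"
        using path_weight_nonneg[OF Q L k] by (simp add: abs_mult mult_left_mono)
    qed
    also have "\<dots> = chain_mean K \<pi> Q L (\<lambda>_. 1) * \<beta> ^ L"
      by (simp add: chain_mean_def sum_distrib_right)
    finally show ?case using chain_mean_one[OF Q L] by simp
  qed
qed

text \<open>Young's inequality \<open>(a + b)\<^sup>2 \<le> (1 + \<kappa>) a\<^sup>2 + (1 + 1 / \<kappa>) b\<^sup>2\<close> with \<open>a = t - s\<close> and \<open>\<bar>b\<bar> \<le> \<kappa> F\<close>.\<close>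

lemma square_norm_close:
  assumes "t \<in> L2_space P" "t' \<in> L2_space P" "s \<in> L2_space P" "F \<in> L2_space P"
    and close: "\<And>z. \<bar>t z - t' z\<bar> \<le> \<kappa> * F z" and \<kappa>: "0 < \<kappa>"
  shows "(L2_norm P (\<lambda>z. t' z - s z))\<^sup>2
    \<le> (1 + \<kappa>) * (L2_norm P (\<lambda>z. t z - s z))\<^sup>2 + (\<kappa> + \<kappa>\<^sup>2) * (\<integral>z. (F z)\<^sup>2 \<partial>P)"
proof -
  have sq: "(L2_norm P u)\<^sup>2 = (\<integral>z. (u z)\<^sup>2 \<partial>P)" for u by (simp add: L2_norm_def)
  have int: "integrable P (\<lambda>z. (u z)\<^sup>2)" if "u \<in> L2_space P" for u using that by (simp add: L2_space_def)
  have i1: "integrable P (\<lambda>z. (t z - s z)\<^sup>2)" and i2: "integrable P (\<lambda>z. (t' z - s z)\<^sup>2)"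
    and i3: "integrable P (\<lambda>z. (F z)\<^sup>2)"
    using assms by (auto intro!: int L2_space_diff)
  have "(\<integral>z. (t' z - s z)\<^sup>2 \<partial>P) \<le> (\<integral>z. (1 + \<kappa>) * (t z - s z)\<^sup>2 + (\<kappa> + \<kappa>\<^sup>2) * (F z)\<^sup>2 \<partial>P)"
  proof (rule integral_mono[OF i2])
    show "integrable P (\<lambda>z. (1 + \<kappa>) * (t z - s z)\<^sup>2 + (\<kappa> + \<kappa>\<^sup>2) * (F z)\<^sup>2)" using i1 i3 by simp
    fix z
    let ?a = "t z - s z" and ?b = "t' z - t z"
    have young: "(a + b)\<^sup>2 \<le> (1 + \<kappa>) * a\<^sup>2 + (1 + 1 / \<kappa>) * b\<^sup>2" for a b :: real
    proof -
      have "0 \<le> (\<kappa> * a - b)\<^sup>2 / \<kappa>" using \<kappa> by simp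
      also have "\<dots> = \<kappa> * a\<^sup>2 - 2 * a * b + b\<^sup>2 / \<kappa>"
        using \<kappa> by (simp add: power2_diff field_simps power2_eq_square)
      finally show ?thesis by (simp add: power2_sum algebra_simps)
    qed
    have "(?a + ?b)\<^sup>2 \<le> (1 + \<kappa>) * ?a\<^sup>2 + (1 + 1 / \<kappa>) * ?b\<^sup>2" by (rule young)
    moreover have "?b\<^sup>2 \<le> (\<kappa> * F z)\<^sup>2"
      using close[of z] by (subst abs_le_square_iff[symmetric]) linarith
    then have "(1 + 1 / \<kappa>) * ?b\<^sup>2 \<le> (1 + 1 / \<kappa>) * (\<kappa> * F z)\<^sup>2" using \<kappa> by (intro mult_left_mono) auto
    moreover have "(1 + 1 / \<kappa>) * (\<kappa> * F z)\<^sup>2 = (\<kappa> + \<kappa>\<^sup>2) * (F z)\<^sup>2"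
      using \<kappa> by (simp add: power2_eq_square field_simps)
    moreover have "?a + ?b = t' z - s z" by simp
    ultimately show "(t' z - s z)\<^sup>2 \<le> (1 + \<kappa>) * (t z - s z)\<^sup>2 + (\<kappa> + \<kappa>\<^sup>2) * (F z)\<^sup>2" by simp
  qed
  also have "\<dots> = (1 + \<kappa>) * (\<integral>z. (t z - s z)\<^sup>2 \<partial>P) + (\<kappa> + \<kappa>\<^sup>2) * (\<integral>z. (F z)\<^sup>2 \<partial>P)"
    using i1 i3 by simp
  finally show ?thesis by (simp add: sq)
qed

lemma empirical_process_close:
  fixes \<mu> :: "'a measure" and L :: nat
  defines "P \<equiv> power_measure \<mu> L"
  assumes L2: "t \<in> L2_space P" "t' \<in> L2_space P" "s \<in> L2_space P" "F \<in> L2_space P" "g \<in> L2_space P"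
    and close: "\<And>z. \<bar>t z - t' z\<bar> \<le> \<kappa> * F z" and n: "1 \<le> n"
  shows "\<bar>empirical_process \<mu> L g n y (\<lambda>z. t z - s z) - empirical_process \<mu> L g n y (\<lambda>z. t' z - s z)\<bar>
    \<le> \<kappa> * ((\<Sum>j\<in>{1..n}. F (window L j y)) / real n + (\<integral>z. F z * \<bar>g z\<bar> \<partial>P))"
proof -
  have ts: "integrable P (\<lambda>z. (t z - s z) * g z)" and ts': "integrable P (\<lambda>z. (t' z - s z) * g z)"
    and tt': "integrable P (\<lambda>z. (t z - t' z) * g z)"
    using L2 by (auto intro!: L2_space_mult L2_space_diff)
  have "g \<in> L2_space P \<Longrightarrow> (\<lambda>z. \<bar>g z\<bar>) \<in> L2_space P" by (auto simp: L2_space_def)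
  then have Fg: "integrable P (\<lambda>z. F z * \<bar>g z\<bar>)" using L2 by (intro L2_space_mult) auto
  let ?S = "\<Sum>j\<in>{1..n}. t (window L j y) - t' (window L j y)"
  have "empirical_process \<mu> L g n y (\<lambda>z. t z - s z) - empirical_process \<mu> L g n y (\<lambda>z. t' z - s z)
      = ?S / real n - (\<integral>z. (t z - t' z) * g z \<partial>P)"
  proof -
    have "(\<integral>z. (t z - s z) * g z \<partial>P) - (\<integral>z. (t' z - s z) * g z \<partial>P) = (\<integral>z. (t z - t' z) * g z \<partial>P)"
      unfolding Bochner_Integration.integral_diff[OF ts ts', symmetric]
      by (intro Bochner_Integration.integral_cong refl) (simp add: algebra_simps)
    moreover have "(\<Sum>j\<in>{1..n}. t (window L j y) - s (window L j y))
        - (\<Sum>j\<in>{1..n}. t' (window L j y) - s (window L j y)) = ?S"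
      by (simp add: sum_subtractf)
    then have "(\<Sum>j\<in>{1..n}. t (window L j y) - s (window L j y)) / real n
        - (\<Sum>j\<in>{1..n}. t' (window L j y) - s (window L j y)) / real n = ?S / real n"
      unfolding diff_divide_distrib[symmetric] by (rule arg_cong)
    moreover have "empirical_process \<mu> L g n y (\<lambda>z. r z - s z) =
        (\<Sum>j\<in>{1..n}. r (window L j y) - s (window L j y)) / real n - (\<integral>z. (r z - s z) * g z \<partial>P)" for r
      by (simp only: empirical_process_def P_def window_def)
    ultimately show ?thesis by simp
  qed
  moreover have "\<bar>?S / real n\<bar> \<le> \<kappa> * ((\<Sum>j\<in>{1..n}. F (window L j y)) / real n)"
  proof -
    have "\<bar>?S\<bar> \<le> (\<Sum>j\<in>{1..n}. \<bar>t (window L j y) - t' (window L j y)\<bar>)" by (rule sum_abs)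
    also have "\<dots> \<le> (\<Sum>j\<in>{1..n}. \<kappa> * F (window L j y))" by (intro sum_mono close)
    finally show ?thesis by (simp add: sum_distrib_left divide_right_mono)
  qed
  moreover have "\<bar>\<integral>z. (t z - t' z) * g z \<partial>P\<bar> \<le> \<kappa> * (\<integral>z. F z * \<bar>g z\<bar> \<partial>P)"
  proof -
    have "\<bar>\<integral>z. (t z - t' z) * g z \<partial>P\<bar> \<le> (\<integral>z. \<bar>(t z - t' z) * g z\<bar> \<partial>P)" by (rule integral_abs_bound)
    also have "\<dots> \<le> (\<integral>z. \<kappa> * (F z * \<bar>g z\<bar>) \<partial>P)"
    proof (rule integral_mono)
      show "integrable P (\<lambda>z. \<bar>(t z - t' z) * g z\<bar>)" using tt' by simp
      show "integrable P (\<lambda>z. \<kappa> * (F z * \<bar>g z\<bar>))" using Fg by simp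
      show "\<bar>(t z - t' z) * g z\<bar> \<le> \<kappa> * (F z * \<bar>g z\<bar>)" for z
        using mult_right_mono[OF close[of z] abs_ge_zero[of "g z"]] by (simp add: abs_mult mult.assoc)
    qed
    finally show ?thesis by simp
  qed
  ultimately show ?thesis unfolding distrib_left by linarith
qed

text \<open>The observations have densities with respect to \<open>\<mu>\<close>, so they avoid a given null set.\<close>

lemma hmm_AE:
  assumes hmm: "hidden_markov_model \<Omega> \<mu> K \<pi> Q f X Y" and ae: "AE y in \<mu>. P y" and N: "1 \<le> N"
  shows "AE \<omega> in \<Omega>. \<forall>j\<in>{1..N}. P (Y j \<omega>)"
proof -
  have Y: "Y j \<in> measurable \<Omega> \<mu>" if "1 \<le> j" for j
    using hmm that by (simp add: hidden_markov_model_def)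
  obtain A where A: "{y\<in>space \<mu>. \<not> P y} \<subseteq> A" "emeasure \<mu> A = 0" "A \<in> sets \<mu>"
    using ae by (auto elim: AE_E)
  define B where "B = (\<Union>j\<in>{1..N}. {y\<in>space (PiM {1..N} (\<lambda>_. \<mu>)). y j \<in> A})"
  have B: "B \<in> sets (PiM {1..N} (\<lambda>_. \<mu>))"
    unfolding B_def
  proof (intro sets.finite_UN)
    fix j assume j: "j \<in> {1..N}"
    have "(\<lambda>y. y j) -` A \<inter> space (PiM {1..N} (\<lambda>_. \<mu>)) \<in> sets (PiM {1..N} (\<lambda>_. \<mu>))"
      by (rule measurable_sets[OF measurable_component_singleton[OF j] A(3)])
    then show "{y\<in>space (PiM {1..N} (\<lambda>_. \<mu>)). y j \<in> A} \<in> sets (PiM {1..N} (\<lambda>_. \<mu>))"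
      by (simp add: vimage_def Int_def conj_commute)
  qed simp
  have Yv: "(\<lambda>\<omega>. \<lambda>j\<in>{1..N}. Y j \<omega>) \<in> measurable \<Omega> (PiM {1..N} (\<lambda>_. \<mu>))"
    by (intro measurable_restrict Y) simp
  have "(\<integral>\<^sup>+\<omega>. indicator B (\<lambda>j\<in>{1..N}. Y j \<omega>) \<partial>\<Omega>) = (\<Sum>k\<in>PiE {1..N} (\<lambda>_. {1..K}).
      ennreal (path_weight \<pi> Q N k) * (\<integral>\<^sup>+y. indicator B y \<partial>PiM {1..N} (\<lambda>j. emission \<mu> f (k j))))"
    using B by (intro hmm_law[OF hmm N]) simp
  also have "\<dots> = 0"
  proof (intro sum.neutral ballI)
    fix k assume k: "k \<in> PiE {1..N} (\<lambda>_. {1..K})"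
    let ?E = "PiM {1..N} (\<lambda>j. emission \<mu> f (k j))"
    have pd: "probability_density \<mu> (f (k j))" if "j \<in> {1..N}" for j
    proof -
      have "k j \<in> {1..K}" using k that by (rule PiE_mem)
      then show ?thesis using hmm by (simp add: hidden_markov_model_def)
    qed
    have notA: "AE y in \<mu>. y \<notin> A" using A by (intro AE_not_in) (auto simp: null_sets_def)
    have "AE y in ?E. y j \<notin> A" if j: "j \<in> {1..N}" for j
    proof (rule AE_PiM_component[OF _ j])
      show "prob_space (emission \<mu> f (k i))" if "i \<in> {1..N}" for i
        using pd[OF that] by (simp add: probability_density_def emission_def)
      show "AE y in emission \<mu> f (k j). y \<notin> A"
        unfolding emission_def using pd[OF j] notA
        by (subst AE_density) (auto simp: probability_density_def)
    qed
    then have "AE y in ?E. \<forall>j\<in>{1..N}. y j \<notin> A" by (subst AE_finite_all) auto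
    then have "AE y in ?E. indicator B y = (0::ennreal)"
      by eventually_elim (auto simp: B_def)
    then have "(\<integral>\<^sup>+y. indicator B y \<partial>?E) = (\<integral>\<^sup>+y. 0 \<partial>?E)" by (rule nn_integral_cong_AE)
    then show "ennreal (path_weight \<pi> Q N k) * (\<integral>\<^sup>+y. indicator B y \<partial>?E) = 0" by simp
  qed
  finally have "(\<integral>\<^sup>+\<omega>. indicator B (\<lambda>j\<in>{1..N}. Y j \<omega>) \<partial>\<Omega>) = 0" .
  then have "AE \<omega> in \<Omega>. indicator B (\<lambda>j\<in>{1..N}. Y j \<omega>) = (0::ennreal)"
    using measurable_compose[OF Yv borel_measurable_indicator[OF B]] by (subst (asm) nn_integral_0_iff_AE) auto
  moreover have "AE \<omega> in \<Omega>. \<omega> \<in> space \<Omega>" by simp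
  ultimately show ?thesis
  proof eventually_elim
    case (elim \<omega>)
    show ?case
    proof
      fix j assume j: "j \<in> {1..N}"
      let ?y = "\<lambda>j\<in>{1..N}. Y j \<omega>"
      have notB: "?y \<notin> B" using elim(1) by (metis indicator_simps(1) zero_neq_one)
      have sp: "?y \<in> space (PiM {1..N} (\<lambda>_. \<mu>))"
        by (rule measurable_space[OF Yv elim(2)])
      have "Y j \<omega> \<notin> A"
      proof
        assume "Y j \<omega> \<in> A"
        then have "?y j \<in> A" using j by simp
        then have "?y \<in> B" unfolding B_def by (intro UN_I[OF j] CollectI conjI sp)
        then show False using notB by contradiction
      qed
      moreover have "Y j \<omega> \<in> space \<mu>" using Y[of j] j elim(2) by (auto dest: measurable_space)
      ultimately show "P (Y j \<omega>)" using A(1) by blast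
    qed
  qed
qed

section \<open>Deviations in one model\<close>

context hmm_test_function
begin

lemma empirical_process_measurable:
  "(\<lambda>\<omega>. empirical_process \<mu> L g n (\<lambda>j. Y j \<omega>) u) \<in> borel_measurable \<Omega>"
proof -
  have "(\<lambda>\<omega>. u (\<lambda>i\<in>{1..L}. Y (s + i - 1) \<omega>)) \<in> borel_measurable \<Omega>" if "s \<in> {1..n}" for s
  proof (rule measurable_compose[OF measurable_restrict u_meas])
    fix i assume "i \<in> {1..L}"
    then have "1 \<le> s + i - 1" using that by auto
    then show "Y (s + i - 1) \<in> measurable \<Omega> \<mu>" using hmm by (simp add: hidden_markov_model_def)
  qed
  then show ?thesis
    unfolding empirical_process_def by (intro borel_measurable_diff borel_measurable_divide borel_measurable_sum) auto
qed

lemma hmm_tail: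
  assumes C: "chain_window_constant K Q L C" and n: "1 \<le> n" and D: "D = 4 * (real L + C)"
    and \<epsilon>: "0 < \<epsilon>" "V \<le> \<Gamma> * \<epsilon>" and th: "0 < \<theta>" "D * \<theta> * B \<le> 1" "2 * D\<^sup>2 * \<Gamma> * \<theta> \<le> 1"
  shows "measure \<Omega> {\<omega>\<in>space \<Omega>. \<epsilon> \<le> \<bar>empirical_process \<mu> L (hmm_density L K \<pi> Q f) n (\<lambda>j. Y j \<omega>) u\<bar>}
    \<le> 2 * exp (1 - \<theta> * real n * \<epsilon> / 2)"
proof -
  interpret \<Omega>: prob_space \<Omega> using hmm by (simp add: hidden_markov_model_def)
  interpret neg: hmm_test_function \<Omega> \<mu> L K \<pi> Q f X Y "\<lambda>z. - u z" B \<beta> V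
    by (rule hmm_test_function.intro[OF \<mu> hmm tm st L f_le _ _ _ _ B])
      (use u_meas u_bound u_L2 V in simp_all)
  let ?\<nu> = "\<lambda>\<omega>. empirical_process \<mu> L (hmm_density L K \<pi> Q f) n (\<lambda>j. Y j \<omega>)"
  have minus: "?\<nu> \<omega> (\<lambda>z. - u z) = - ?\<nu> \<omega> u" for \<omega>
    by (simp add: empirical_process_def sum_negf)
  have [measurable]: "(\<lambda>\<omega>. ?\<nu> \<omega> u) \<in> borel_measurable \<Omega>" by (rule empirical_process_measurable)
  have "measure \<Omega> {\<omega>\<in>space \<Omega>. \<epsilon> \<le> \<bar>?\<nu> \<omega> u\<bar>}
      \<le> measure \<Omega> ({\<omega>\<in>space \<Omega>. \<epsilon> \<le> ?\<nu> \<omega> u} \<union> {\<omega>\<in>space \<Omega>. \<epsilon> \<le> - ?\<nu> \<omega> u})"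
    by (intro \<Omega>.finite_measure_mono) auto
  also have "\<dots> \<le> measure \<Omega> {\<omega>\<in>space \<Omega>. \<epsilon> \<le> ?\<nu> \<omega> u} + measure \<Omega> {\<omega>\<in>space \<Omega>. \<epsilon> \<le> - ?\<nu> \<omega> u}"
    by (intro measure_Un_le) auto
  also have "\<dots> \<le> exp (1 - \<theta> * real n * \<epsilon> / 2) + exp (1 - \<theta> * real n * \<epsilon> / 2)"
    using hmm_upper_tail[OF C n D \<epsilon> th] neg.hmm_upper_tail[OF C n D \<epsilon> th] unfolding minus
    by (rule add_mono)
  finally show ?thesis by simp
qed

text \<open>The density of a window is a mixture, over the paths of the chain, of tensor products of probability
  densities.\<close>

lemma hmm_density_true:
  "AE z in power_measure \<mu> L. 0 \<le> hmm_density L K \<pi> Q f z"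
  "integrable (power_measure \<mu> L) (hmm_density L K \<pi> Q f)"
  "(\<integral>z. hmm_density L K \<pi> Q f z \<partial>power_measure \<mu> L) = 1"
proof -
  let ?P = "PiE {1..L} (\<lambda>_. {1..K})"
  have fin: "finite ?P" by (intro finite_PiE) auto
  have g_eq: "hmm_density L K \<pi> Q f = (\<lambda>z. \<Sum>k\<in>?P. path_weight \<pi> Q L k * window_density k z)"
    by (simp add: hmm_density_def path_weight_def fun_eq_iff)
  have kK: "k i \<in> {1..K}" if "k \<in> ?P" "i \<in> {1..L}" for k i using that by (rule PiE_mem)
  have 1: "integrable (power_measure \<mu> L) (window_density k)"
    "(\<integral>z. window_density k z \<partial>power_measure \<mu> L) = 1"
    "AE z in power_measure \<mu> L. 0 \<le> window_density k z" if k: "k \<in> ?P" for k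
  proof -
    have kk: "\<And>i. i \<in> {1..L} \<Longrightarrow> k i \<in> {1..K}" by (rule kK[OF k])
    have bounds: "AE z in power_measure \<mu> L. 0 \<le> window_density k z \<and> window_density k z \<le> \<beta> ^ L"
      by (rule window_density_bounds) (rule kk)
    have law: "window_law k = density (power_measure \<mu> L) (\<lambda>z. ennreal (window_density k z))"
      by (rule window_law_density) (rule kk)
    interpret W: prob_space "window_law k" by (rule prob_space_window_law) (rule kk)
    have m: "window_density k \<in> borel_measurable (power_measure \<mu> L)"
      by (rule window_density_measurable) (rule kk)
    show ae: "AE z in power_measure \<mu> L. 0 \<le> window_density k z"
      using bounds by eventually_elim simp
    have "emeasure (window_law k) (space (window_law k)) = (\<integral>\<^sup>+z. ennreal (window_density k z) \<partial>power_measure \<mu> L)"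
      unfolding law using m
      by (subst emeasure_density) (auto intro!: nn_integral_cong)
    then have nn: "(\<integral>\<^sup>+z. ennreal (window_density k z) \<partial>power_measure \<mu> L) = 1"
      using W.emeasure_space_1 by simp
    show int: "integrable (power_measure \<mu> L) (window_density k)"
      using ae m nn by (intro integrableI_nonneg) auto
    show "(\<integral>z. window_density k z \<partial>power_measure \<mu> L) = 1"
      using integral_eq_nn_integral[OF m ae] nn by simp
  qed
  show "integrable (power_measure \<mu> L) (hmm_density L K \<pi> Q f)"
    unfolding g_eq by (intro Bochner_Integration.integrable_sum integrable_mult_right 1)
  have "(\<integral>z. hmm_density L K \<pi> Q f z \<partial>power_measure \<mu> L)
      = (\<Sum>k\<in>?P. path_weight \<pi> Q L k * (\<integral>z. window_density k z \<partial>power_measure \<mu> L))"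
    unfolding g_eq
    by (subst Bochner_Integration.integral_sum) (intro integrable_mult_right 1, auto)
  also have "\<dots> = chain_mean K \<pi> Q L (\<lambda>_. 1)"
    unfolding chain_mean_def by (intro sum.cong refl) (simp only: 1(2))
  finally show "(\<integral>z. hmm_density L K \<pi> Q f z \<partial>power_measure \<mu> L) = 1"
    using chain_mean_one[OF tm st L] by simp
  have "AE z in power_measure \<mu> L. \<forall>k\<in>?P. 0 \<le> window_density k z"
    using 1(3) fin by (subst AE_finite_all) auto
  then show "AE z in power_measure \<mu> L. 0 \<le> hmm_density L K \<pi> Q f z"
    unfolding g_eq
  proof eventually_elim
    case (elim z)
    then show ?case by (intro sum_nonneg mult_nonneg_nonneg path_weight_nonneg[OF tm st L]) auto
  qed
qed

end

text \<open>The data of the theorem which are common to all models. The essential bounds of the elements of \<open>\<F>\<close> enter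
  as almost everywhere bounds.\<close>

locale hmm_setting =
  fixes \<Omega> :: "'w measure" and \<mu> :: "'y measure" and L K\<^sub>0 :: nat and \<pi>\<^sub>0 Q\<^sub>0 f\<^sub>0 X Y
    and \<F> :: "('y \<Rightarrow> real) set" and C2 Cinf :: real
  assumes \<mu>: "sigma_finite_measure \<mu>"
    and hmm: "hidden_markov_model \<Omega> \<mu> K\<^sub>0 \<pi>\<^sub>0 Q\<^sub>0 f\<^sub>0 X Y"
    and tm: "transition_matrix K\<^sub>0 Q\<^sub>0" and st: "stationary_distribution K\<^sub>0 Q\<^sub>0 \<pi>\<^sub>0" and L: "1 \<le> L"
    and \<F>_L2: "\<F> \<subseteq> L2_space \<mu>" and f0: "\<And>k. k \<in> {1..K\<^sub>0} \<Longrightarrow> f\<^sub>0 k \<in> \<F>"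
    and \<F>_bound: "\<And>f. f \<in> \<F> \<Longrightarrow> AE y in \<mu>. \<bar>f y\<bar> \<le> Cinf"
    and \<F>_norm: "\<And>f. f \<in> \<F> \<Longrightarrow> L2_norm \<mu> f \<le> C2"
    and C2: "1 \<le> C2" and Cinf: "1 \<le> Cinf"
begin

abbreviation true_density :: "(nat \<Rightarrow> 'y) \<Rightarrow> real" where
  "true_density \<equiv> hmm_density L K\<^sub>0 \<pi>\<^sub>0 Q\<^sub>0 f\<^sub>0"

abbreviation emp :: "nat \<Rightarrow> 'w \<Rightarrow> ((nat \<Rightarrow> 'y) \<Rightarrow> real) \<Rightarrow> real" where
  "emp n \<omega> \<equiv> empirical_process \<mu> L true_density n (\<lambda>j. Y j \<omega>)"

lemma model_L2: "G \<subseteq> \<F> \<Longrightarrow> t \<in> hmm_model L K G \<Longrightarrow> t \<in> L2_space (power_measure \<mu> L)"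
proof -
  assume G: "G \<subseteq> \<F>" and "t \<in> hmm_model L K G"
  then obtain \<pi> Q f where t: "t = hmm_density L K \<pi> Q f" and f: "\<forall>k\<in>{1..K}. f k \<in> G"
    unfolding hmm_model_def by blast
  show "t \<in> L2_space (power_measure \<mu> L)"
    unfolding t by (rule hmm_density_L2[OF \<mu>]) (use f G \<F>_L2 in blast)
qed

lemma model_bound:
  assumes "G \<subseteq> \<F>" "t \<in> hmm_model L K G"
  shows "AE z in power_measure \<mu> L. \<bar>t z\<bar> \<le> Cinf ^ L"
proof -
  obtain \<pi> Q f where t: "t = hmm_density L K \<pi> Q f" and Q: "irreducible_transition_matrix K Q"
    "stationary_distribution K Q \<pi>" and f: "\<forall>k\<in>{1..K}. f k \<in> G"
    using assms(2) unfolding hmm_model_def by blast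
  have "transition_matrix K Q" using Q by (simp add: irreducible_transition_matrix_def)
  then show ?thesis
    unfolding t
  proof (rule hmm_density_bound[OF \<mu> L _ Q(2)])
    fix k assume "k \<in> {1..K}"
    then have "f k \<in> \<F>" using f assms(1) by blast
    then show "AE y in \<mu>. \<bar>f k y\<bar> \<le> Cinf" by (rule \<F>_bound)
  qed
qed

lemma true_density_L2: "true_density \<in> L2_space (power_measure \<mu> L)"
  using f0 \<F>_L2 by (intro hmm_density_L2[OF \<mu>]) auto

lemma difference_test_function:
  assumes "G \<subseteq> \<F>" "t \<in> hmm_model L K G" "s \<in> hmm_model L K' \<F>"
  shows "hmm_test_function \<Omega> \<mu> L K\<^sub>0 \<pi>\<^sub>0 Q\<^sub>0 f\<^sub>0 X Y (\<lambda>z. t z - s z) (2 * Cinf ^ L) Cinf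
    (Cinf ^ L * (L2_norm (power_measure \<mu> L) (\<lambda>z. t z - s z))\<^sup>2)"
proof (rule hmm_test_function.intro)
  have L2: "(\<lambda>z. t z - s z) \<in> L2_space (power_measure \<mu> L)"
    using assms by (intro L2_space_diff model_L2) auto
  then show "(\<lambda>z. t z - s z) \<in> borel_measurable (power_measure \<mu> L)"
    "integrable (power_measure \<mu> L) (\<lambda>z. (t z - s z)\<^sup>2)" by (simp_all add: L2_space_def)
  show "AE z in power_measure \<mu> L. \<bar>t z - s z\<bar> \<le> 2 * Cinf ^ L"
    using model_bound[OF assms(1,2)] model_bound[OF subset_refl assms(3)] by eventually_elim linarith
  show "AE y in \<mu>. f\<^sub>0 k y \<le> Cinf" if "k \<in> {1..K\<^sub>0}" for k
    using \<F>_bound[OF f0[OF that]] by eventually_elim linarith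
  show "Cinf ^ L * (\<integral>z. (t z - s z)\<^sup>2 \<partial>power_measure \<mu> L)
      \<le> Cinf ^ L * (L2_norm (power_measure \<mu> L) (\<lambda>z. t z - s z))\<^sup>2"
    by (simp add: L2_norm_def)
  show "0 \<le> 2 * Cinf ^ L" using Cinf by simp
qed (fact \<mu> hmm tm st L)+

abbreviation dist2 :: "((nat \<Rightarrow> 'y) \<Rightarrow> real) \<Rightarrow> ((nat \<Rightarrow> 'y) \<Rightarrow> real) \<Rightarrow> real" where
  "dist2 t s \<equiv> (L2_norm (power_measure \<mu> L) (\<lambda>z. t z - s z))\<^sup>2"

text \<open>The function \<open>F\<close> is the tensor power of \<open>2 \<Sum> \<bar>w\<^sub>j\<bar>\<close> for a nearly extremal family \<open>w\<close>. It is bounded at the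
  observations almost surely, and all its norms are polynomial in \<open>M\<close>.\<close>

lemma model_envelope:
  assumes V: "L2_subspace \<mu> M V" and K: "1 \<le> K" and M: "1 \<le> M"
  obtains F where "F \<in> L2_space (power_measure \<mu> L)"
    "(\<integral>z. (F z)\<^sup>2 \<partial>power_measure \<mu> L) \<le> (2 * real M * C2) ^ (2 * L)"
    "(\<integral>z. F z * \<bar>true_density z\<bar> \<partial>power_measure \<mu> L) \<le> (2 * real M * Cinf) ^ L"
    "\<And>n. 1 \<le> n \<Longrightarrow> AE \<omega> in \<Omega>. \<forall>j\<in>{1..n}. F (window L j (\<lambda>j. Y j \<omega>)) \<le> (2 * real M * Cinf) ^ L"
    "\<And>m. 1 \<le> m \<Longrightarrow> \<exists>N\<subseteq>hmm_model L K (\<F> \<inter> V). finite N \<and> card N \<le> (5 * m) ^ (K + K\<^sup>2 + K * M) \<and>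
      (\<forall>t\<in>hmm_model L K (\<F> \<inter> V). \<exists>t'\<in>N. \<forall>z. \<bar>t z - t' z\<bar> \<le> real K ^ L * (2 * real L / real m) * F z)"
    "\<And>z. 0 \<le> F z"
proof -
  have "\<exists>d\<le>M. \<exists>w. (\<forall>i<d. w i \<in> \<F> \<inter> V) \<and>
    (\<forall>g\<in>\<F> \<inter> V. \<exists>c. (\<forall>i<d. \<bar>c i\<bar> \<le> 2) \<and> g = (\<lambda>y. \<Sum>i<d. c i * w i y))"
    by (rule near_extremal_basis[OF V, of _ C2]) (auto intro: \<F>_norm)
  then obtain d w where d: "d \<le> M" and w: "\<forall>i<d. w i \<in> \<F> \<inter> V"
    and coord: "\<forall>g\<in>\<F> \<inter> V. \<exists>c. (\<forall>i<d. \<bar>c i\<bar> \<le> 2) \<and> g = (\<lambda>y. \<Sum>i<d. c i * w i y)" by blast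
  have wF: "w i \<in> \<F>" if "i < d" for i using w that by blast
  define e where "e y = 2 * (\<Sum>j<d. \<bar>w j y\<bar>)" for y
  define F where "F z = (\<Prod>i\<in>{1..L}. e (z i))" for z :: "nat \<Rightarrow> 'y"
  have e0: "0 \<le> e y" for y by (simp add: e_def sum_nonneg)
  have w_abs: "(\<lambda>y. \<bar>w i y\<bar>) \<in> L2_space \<mu>" if "i < d" for i
    using wF[OF that] \<F>_L2 by (auto simp: L2_space_def)
  have e_L2: "e \<in> L2_space \<mu>"
  proof -
    have "(\<lambda>y. \<Sum>j\<in>{..<d}. 2 * \<bar>w j y\<bar>) \<in> L2_space \<mu>" by (rule L2_space_lincomb) (auto intro: w_abs)
    then show ?thesis by (simp add: e_def[abs_def] sum_distrib_left)
  qed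
  have e_norm: "(\<integral>y. (e y)\<^sup>2 \<partial>\<mu>) \<le> (2 * real M * C2)\<^sup>2"
  proof -
    have wi: "integrable \<mu> (\<lambda>y. (w j y)\<^sup>2)" if "j < d" for j
      using wF[OF that] \<F>_L2 by (auto simp: L2_space_def)
    have wn: "(\<integral>y. (w j y)\<^sup>2 \<partial>\<mu>) \<le> C2\<^sup>2" if "j < d" for j
    proof -
      have "0 \<le> (\<integral>y. (w j y)\<^sup>2 \<partial>\<mu>)" by simp
      moreover have "L2_norm \<mu> (w j) \<le> C2" by (rule \<F>_norm[OF wF[OF that]])
      ultimately show ?thesis using power_mono[of "L2_norm \<mu> (w j)" C2 2] by (simp add: L2_norm_def)
    qed
    have "(\<integral>y. (e y)\<^sup>2 \<partial>\<mu>) \<le> (\<integral>y. 4 * real d * (\<Sum>j<d. (w j y)\<^sup>2) \<partial>\<mu>)"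
    proof (rule integral_mono)
      show "integrable \<mu> (\<lambda>y. (e y)\<^sup>2)" using e_L2 by (simp add: L2_space_def)
      show "integrable \<mu> (\<lambda>y. 4 * real d * (\<Sum>j<d. (w j y)\<^sup>2))"
        by (intro integrable_mult_right Bochner_Integration.integrable_sum wi) simp
      fix y
      have "(\<Sum>j<d. \<bar>w j y\<bar>)\<^sup>2 \<le> (\<Sum>j<d. \<bar>w j y\<bar>\<^sup>2) * real (card {..<d})"
        by (rule sum_squared_le_sum_of_squares)
      then show "(e y)\<^sup>2 \<le> 4 * real d * (\<Sum>j<d. (w j y)\<^sup>2)"
        by (simp add: e_def power_mult_distrib mult_ac)
    qed
    also have "\<dots> = 4 * real d * (\<Sum>j<d. \<integral>y. (w j y)\<^sup>2 \<partial>\<mu>)"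
      using wi by (simp add: Bochner_Integration.integral_sum)
    also have "\<dots> \<le> 4 * real d * (\<Sum>j<d. C2\<^sup>2)"
      by (intro mult_left_mono sum_mono wn) auto
    also have "\<dots> = (2 * real d * C2)\<^sup>2" by (simp add: power_mult_distrib power2_eq_square)
    also have "\<dots> \<le> (2 * real M * C2)\<^sup>2" using d C2 by (intro power_mono mult_mono) auto
    finally show ?thesis .
  qed
  have e_bound: "AE y in \<mu>. e y \<le> 2 * real M * Cinf"
  proof -
    have "AE y in \<mu>. \<forall>j\<in>{..<d}. \<bar>w j y\<bar> \<le> Cinf"
      using \<F>_bound[OF wF] by (subst AE_finite_all) auto
    then show ?thesis
    proof eventually_elim
      case (elim y)
      then have "(\<Sum>j<d. \<bar>w j y\<bar>) \<le> (\<Sum>j<d. Cinf)" by (intro sum_mono) auto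
      also have "\<dots> \<le> real M * Cinf" using d Cinf by (simp add: mult_right_mono)
      finally show ?case by (simp add: e_def)
    qed
  qed
  have F_bound: "F z \<le> (2 * real M * Cinf) ^ L" if "\<And>i. i \<in> {1..L} \<Longrightarrow> e (z i) \<le> 2 * real M * Cinf" for z
  proof -
    have "F z \<le> (\<Prod>i\<in>{1..L}. 2 * real M * Cinf)"
      unfolding F_def using that e0 by (intro prod_mono) auto
    then show ?thesis by simp
  qed
  have F_L2: "F \<in> L2_space (power_measure \<mu> L)"
    unfolding F_def[abs_def] by (rule L2_space_tensor[OF \<mu>]) (auto intro: e_L2)
  show ?thesis
  proof (rule that[OF F_L2])
    have "(\<integral>z. (F z)\<^sup>2 \<partial>power_measure \<mu> L) = (\<Prod>i\<in>{1..L}. \<integral>y. (e y)\<^sup>2 \<partial>\<mu>)"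
      unfolding F_def by (rule L2_space_tensor[OF \<mu>]) (auto intro: e_L2)
    also have "\<dots> = (\<integral>y. (e y)\<^sup>2 \<partial>\<mu>) ^ L" by simp
    also have "\<dots> \<le> ((2 * real M * C2)\<^sup>2) ^ L" using e_norm by (intro power_mono) auto
    finally show "(\<integral>z. (F z)\<^sup>2 \<partial>power_measure \<mu> L) \<le> (2 * real M * C2) ^ (2 * L)"
      by (simp only: power_mult)
  next
    \<comment> \<open>the zero function serves only to access the facts about the true density\<close>
    interpret z: hmm_test_function \<Omega> \<mu> L K\<^sub>0 \<pi>\<^sub>0 Q\<^sub>0 f\<^sub>0 X Y "\<lambda>_. 0" 0 Cinf 0
    proof (rule hmm_test_function.intro)
      show "AE y in \<mu>. f\<^sub>0 k y \<le> Cinf" if "k \<in> {1..K\<^sub>0}" for k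
        using \<F>_bound[OF f0[OF that]] by eventually_elim linarith
    qed (use \<mu> hmm tm st L in simp_all)
    have "AE z in power_measure \<mu> L. \<forall>i\<in>{1..L}. e (z i) \<le> 2 * real M * Cinf"
      by (rule AE_PiM_sigma_finite[OF \<mu> _ e_bound]) simp
    then have "AE z in power_measure \<mu> L. F z * \<bar>true_density z\<bar> \<le> (2 * real M * Cinf) ^ L * true_density z"
      using z.hmm_density_true(1)
    proof eventually_elim
      case (elim z)
      then show ?case using F_bound[of z] by (simp add: mult_right_mono)
    qed
    then have "(\<integral>z. F z * \<bar>true_density z\<bar> \<partial>power_measure \<mu> L)
        \<le> (\<integral>z. (2 * real M * Cinf) ^ L * true_density z \<partial>power_measure \<mu> L)"
    proof (intro integral_mono_AE)
      have "(\<lambda>z. \<bar>true_density z\<bar>) \<in> L2_space (power_measure \<mu> L)"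
        using true_density_L2 by (auto simp: L2_space_def)
      then show "integrable (power_measure \<mu> L) (\<lambda>z. F z * \<bar>true_density z\<bar>)" by (rule L2_space_mult[OF F_L2])
      show "integrable (power_measure \<mu> L) (\<lambda>z. (2 * real M * Cinf) ^ L * true_density z)"
        by (intro integrable_mult_right z.hmm_density_true)
    qed
    then show "(\<integral>z. F z * \<bar>true_density z\<bar> \<partial>power_measure \<mu> L) \<le> (2 * real M * Cinf) ^ L"
      by (simp only: integral_mult_right_zero z.hmm_density_true(3) mult_1_right)
  next
    fix n :: nat assume "1 \<le> n"
    then have "AE \<omega> in \<Omega>. \<forall>j\<in>{1..n + L}. e (Y j \<omega>) \<le> 2 * real M * Cinf"
      by (intro hmm_AE[OF hmm e_bound]) simp
    then show "AE \<omega> in \<Omega>. \<forall>j\<in>{1..n}. F (window L j (\<lambda>j. Y j \<omega>)) \<le> (2 * real M * Cinf) ^ L"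
    proof eventually_elim
      case (elim \<omega>)
      show ?case
      proof (intro ballI F_bound)
        fix j i assume "j \<in> {1..n}" "i \<in> {1..L}"
        then have "j + i - 1 \<in> {1..n + L}" "window L j (\<lambda>j. Y j \<omega>) i = Y (j + i - 1) \<omega>"
          by (auto simp: window_def)
        then show "e (window L j (\<lambda>j. Y j \<omega>) i) \<le> 2 * real M * Cinf" using elim by simp
      qed
    qed
  next
    fix m :: nat assume m: "1 \<le> m"
    show "\<exists>N\<subseteq>hmm_model L K (\<F> \<inter> V). finite N \<and> card N \<le> (5 * m) ^ (K + K\<^sup>2 + K * M) \<and>
      (\<forall>t\<in>hmm_model L K (\<F> \<inter> V). \<exists>t'\<in>N. \<forall>z. \<bar>t z - t' z\<bar> \<le> real K ^ L * (2 * real L / real m) * F z)"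
      unfolding F_def e_def by (rule hmm_model_net[OF L m d]) (use coord in blast)
  next
    show "0 \<le> F z" for z by (simp add: F_def e0 prod_nonneg)
  qed
qed

definition model_deviation :: "nat \<Rightarrow> nat \<Rightarrow> ('y \<Rightarrow> real) set \<Rightarrow> ((nat \<Rightarrow> 'y) \<Rightarrow> real) \<Rightarrow> real \<Rightarrow> 'w set" where
  "model_deviation n K G s r =
     {\<omega>\<in>space \<Omega>. \<exists>t\<in>hmm_model L K G. (dist2 t s + r) / 4 < \<bar>emp n \<omega> (\<lambda>z. t z - s z)\<bar>}"

text \<open>If the strict inequality that defines the event holds for some \<open>t\<close>, it also holds for a sufficiently close
  point of a net, since for a fixed \<open>\<omega>\<close> both sides depend continuously on \<open>t\<close>. So the union over \<open>t\<close> may be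
  restricted to a countable union of nets.\<close>

lemma model_deviation_measurable:
  assumes V: "L2_subspace \<mu> M V" and K: "1 \<le> K" and M: "1 \<le> M" and n: "1 \<le> n"
    and s: "s \<in> hmm_model L K' \<F>"
  shows "model_deviation n K (\<F> \<inter> V) s r \<in> sets \<Omega>"
proof -
  let ?P = "power_measure \<mu> L"
  let ?S = "hmm_model L K (\<F> \<inter> V)"
  obtain F where F: "F \<in> L2_space (power_measure \<mu> L)"
    and F_norm: "(\<integral>z. (F z)\<^sup>2 \<partial>power_measure \<mu> L) \<le> (2 * real M * C2) ^ (2 * L)"
    and F_int: "(\<integral>z. F z * \<bar>true_density z\<bar> \<partial>power_measure \<mu> L) \<le> (2 * real M * Cinf) ^ L"
    and F_obs: "\<And>n. 1 \<le> n \<Longrightarrow> AE \<omega> in \<Omega>. \<forall>j\<in>{1..n}. F (window L j (\<lambda>j. Y j \<omega>)) \<le> (2 * real M * Cinf) ^ L"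
    and net: "\<And>m. 1 \<le> m \<Longrightarrow> \<exists>N\<subseteq>?S. finite N \<and> card N \<le> (5 * m) ^ (K + K\<^sup>2 + K * M) \<and>
      (\<forall>t\<in>?S. \<exists>t'\<in>N. \<forall>z. \<bar>t z - t' z\<bar> \<le> real K ^ L * (2 * real L / real m) * F z)"
    and F0: "\<And>z. 0 \<le> F z"
    by (rule model_envelope[OF V K M]) (rule that; assumption)
  have "\<forall>m. \<exists>N. N \<subseteq> ?S \<and> finite N \<and>
      (\<forall>t\<in>?S. \<exists>t'\<in>N. \<forall>z. \<bar>t z - t' z\<bar> \<le> real K ^ L * (2 * real L / real (Suc m)) * F z)"
  proof
    fix m :: nat
    have "1 \<le> Suc m" by simp
    from net[OF this] show "\<exists>N. N \<subseteq> ?S \<and> finite N \<and>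
      (\<forall>t\<in>?S. \<exists>t'\<in>N. \<forall>z. \<bar>t z - t' z\<bar> \<le> real K ^ L * (2 * real L / real (Suc m)) * F z)" by blast
  qed
  from choice[OF this] obtain N where N': "\<forall>m. N m \<subseteq> ?S \<and> finite (N m) \<and>
      (\<forall>t\<in>?S. \<exists>t'\<in>N m. \<forall>z. \<bar>t z - t' z\<bar> \<le> real K ^ L * (2 * real L / real (Suc m)) * F z)" ..
  have N: "N m \<subseteq> ?S" "finite (N m)" for m using N' by blast+
  have close: "\<exists>t'\<in>N m. \<forall>z. \<bar>t z - t' z\<bar> \<le> real K ^ L * (2 * real L / real (Suc m)) * F z"
    if "t \<in> ?S" for m t using N' that by blast
  define D where "D = (\<Union>m. N m)"
  have D: "countable D" "D \<subseteq> ?S"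
  proof -
    show "countable D" unfolding D_def by (rule countable_UN[OF countableI_type countable_finite[OF N(2)]])
    show "D \<subseteq> ?S" unfolding D_def using N(1) by blast
  qed
  let ?E = "\<lambda>t. {\<omega>\<in>space \<Omega>. (dist2 t s + r) / 4 < \<bar>emp n \<omega> (\<lambda>z. t z - s z)\<bar>}"
  have E: "?E t \<in> sets \<Omega>" if "t \<in> ?S" for t
  proof -
    interpret hmm_test_function \<Omega> \<mu> L K\<^sub>0 \<pi>\<^sub>0 Q\<^sub>0 f\<^sub>0 X Y "\<lambda>z. t z - s z" "2 * Cinf ^ L" Cinf "Cinf ^ L * dist2 t s"
      by (rule difference_test_function[OF Int_lower1 that s])
    have [measurable]: "(\<lambda>\<omega>. emp n \<omega> (\<lambda>z. t z - s z)) \<in> borel_measurable \<Omega>"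
      by (rule empirical_process_measurable)
    show ?thesis by measurable
  qed
  have sL2: "s \<in> L2_space ?P" by (rule model_L2[OF subset_refl s])
  have "model_deviation n K (\<F> \<inter> V) s r = (\<Union>t\<in>D. ?E t)"
  proof (intro equalityI subsetI)
    fix \<omega> assume "\<omega> \<in> model_deviation n K (\<F> \<inter> V) s r"
    then obtain t where \<omega>: "\<omega> \<in> space \<Omega>" and t: "t \<in> ?S"
      and dev: "(dist2 t s + r) / 4 < \<bar>emp n \<omega> (\<lambda>z. t z - s z)\<bar>"
      by (auto simp: model_deviation_def)
    define gap where "gap = \<bar>emp n \<omega> (\<lambda>z. t z - s z)\<bar> - (dist2 t s + r) / 4"
    define c where "c = (\<Sum>j\<in>{1..n}. F (window L j (\<lambda>j. Y j \<omega>))) / real n + (\<integral>z. F z * \<bar>true_density z\<bar> \<partial>?P)"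
    define q where "q = (\<integral>z. (F z)\<^sup>2 \<partial>?P)"
    define H where "H = c + dist2 t s + q"
    have c0: "0 \<le> c" unfolding c_def
      by (intro add_nonneg_nonneg divide_nonneg_nonneg sum_nonneg Bochner_Integration.integral_nonneg
          mult_nonneg_nonneg F0 abs_ge_zero of_nat_0_le_iff)
    have q0: "0 \<le> q" by (simp add: q_def)
    have H0: "0 \<le> H" using c0 q0 by (simp add: H_def)
    have gap: "0 < gap" using dev by (simp add: gap_def)
    let ?b = "real K ^ L * (2 * real L)"
    have b0: "0 < ?b" using K L by simp
    \<comment> \<open>with this \<open>m\<close> the mesh satisfies \<open>\<kappa> \<le> 1\<close> and \<open>\<kappa> * H < gap\<close>\<close>
    obtain m where m: "?b * (1 + H / gap) < real m" using reals_Archimedean2 by blast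
    define \<kappa> where "\<kappa> = real K ^ L * (2 * real L / real (Suc m))"
    have \<kappa>0: "0 < \<kappa>" using K L by (simp add: \<kappa>_def)
    have \<kappa>_b: "\<kappa> = ?b / real (Suc m)" by (simp add: \<kappa>_def)
    have "0 \<le> ?b * (H / gap)" using b0 H0 gap by (intro mult_nonneg_nonneg divide_nonneg_nonneg) auto
    then have "?b < real (Suc m)" "?b * (H / gap) < real (Suc m)"
    proof -
      have "?b + ?b * (H / gap) < real m" using m by (simp only: distrib_left mult_1_right)
      moreover have "real m < real (Suc m)" by simp
      ultimately show "?b < real (Suc m)" "?b * (H / gap) < real (Suc m)"
        using b0 \<open>0 \<le> ?b * (H / gap)\<close> by linarith+
    qed
    then have small: "\<kappa> \<le> 1" "\<kappa> * H < gap"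
      unfolding \<kappa>_b using gap by (simp_all add: field_simps)
    obtain t' where t': "t' \<in> N m" and tt': "\<And>z. \<bar>t z - t' z\<bar> \<le> \<kappa> * F z"
      using close[OF t, of m] unfolding \<kappa>_def by blast
    have t'S: "t' \<in> ?S" using t' N by blast
    have L2: "t \<in> L2_space ?P" "t' \<in> L2_space ?P"
      by (rule model_L2[OF Int_lower1 t], rule model_L2[OF Int_lower1 t'S])
    have "\<bar>emp n \<omega> (\<lambda>z. t z - s z) - emp n \<omega> (\<lambda>z. t' z - s z)\<bar> \<le> \<kappa> * c"
      unfolding c_def by (rule empirical_process_close[OF L2 sL2 F true_density_L2 tt' n])
    moreover have "dist2 t' s \<le> (1 + \<kappa>) * dist2 t s + (\<kappa> + \<kappa>\<^sup>2) * q"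
      unfolding q_def by (rule square_norm_close[OF L2 sL2 F tt' \<kappa>0])
    moreover have "(1 + \<kappa>) * dist2 t s + (\<kappa> + \<kappa>\<^sup>2) * q \<le> dist2 t s + \<kappa> * dist2 t s + 2 * \<kappa> * q"
    proof -
      have "\<kappa>\<^sup>2 \<le> \<kappa>" using small(1) \<kappa>0 by (simp add: power2_eq_square mult_left_le)
      then have "(\<kappa> + \<kappa>\<^sup>2) * q \<le> (2 * \<kappa>) * q" using q0 by (intro mult_right_mono) auto
      then show ?thesis by (simp add: algebra_simps)
    qed
    moreover have "\<kappa> * c + \<kappa> * dist2 t s + \<kappa> * q < gap"
      using small(2) by (simp add: H_def algebra_simps)
    moreover have "0 \<le> \<kappa> * dist2 t s" "0 \<le> \<kappa> * q" using \<kappa>0 q0 by auto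
    ultimately have "(dist2 t' s + r) / 4 < \<bar>emp n \<omega> (\<lambda>z. t' z - s z)\<bar>"
      unfolding gap_def add_divide_distrib by linarith
    then show "\<omega> \<in> (\<Union>t\<in>D. ?E t)" using \<omega> t' by (auto simp: D_def)
  next
    fix \<omega> assume "\<omega> \<in> (\<Union>t\<in>D. ?E t)"
    then show "\<omega> \<in> model_deviation n K (\<F> \<inter> V) s r"
      using D(2) unfolding model_deviation_def by blast
  qed
  also have "\<dots> \<in> sets \<Omega>" using D E by (intro sets.countable_UN') auto
  finally show ?thesis .
qed

text \<open>A deviation beyond \<open>(\<parallel>t - s\<parallel>\<^sup>2 + r) / 4\<close> at \<open>t\<close> forces one beyond \<open>(\<parallel>t' - s\<parallel>\<^sup>2 + r) / 8\<close> at the nearest net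
  point \<open>t'\<close>, if the mesh is small compared with \<open>r\<close>. At \<open>t'\<close> the tail bound applies, because its threshold
  is at least \<open>\<parallel>t' - s\<parallel>\<^sup>2 / 8\<close>; this is the origin of the factor \<open>8\<close> in the condition on \<open>\<theta>\<close>.\<close>

lemma model_deviation_bound:
  assumes V: "L2_subspace \<mu> M V" and K: "1 \<le> K" and M: "1 \<le> M" and n: "1 \<le> n"
    and s: "s \<in> hmm_model L K' \<F>"
    and C: "chain_window_constant K\<^sub>0 Q\<^sub>0 L C" and D: "D = 4 * (real L + C)" and r: "0 < r"
    and th: "0 < \<theta>" "D * \<theta> * (2 * Cinf ^ L) \<le> 1" "2 * D\<^sup>2 * (8 * Cinf ^ L) * \<theta> \<le> 1"
    and m: "1 \<le> m" and \<kappa>: "\<kappa> = real K ^ L * (2 * real L / real m)" "\<kappa> \<le> 1"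
    and fine: "\<kappa> * ((2 * real M * C2) ^ (2 * L) / 4 + 2 * (2 * real M * Cinf) ^ L) \<le> r / 8"
  shows "measure \<Omega> (model_deviation n K (\<F> \<inter> V) s r)
    \<le> real ((5 * m) ^ (K + K\<^sup>2 + K * M)) * (2 * exp (1 - \<theta> * real n * r / 16))"
proof -
  let ?P = "power_measure \<mu> L"
  let ?S = "hmm_model L K (\<F> \<inter> V)"
  interpret \<Omega>: prob_space \<Omega> using hmm by (simp add: hidden_markov_model_def)
  define q where "q = (2 * real M * C2) ^ (2 * L)"
  define \<Theta> where "\<Theta> = (2 * real M * Cinf) ^ L"
  obtain F where F: "F \<in> L2_space (power_measure \<mu> L)"
    and F_norm': "(\<integral>z. (F z)\<^sup>2 \<partial>power_measure \<mu> L) \<le> (2 * real M * C2) ^ (2 * L)"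
    and F_int': "(\<integral>z. F z * \<bar>true_density z\<bar> \<partial>power_measure \<mu> L) \<le> (2 * real M * Cinf) ^ L"
    and F_obs': "\<And>n. 1 \<le> n \<Longrightarrow> AE \<omega> in \<Omega>. \<forall>j\<in>{1..n}. F (window L j (\<lambda>j. Y j \<omega>)) \<le> (2 * real M * Cinf) ^ L"
    and net: "\<And>m. 1 \<le> m \<Longrightarrow> \<exists>N\<subseteq>?S. finite N \<and> card N \<le> (5 * m) ^ (K + K\<^sup>2 + K * M) \<and>
      (\<forall>t\<in>?S. \<exists>t'\<in>N. \<forall>z. \<bar>t z - t' z\<bar> \<le> real K ^ L * (2 * real L / real m) * F z)"
    and F0: "\<And>z. 0 \<le> F z"
    by (rule model_envelope[OF V K M]) (rule that; assumption)
  have F_norm: "(\<integral>z. (F z)\<^sup>2 \<partial>?P) \<le> q" using F_norm' by (simp only: q_def)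
  have F_int: "(\<integral>z. F z * \<bar>true_density z\<bar> \<partial>?P) \<le> \<Theta>" using F_int' by (simp only: \<Theta>_def)
  have F_obs: "AE \<omega> in \<Omega>. \<forall>j\<in>{1..n}. F (window L j (\<lambda>j. Y j \<omega>)) \<le> \<Theta>"
    unfolding \<Theta>_def by (rule F_obs'[OF n])
  from net[OF m] obtain N where N: "N \<subseteq> ?S" "finite N" "card N \<le> (5 * m) ^ (K + K\<^sup>2 + K * M)"
    and close: "\<And>t. t \<in> ?S \<Longrightarrow> \<exists>t'\<in>N. \<forall>z. \<bar>t z - t' z\<bar> \<le> \<kappa> * F z"
    unfolding \<kappa>(1)[symmetric] by blast
  have \<kappa>0: "0 < \<kappa>" using K L m by (simp add: \<kappa>)
  have q0: "0 \<le> q" and \<Theta>0: "0 \<le> \<Theta>" using C2 Cinf by (simp_all add: q_def \<Theta>_def)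
  have fine': "\<kappa> * q / 4 + 2 * (\<kappa> * \<Theta>) \<le> r / 8"
    using fine by (simp add: q_def \<Theta>_def algebra_simps)
  have sL2: "s \<in> L2_space ?P" by (rule model_L2[OF subset_refl s])
  let ?\<epsilon> = "\<lambda>t. (dist2 t s + r) / 8"
  let ?E = "\<lambda>t. {\<omega>\<in>space \<Omega>. ?\<epsilon> t \<le> \<bar>emp n \<omega> (\<lambda>z. t z - s z)\<bar>}"
  have E: "?E t \<in> sets \<Omega> \<and> measure \<Omega> (?E t) \<le> 2 * exp (1 - \<theta> * real n * r / 16)" if t: "t \<in> ?S" for t
  proof -
    interpret hmm_test_function \<Omega> \<mu> L K\<^sub>0 \<pi>\<^sub>0 Q\<^sub>0 f\<^sub>0 X Y "\<lambda>z. t z - s z" "2 * Cinf ^ L" Cinf "Cinf ^ L * dist2 t s"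
      by (rule difference_test_function[OF Int_lower1 t s])
    have [measurable]: "(\<lambda>\<omega>. emp n \<omega> (\<lambda>z. t z - s z)) \<in> borel_measurable \<Omega>"
      by (rule empirical_process_measurable)
    have \<epsilon>0: "0 < ?\<epsilon> t" using r by (simp add: add_nonneg_pos)
    have "Cinf ^ L * dist2 t s \<le> Cinf ^ L * (dist2 t s + r)"
      using r Cinf by (intro mult_left_mono) auto
    then have V: "Cinf ^ L * dist2 t s \<le> (8 * Cinf ^ L) * ?\<epsilon> t" by simp
    have "measure \<Omega> (?E t) \<le> 2 * exp (1 - \<theta> * real n * ?\<epsilon> t / 2)"
      by (rule hmm_tail[OF C n D \<epsilon>0 V th])
    also have "\<dots> \<le> 2 * exp (1 - \<theta> * real n * r / 16)"
    proof -
      have "\<theta> * real n * (r / 8) \<le> \<theta> * real n * ?\<epsilon> t"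
        using th by (intro mult_left_mono) auto
      then show ?thesis by simp
    qed
    finally have "measure \<Omega> (?E t) \<le> 2 * exp (1 - \<theta> * real n * r / 16)" .
    moreover have "?E t \<in> sets \<Omega>" by measurable
    ultimately show ?thesis by blast
  qed
  have "AE \<omega> in \<Omega>. \<omega> \<in> model_deviation n K (\<F> \<inter> V) s r \<longrightarrow> \<omega> \<in> (\<Union>t\<in>N. ?E t)"
    using F_obs
  proof eventually_elim
    case (elim \<omega>)
    show ?case
    proof
      assume "\<omega> \<in> model_deviation n K (\<F> \<inter> V) s r"
      then obtain t where \<omega>: "\<omega> \<in> space \<Omega>" and t: "t \<in> ?S"
        and dev: "(dist2 t s + r) / 4 < \<bar>emp n \<omega> (\<lambda>z. t z - s z)\<bar>"
        by (auto simp: model_deviation_def)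
      obtain t' where t': "t' \<in> N" and tt': "\<And>z. \<bar>t z - t' z\<bar> \<le> \<kappa> * F z"
        using close[OF t] by blast
      have t'S: "t' \<in> ?S" using t' N by blast
      have L2: "t \<in> L2_space ?P" "t' \<in> L2_space ?P"
      by (rule model_L2[OF Int_lower1 t], rule model_L2[OF Int_lower1 t'S])
      have "\<bar>emp n \<omega> (\<lambda>z. t z - s z) - emp n \<omega> (\<lambda>z. t' z - s z)\<bar>
          \<le> \<kappa> * ((\<Sum>j\<in>{1..n}. F (window L j (\<lambda>j. Y j \<omega>))) / real n + (\<integral>z. F z * \<bar>true_density z\<bar> \<partial>?P))"
        by (rule empirical_process_close[OF L2 sL2 F true_density_L2 tt' n])
      also have "\<dots> \<le> \<kappa> * (\<Theta> + \<Theta>)"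
      proof (intro mult_left_mono add_mono F_int)
        have "(\<Sum>j\<in>{1..n}. F (window L j (\<lambda>j. Y j \<omega>))) \<le> (\<Sum>j\<in>{1..n}. \<Theta>)" by (intro sum_mono) (use elim in blast)
        then show "(\<Sum>j\<in>{1..n}. F (window L j (\<lambda>j. Y j \<omega>))) / real n \<le> \<Theta>"
          using n by (simp add: field_simps)
      qed (use \<kappa>0 in simp)
      finally have 1: "\<bar>emp n \<omega> (\<lambda>z. t z - s z) - emp n \<omega> (\<lambda>z. t' z - s z)\<bar> \<le> 2 * (\<kappa> * \<Theta>)" by simp
      have "\<And>z. \<bar>t z - t' z\<bar> \<le> \<kappa> * F z" by (rule tt')
      from square_norm_close[OF L2 sL2 F this \<kappa>0]
      have "dist2 t' s \<le> (1 + \<kappa>) * dist2 t s + (\<kappa> + \<kappa>\<^sup>2) * (\<integral>z. (F z)\<^sup>2 \<partial>?P)" .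
      also have "\<dots> \<le> 2 * dist2 t s + (2 * \<kappa>) * q"
      proof (intro add_mono mult_mono)
        have "\<kappa>\<^sup>2 \<le> \<kappa>" using \<kappa>(2) \<kappa>0 by (simp add: power2_eq_square mult_left_le)
        then show "\<kappa> + \<kappa>\<^sup>2 \<le> 2 * \<kappa>" by simp
      qed (use \<kappa> \<kappa>0 F_norm in auto)
      finally have 2: "dist2 t' s \<le> 2 * dist2 t s + 2 * (\<kappa> * q)" by simp
      have "?\<epsilon> t' \<le> \<bar>emp n \<omega> (\<lambda>z. t' z - s z)\<bar>"
      proof -
        have "\<bar>emp n \<omega> (\<lambda>z. t z - s z)\<bar> \<le> \<bar>emp n \<omega> (\<lambda>z. t' z - s z)\<bar> + 2 * (\<kappa> * \<Theta>)"
          using 1 abs_triangle_ineq2[of "emp n \<omega> (\<lambda>z. t z - s z)" "emp n \<omega> (\<lambda>z. t' z - s z)"] by linarith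
        moreover have "(dist2 t' s + r) / 8 \<le> dist2 t s / 4 + \<kappa> * q / 4 + r / 8"
        proof -
          have "(d' + r) / 8 \<le> d / 4 + p / 4 + r / 8" if "d' \<le> 2 * d + 2 * p" for d' d p :: real
            using that by (simp add: field_simps)
          from this[OF 2] show ?thesis .
        qed
        ultimately show ?thesis using dev fine' unfolding add_divide_distrib by linarith
      qed
      then show "\<omega> \<in> (\<Union>t\<in>N. ?E t)" using \<omega> t' by blast
    qed
  qed
  then have "measure \<Omega> (model_deviation n K (\<F> \<inter> V) s r) \<le> measure \<Omega> (\<Union>t\<in>N. ?E t)"
    using N E by (intro \<Omega>.finite_measure_mono_AE sets.finite_UN) auto
  also have "\<dots> \<le> (\<Sum>t\<in>N. measure \<Omega> (?E t))"
    using N E by (intro \<Omega>.finite_measure_subadditive_finite) auto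
  also have "\<dots> \<le> (\<Sum>t\<in>N. 2 * exp (1 - \<theta> * real n * r / 16))"
    using N E by (intro sum_mono) auto
  also have "\<dots> = real (card N) * (2 * exp (1 - \<theta> * real n * r / 16))" by simp
  also have "\<dots> \<le> real ((5 * m) ^ (K + K\<^sup>2 + K * M)) * (2 * exp (1 - \<theta> * real n * r / 16))"
    using N(3) by (intro mult_right_mono) (simp_all only: of_nat_le_iff, simp)
  finally show ?thesis .
qed

end

section \<open>Union bound over the models\<close>

text \<open>Up to a factor, the number \<open>M K + K\<^sup>2 - 1\<close> in the penalty counts the parameters of a net, although it does not
  count the entries of \<open>\<pi>\<close> and replaces \<open>K\<^sup>2\<close> by \<open>K\<^sup>2 - 1\<close>.\<close>

lemma penalty_dimension:
  fixes K M :: nat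
  assumes "1 \<le> K" "1 \<le> M"
  defines "\<Delta> \<equiv> real M * real K + (real K)\<^sup>2 - 1"
  shows "1 \<le> \<Delta>" "real (K + K\<^sup>2 + K * M) \<le> 3 * \<Delta>"
proof -
  have K: "1 \<le> real K" and M: "1 \<le> real M" using assms by auto
  have K2: "real K \<le> (real K)\<^sup>2" using K by (simp add: power2_eq_square)
  have MK: "1 * 1 \<le> real M * real K" using K M by (intro mult_mono) auto
  show "1 \<le> \<Delta>" using MK K2 K unfolding \<Delta>_def by linarith
  have eq: "real (K + K\<^sup>2 + K * M) = real K + (real K)\<^sup>2 + real M * real K" by simp
  show "real (K + K\<^sup>2 + K * M) \<le> 3 * \<Delta>"
    unfolding eq \<Delta>_def
  proof -
    have "k + q + p \<le> 3 * (p + q - 1)" if "1 \<le> p" "k \<le> q" "1 \<le> k" for k q p :: real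
      using that by (simp add: algebra_simps)
    from this[OF _ K2 K, of "real M * real K"]
    show "real K + (real K)\<^sup>2 + real M * real K \<le> 3 * (real M * real K + (real K)\<^sup>2 - 1)"
      using MK by (simp only: mult_1_right)
  qed
qed

text \<open>With \<open>\<Delta> = M K + K\<^sup>2 - 1\<close> the net has at most \<open>n\<close> to the power \<open>3 (3 L + 2) \<Delta>\<close> points. The choice of \<open>\<rho>\<close>
  compensates this and leaves a factor \<open>n\<close> to the power \<open>- 4 \<Delta>\<close> for the sum over the \<open>n\<^sup>2\<close> models.\<close>

lemma net_times_tail_le:
  fixes n H L K M :: nat and c \<rho> A x :: real
  assumes n: "3 \<le> n" "5 * H \<le> n" and K: "1 \<le> K" and M: "1 \<le> M" and c: "0 < c"
  defines "\<Delta> \<equiv> real M * real K + (real K)\<^sup>2 - 1"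
  defines "r \<equiv> 2 * \<rho> * \<Delta> * ln (real n) / real n + 2 * A * x / real n"
  assumes \<rho>: "2 * \<rho> * c = 3 * (3 * real L + 2) + 4" and A: "2 * A * c = 1"
  shows "real ((5 * (H * n ^ (3 * L + 1))) ^ (K + K\<^sup>2 + K * M)) * (2 * exp (1 - c * real n * r))
    \<le> 6 * real n powr (-4) * exp (- x)"
proof -
  have \<Delta>: "1 \<le> \<Delta>" "real (K + K\<^sup>2 + K * M) \<le> 3 * \<Delta>"
    unfolding \<Delta>_def using penalty_dimension[OF K M] by auto
  have n0: "1 < real n" using n by simp
  have ln0: "0 < ln (real n)" using n0 by simp
  have "real ((5 * (H * n ^ (3 * L + 1))) ^ (K + K\<^sup>2 + K * M))
      \<le> real ((n ^ (3 * L + 2)) ^ (K + K\<^sup>2 + K * M))"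
  proof -
    have "5 * (H * n ^ (3 * L + 1)) \<le> n * n ^ (3 * L + 1)"
      using mult_le_mono1[OF n(2), of "n ^ (3 * L + 1)"] by (simp only: mult.assoc)
    also have "\<dots> = n ^ (3 * L + 2)" by simp
    finally show ?thesis by (intro of_nat_mono power_mono) auto
  qed
  also have "\<dots> = exp ((3 * real L + 2) * real (K + K\<^sup>2 + K * M) * ln (real n))"
  proof -
    have "real ((n ^ (3 * L + 2)) ^ (K + K\<^sup>2 + K * M)) = real n ^ ((3 * L + 2) * (K + K\<^sup>2 + K * M))"
      by (simp only: of_nat_power power_mult)
    also have "\<dots> = real n powr real ((3 * L + 2) * (K + K\<^sup>2 + K * M))"
      using n0 by (intro powr_realpow[symmetric]) simp
    also have "\<dots> = exp (real ((3 * L + 2) * (K + K\<^sup>2 + K * M)) * ln (real n))"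
      using n0 by (simp add: powr_def)
    also have "real ((3 * L + 2) * (K + K\<^sup>2 + K * M)) = (3 * real L + 2) * real (K + K\<^sup>2 + K * M)"
      by (simp only: of_nat_mult of_nat_add of_nat_numeral)
    finally show ?thesis .
  qed
  also have "\<dots> \<le> exp (3 * (3 * real L + 2) * \<Delta> * ln (real n))"
  proof -
    have "(3 * real L + 2) * real (K + K\<^sup>2 + K * M) \<le> (3 * real L + 2) * (3 * \<Delta>)"
      using \<Delta> by (intro mult_left_mono) auto
    then have "(3 * real L + 2) * real (K + K\<^sup>2 + K * M) * ln (real n) \<le> (3 * real L + 2) * (3 * \<Delta>) * ln (real n)"
      using ln0 by (intro mult_right_mono) auto
    then show ?thesis by (simp add: mult_ac)
  qed
  finally have net: "real ((5 * (H * n ^ (3 * L + 1))) ^ (K + K\<^sup>2 + K * M))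
    \<le> exp (3 * (3 * real L + 2) * \<Delta> * ln (real n))" .
  have "c * real n * r = (2 * \<rho> * c) * \<Delta> * ln (real n) + (2 * A * c) * x"
    unfolding r_def using n0 by (simp add: field_simps)
  also have "\<dots> = 3 * (3 * real L + 2) * \<Delta> * ln (real n) + 4 * \<Delta> * ln (real n) + x"
    unfolding \<rho> A by (simp add: algebra_simps)
  finally have cr: "c * real n * r = 3 * (3 * real L + 2) * \<Delta> * ln (real n) + 4 * \<Delta> * ln (real n) + x" .
  have "real ((5 * (H * n ^ (3 * L + 1))) ^ (K + K\<^sup>2 + K * M)) * (2 * exp (1 - c * real n * r))
      \<le> exp (3 * (3 * real L + 2) * \<Delta> * ln (real n)) * (2 * exp (1 - c * real n * r))"
    by (intro mult_right_mono net) simp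
  also have "\<dots> = 2 * exp (1 - 4 * \<Delta> * ln (real n) - x)"
    unfolding cr by (simp flip: exp_add)
  also have "\<dots> \<le> 2 * exp (1 - 4 * ln (real n) - x)"
  proof -
    have "1 * ln (real n) \<le> \<Delta> * ln (real n)" using \<Delta> ln0 by (intro mult_right_mono) auto
    then show ?thesis by simp
  qed
  also have "\<dots> = 2 * exp 1 * (real n powr (-4) * exp (- x))"
    using n0 by (simp add: powr_def flip: exp_add)
  also have "\<dots> \<le> 6 * (real n powr (-4) * exp (- x))"
    using exp_le by (intro mult_right_mono) auto
  finally show ?thesis by (simp add: mult.assoc)
qed

text \<open>The exponent \<open>3 L + 1\<close> of the mesh is \<open>L\<close> for the number \<open>K\<^sup>L\<close> of summands of a density, \<open>2 L\<close> for the squared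
  norm of the envelope, and \<open>1\<close> to reach the order \<open>1 / n\<close> of \<open>r\<close>.\<close>

lemma net_mesh_fine:
  fixes n H L K M :: nat and C2 Cinf r :: real
  assumes n: "1 \<le> n" and L: "1 \<le> L" and K: "K \<le> n" and M: "M \<le> n" and C2: "1 \<le> C2" and Cinf: "1 \<le> Cinf"
    and H: "2 * real L * ((2 * C2) ^ (2 * L) / 4 + 2 * (2 * Cinf) ^ L + 1) \<le> real H"
    and r: "8 / real n \<le> r"
  defines "\<kappa> \<equiv> real K ^ L * (2 * real L / real (H * n ^ (3 * L + 1)))"
  shows "1 \<le> H * n ^ (3 * L + 1)" "\<kappa> \<le> 1"
    "\<kappa> * ((2 * real M * C2) ^ (2 * L) / 4 + 2 * (2 * real M * Cinf) ^ L) \<le> r / 8"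
proof -
  define S where "S = (2 * C2) ^ (2 * L) / 4 + 2 * (2 * Cinf) ^ L"
  have S0: "0 \<le> S" using C2 Cinf by (simp add: S_def)
  have rn: "1 \<le> real n" using n by simp
  have L1: "1 \<le> real L" using L by simp
  have HL: "2 * real L * (S + 1) \<le> real H" using H by (simp add: S_def)
  have "1 * 1 \<le> real L * (S + 1)" using L1 S0 by (intro mult_mono) auto
  then have "1 \<le> 2 * real L * (S + 1)" unfolding mult.assoc by linarith
  then have H1: "1 \<le> real H" using HL by linarith
  then have "1 \<le> H" by simp
  then show m1: "1 \<le> H * n ^ (3 * L + 1)" using n by simp
  have H0: "0 < real H" using H1 by simp
  have KL: "real K ^ L \<le> real n ^ L" using K by (intro power_mono) auto
  have pos: "0 < real n ^ L" "0 < real n ^ (2 * L)" using rn by auto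
  have \<kappa>: "\<kappa> \<le> 2 * real L / (real H * real n ^ (2 * L + 1))"
  proof -
    have "\<kappa> \<le> real n ^ L * (2 * real L / real (H * n ^ (3 * L + 1)))"
      unfolding \<kappa>_def by (intro mult_right_mono KL) simp
    also have "\<dots> = 2 * real L / (real H * real n ^ (2 * L + 1))"
    proof -
      have e1: "real (H * n ^ (3 * L + 1)) = real H * (real n ^ L * real n ^ (2 * L + 1))"
        by (simp flip: power_add)
      have e2: "a * (l / (h * (a * b))) = l / (h * b)" if "0 < a" for a l h b :: real
        using that by simp
      show ?thesis unfolding e1 by (rule e2[OF pos(1)])
    qed
    finally show ?thesis .
  qed
  also have "\<dots> \<le> 2 * real L / (real H * 1)"
    using H0 rn by (intro divide_left_mono mult_left_mono one_le_power) auto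
  also have "\<dots> \<le> 1"
  proof -
    have "2 * real L * 1 \<le> 2 * real L * (S + 1)" using L1 S0 by (intro mult_left_mono) auto
    then show ?thesis using HL H0 by simp
  qed
  finally show "\<kappa> \<le> 1" .
  have bound: "(2 * real M * C2) ^ (2 * L) / 4 + 2 * (2 * real M * Cinf) ^ L \<le> real n ^ (2 * L) * S"
  proof -
    have "(2 * real M * C2) ^ (2 * L) \<le> (real n * (2 * C2)) ^ (2 * L)"
      using M C2 by (intro power_mono) auto
    moreover have "(2 * real M * Cinf) ^ L \<le> (real n * (2 * Cinf)) ^ L"
      using M Cinf by (intro power_mono) auto
    moreover have "(real n * (2 * Cinf)) ^ L \<le> real n ^ (2 * L) * (2 * Cinf) ^ L"
      unfolding power_mult_distrib[of "real n"] using rn Cinf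
      by (intro mult_right_mono power_increasing) auto
    ultimately show ?thesis unfolding S_def power_mult_distrib[of "real n"] by (simp add: algebra_simps)
  qed
  have "\<kappa> * ((2 * real M * C2) ^ (2 * L) / 4 + 2 * (2 * real M * Cinf) ^ L)
      \<le> (2 * real L / (real H * real n ^ (2 * L + 1))) * (real n ^ (2 * L) * S)"
    using \<kappa> bound C2 Cinf by (intro mult_mono) auto
  also have "\<dots> = (2 * real L * S / real H) * (1 / real n)"
    using pos H0 by (simp add: field_simps)
  also have "\<dots> \<le> 1 * (1 / real n)"
  proof (rule mult_right_mono)
    have "2 * real L * S \<le> 2 * real L * (S + 1)" using L1 by (intro mult_left_mono) auto
    then show "2 * real L * S / real H \<le> 1" using HL H0 by simp
  qed simp
  also have "\<dots> \<le> r / 8" using r by simp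
  finally show "\<kappa> * ((2 * real M * C2) ^ (2 * L) / 4 + 2 * (2 * real M * Cinf) ^ L) \<le> r / 8" .
qed

theorem lemma16:
  fixes L Kstar :: nat
    and Qstar :: "nat \<Rightarrow> nat \<Rightarrow> real"
    and C2 Cinf :: real
  assumes "1 \<le> L" and "1 \<le> Kstar"
    and "irreducible_transition_matrix Kstar Qstar"
    and "1 < C2" and "1 < Cinf"
  shows "\<exists>(xs :: nat \<Rightarrow> real \<Rightarrow> nat \<Rightarrow> nat \<Rightarrow> real) (n0 :: nat) (\<rho> :: real) (A :: real).
    0 < n0 \<and> 0 < \<rho> \<and> 0 < A \<and>
    (\<forall>n\<ge>n0. \<forall>x>0. \<forall>K\<ge>1. \<forall>M\<ge>1. 0 < xs n x K M) \<and>
    (\<forall>(\<mu> :: 'y measure) (\<Omega> :: 'w measure) (\<pi>star :: nat \<Rightarrow> real) (fstar :: nat \<Rightarrow> 'y \<Rightarrow> real)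
       (X :: nat \<Rightarrow> 'w \<Rightarrow> nat) (Y :: nat \<Rightarrow> 'w \<Rightarrow> 'y)
       (\<F> :: ('y \<Rightarrow> real) set) (\<M> :: nat set) (P :: nat \<Rightarrow> ('y \<Rightarrow> real) set)
       (pen :: nat \<Rightarrow> nat \<Rightarrow> nat \<Rightarrow> real).
      sigma_finite_measure \<mu> \<longrightarrow>
      hidden_markov_model \<Omega> \<mu> Kstar \<pi>star Qstar fstar X Y \<longrightarrow>
      stationary_distribution Kstar Qstar \<pi>star \<longrightarrow>
      model_spaces \<mu> \<M> P \<longrightarrow>
      \<F> \<subseteq> L2_space \<mu> \<longrightarrow>
      (\<forall>k\<in>{1..Kstar}. fstar k \<in> \<F>) \<longrightarrow>
      (\<forall>M\<in>\<M>. \<forall>f\<in>\<F>. \<forall>p. is_L2_projection \<mu> (P M) f p \<longrightarrow> p \<in> \<F>) \<longrightarrow>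
      (\<forall>f\<in>\<F>. esssup \<mu> (\<lambda>y. ereal \<bar>f y\<bar>) \<le> ereal Cinf \<and> L2_norm \<mu> f \<le> C2) \<longrightarrow>
      (\<forall>n. \<forall>M\<in>\<M>. \<forall>K\<ge>1. M \<le> n \<longrightarrow> K \<le> n \<longrightarrow>
         pen n M K \<ge> \<rho> * (real M * real K + (real K)\<^sup>2 - 1) * ln (real n) / real n) \<longrightarrow>
      (\<forall>s :: nat \<Rightarrow> nat \<Rightarrow> (nat \<Rightarrow> 'y) \<Rightarrow> real.
        (\<forall>K\<ge>1. \<forall>M\<in>\<M>. s K M \<in> (\<Union>K'\<in>{1..}. hmm_model L K' \<F>)) \<longrightarrow>
        (\<forall>n\<ge>n0. \<forall>x>0.
          (let Z = (\<lambda>\<omega> K M. normalized_sup \<mu> L (hmm_density L Kstar \<pi>star Qstar fstar) n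
                               (\<lambda>j. Y j \<omega>) (hmm_model L K (\<F> \<inter> P M)) (s K M) (xs n x K M))
           in measure \<Omega> {\<omega> \<in> space \<Omega>.
                (SUP (K, M)\<in>{1..n} \<times> {M\<in>\<M>. M \<le> n}. Z \<omega> K M) \<le> ereal (1 / 4) \<and>
                (SUP (K, M)\<in>{1..n} \<times> {M\<in>\<M>. M \<le> n}.
                    2 * Z \<omega> K M * ereal ((xs n x K M)\<^sup>2) - ereal (pen n M K))
                  \<le> ereal (A * x / real n)}
              > 1 - exp (- x)))))"
proof -
  obtain C where C: "chain_window_constant Kstar Qstar L C"
    using chain_window_exp_bound[OF assms(3,2,1)] by blast
  then have C1: "1 \<le> C" by (simp add: chain_window_constant_def)
  define D where "D = 4 * (real L + C)"
  \<comment> \<open>\<open>\<theta>\<close> is the Chernoff parameter and \<open>c\<close> the resulting constant in \<open>exp (1 - c * n * r)\<close>; the definition of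
    \<open>\<theta>\<close> turns \<open>th2\<close> below into an equality. Then \<open>\<rho>\<close> and \<open>A\<close> are such that \<open>c * n * r\<close> pays for the net
    and for \<open>x\<close>\<close>
  define \<theta> where "\<theta> = 1 / (16 * D\<^sup>2 * Cinf ^ L)"
  define c where "c = \<theta> / 16"
  define \<rho> where "\<rho> = (3 * (3 * real L + 2) + 4) / (2 * c)"
  define A where "A = 1 / (2 * c)"
  have D1: "1 \<le> D" using C1 unfolding D_def by simp
  have \<beta>1: "1 \<le> Cinf ^ L" using assms(5) by simp
  have "1 * 1 \<le> D\<^sup>2 * Cinf ^ L" using D1 \<beta>1 by (intro mult_mono) auto
  then have den: "1 \<le> 16 * D\<^sup>2 * Cinf ^ L" by simp
  then have den0: "0 < 16 * D\<^sup>2 * Cinf ^ L" by linarith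
  have \<theta>: "0 < \<theta>" "\<theta> \<le> 1"
    unfolding \<theta>_def divide_le_eq_1_pos[OF den0] using den den0 by (simp_all only: zero_less_divide_1_iff)
  have "w * (1 / w) = 1" if "0 < w" for w :: real using that by simp
  from this[OF den0] have "(16 * D\<^sup>2 * Cinf ^ L) * \<theta> = 1" unfolding \<theta>_def .
  then have th2: "2 * D\<^sup>2 * (8 * Cinf ^ L) * \<theta> \<le> 1" by (simp add: mult_ac)
  have th1: "D * \<theta> * (2 * Cinf ^ L) \<le> 1"
  proof -
    have "D * (\<theta> * (2 * Cinf ^ L)) \<le> (8 * D\<^sup>2) * (\<theta> * (2 * Cinf ^ L))"
      using D1 \<theta> \<beta>1 self_le_power[of D 2] by (intro mult_right_mono) auto
    then show ?thesis using th2 by (simp add: mult_ac)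
  qed
  have c: "0 < c" "c \<le> 1" using \<theta> by (simp_all add: c_def)
  have \<rho>_c: "2 * \<rho> * c = 3 * (3 * real L + 2) + 4" and A_c: "2 * A * c = 1"
    using c by (simp_all add: \<rho>_def A_def)
  have \<rho>: "8 \<le> 2 * \<rho>"
  proof -
    have "8 * c \<le> 8" using c by simp
    also have "\<dots> \<le> 2 * \<rho> * c" unfolding \<rho>_c by simp
    finally have "8 * c \<le> 2 * \<rho> * c" .
    then show ?thesis using c by simp
  qed
  have A0: "0 < A" using c by (simp add: A_def)
  obtain H :: nat where H: "2 * real L * ((2 * C2) ^ (2 * L) / 4 + 2 * (2 * Cinf) ^ L + 1) \<le> real H"
    using real_arch_simple by blast
  define n0 where "n0 = max 3 (5 * H)"
  define \<Delta> where "\<Delta> K M = real M * real K + (real K)\<^sup>2 - 1" for K M :: nat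
  define r where "r n x K M = 2 * \<rho> * \<Delta> K M * ln (real n) / real n + 2 * A * x / real n"
    for n K M :: nat and x :: real
  define xs where "xs n x K M = sqrt (r n x K M)" for n x K M
  have r_ge: "8 / real n \<le> r n x K M" "0 < r n x K M"
    if "n0 \<le> n" "0 < x" "1 \<le> K" "1 \<le> M" for n x K M
  proof -
    have n: "3 \<le> n" using that by (simp add: n0_def)
    have "ln (exp 1) \<le> ln (real n)" using n exp_le by (subst ln_le_cancel_iff) auto
    then have ln: "1 \<le> ln (real n)" by simp
    have \<Delta>: "1 \<le> \<Delta> K M" unfolding \<Delta>_def using penalty_dimension(1)[OF that(3,4)] .
    have "8 * 1 * 1 \<le> 2 * \<rho> * \<Delta> K M * ln (real n)" using \<rho> \<Delta> ln by (intro mult_mono) auto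
    then have "8 / real n \<le> 2 * \<rho> * \<Delta> K M * ln (real n) / real n" by (simp add: divide_right_mono)
    moreover have "0 \<le> 2 * A * x / real n" using A0 that by simp
    ultimately show "8 / real n \<le> r n x K M" unfolding r_def by linarith
    moreover have "0 < 8 / real n" using n by simp
    ultimately show "0 < r n x K M" by linarith
  qed
  have xs_sq: "(xs n x K M)\<^sup>2 = r n x K M" if "n0 \<le> n" "0 < x" "1 \<le> K" "1 \<le> M" for n x K M
    using r_ge(2)[OF that] by (simp add: xs_def)
  show ?thesis
  proof (rule exI[of _ xs], rule exI[of _ n0], rule exI[of _ \<rho>], rule exI[of _ A], intro conjI allI impI)
    show "0 < n0" by (simp add: n0_def)
    show "0 < \<rho>" using \<rho> by linarith
    show "0 < A" by (rule A0)
    show "0 < xs n x K M" if "n0 \<le> n" "0 < x" "1 \<le> K" "1 \<le> M" for n x K M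
      using r_ge(2)[OF that] by (simp add: xs_def)
  next
    fix \<mu> :: "'y measure" and \<Omega> :: "'w measure" and \<pi>star :: "nat \<Rightarrow> real" and fstar :: "nat \<Rightarrow> 'y \<Rightarrow> real"
      and X :: "nat \<Rightarrow> 'w \<Rightarrow> nat" and Y :: "nat \<Rightarrow> 'w \<Rightarrow> 'y"
      and \<F> :: "('y \<Rightarrow> real) set" and \<M> :: "nat set" and P :: "nat \<Rightarrow> ('y \<Rightarrow> real) set"
      and pen :: "nat \<Rightarrow> nat \<Rightarrow> nat \<Rightarrow> real" and s :: "nat \<Rightarrow> nat \<Rightarrow> (nat \<Rightarrow> 'y) \<Rightarrow> real"
      and n :: nat and x :: real
    assume \<mu>: "sigma_finite_measure \<mu>" and hmm: "hidden_markov_model \<Omega> \<mu> Kstar \<pi>star Qstar fstar X Y"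
      and st: "stationary_distribution Kstar Qstar \<pi>star" and models: "model_spaces \<mu> \<M> P"
      and \<F>: "\<F> \<subseteq> L2_space \<mu>" and fstar: "\<forall>k\<in>{1..Kstar}. fstar k \<in> \<F>"
      and bounds: "\<forall>f\<in>\<F>. esssup \<mu> (\<lambda>y. ereal \<bar>f y\<bar>) \<le> ereal Cinf \<and> L2_norm \<mu> f \<le> C2"
      and pen: "\<forall>n. \<forall>M\<in>\<M>. \<forall>K\<ge>1. M \<le> n \<longrightarrow> K \<le> n \<longrightarrow>
         \<rho> * (real M * real K + (real K)\<^sup>2 - 1) * ln (real n) / real n \<le> pen n M K"
      and s: "\<forall>K\<ge>1. \<forall>M\<in>\<M>. s K M \<in> (\<Union>K'\<in>{1..}. hmm_model L K' \<F>)"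
      and n: "n0 \<le> n" and x: "0 < x"
    interpret hmm_setting \<Omega> \<mu> L Kstar \<pi>star Qstar fstar X Y \<F> C2 Cinf
    proof (rule hmm_setting.intro)
      show "AE y in \<mu>. \<bar>f y\<bar> \<le> Cinf" if "f \<in> \<F>" for f
      proof -
        have le: "esssup \<mu> (\<lambda>y. ereal \<bar>f y\<bar>) \<le> ereal Cinf" using bounds that by blast
        from esssup_AE[of "\<lambda>y. ereal \<bar>f y\<bar>" \<mu>] show ?thesis
        proof eventually_elim
          case (elim y)
          from order_trans[OF this le] show ?case by simp
        qed
      qed
      show "transition_matrix Kstar Qstar" using assms(3) by (simp add: irreducible_transition_matrix_def)
    qed (use \<mu> hmm st assms \<F> fstar bounds in simp_all)
    interpret \<Omega>: prob_space \<Omega> using hmm by (simp add: hidden_markov_model_def)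
    define J where "J = {1..n} \<times> {M\<in>\<M>. M \<le> n}"
    have n3: "3 \<le> n" "5 * H \<le> n" using n by (simp_all add: n0_def)
    have J: "1 \<le> K" "K \<le> n" "1 \<le> M" "M \<le> n" "M \<in> \<M>" if "(K, M) \<in> J" for K M
      using that models by (auto simp: J_def model_spaces_def)
    have J_sub: "J \<subseteq> {1..n} \<times> {1..n}" using J by auto
    then have fin: "finite J" by (rule finite_subset) simp
    have "card J \<le> card ({1..n} \<times> {1..n})" using J_sub by (intro card_mono) auto
    then have "real (card J) \<le> real (n * n)" unfolding of_nat_le_iff by simp
    then have card_J: "real (card J) \<le> (real n)\<^sup>2" by (simp add: power2_eq_square)
    define bad where "bad p = (case p of (K, M) \<Rightarrow> model_deviation n K (\<F> \<inter> P M) (s K M) (r n x K M))" for p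
    define q where "q = 6 * real n powr (-4) * exp (- x)"
    have bad: "bad p \<in> sets \<Omega>" "measure \<Omega> (bad p) \<le> q" if "p \<in> J" for p
    proof -
      obtain K M where p: "p = (K, M)" by (cases p)
      note KM = J[OF that[unfolded p]]
      have V: "L2_subspace \<mu> M (P M)" using models KM(5) by (simp add: model_spaces_def)
      obtain K' where s': "s K M \<in> hmm_model L K' \<F>" using s KM by blast
      have n1: "1 \<le> n" using n3 by simp
      show "bad p \<in> sets \<Omega>"
        unfolding bad_def p prod.case by (rule model_deviation_measurable[OF V KM(1,3) n1 s'])
      note mesh = net_mesh_fine[OF n1 assms(1) KM(2,4) _ _ H r_ge(1)[OF n x KM(1,3)]]
      have "measure \<Omega> (bad p) \<le> real ((5 * (H * n ^ (3 * L + 1))) ^ (K + K\<^sup>2 + K * M))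
          * (2 * exp (1 - \<theta> * real n * r n x K M / 16))"
        unfolding bad_def p prod.case
        by (rule model_deviation_bound[OF V KM(1,3) n1 s' C D_def r_ge(2)[OF n x KM(1,3)] \<theta>(1) th1 th2 _ refl])
          (rule mesh; use assms in simp)+
      also have "\<theta> * real n * r n x K M / 16 = c * real n * r n x K M" by (simp add: c_def)
      also have "real ((5 * (H * n ^ (3 * L + 1))) ^ (K + K\<^sup>2 + K * M)) * (2 * exp (1 - c * real n * r n x K M)) \<le> q"
        unfolding q_def r_def \<Delta>_def by (rule net_times_tail_le[OF n3 KM(1,3) c(1) \<rho>_c A_c])
      finally show "measure \<Omega> (bad p) \<le> q" .
    qed
    define Z where "Z \<omega> K M = normalized_sup \<mu> L true_density n (\<lambda>j. Y j \<omega>)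
      (hmm_model L K (\<F> \<inter> P M)) (s K M) (xs n x K M)" for \<omega> K M
    have Z_le: "Z \<omega> K M \<le> ereal (1 / 4) \<longleftrightarrow> \<omega> \<notin> bad (K, M)"
      if "(K, M) \<in> J" "\<omega> \<in> space \<Omega>" for \<omega> K M
    proof -
      note KM = J[OF that(1)]
      have "\<bar>e\<bar> / (d + (xs n x K M)\<^sup>2) \<le> 1 / 4 \<longleftrightarrow> \<not> (d + r n x K M) / 4 < \<bar>e\<bar>" if "0 \<le> d" for e d :: real
      proof -
        have "0 < d + r n x K M" using that r_ge(2)[OF n x KM(1,3)] by simp
        then show ?thesis
          unfolding xs_sq[OF n x KM(1,3)] by (simp add: pos_divide_le_eq not_less)
      qed
      then show ?thesis
        using that(2) by (simp add: Z_def normalized_sup_def SUP_le_iff bad_def model_deviation_def)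
    qed
    have second: "2 * Z \<omega> K M * ereal ((xs n x K M)\<^sup>2) - ereal (pen n M K) \<le> ereal (A * x / real n)"
      if "(K, M) \<in> J" "Z \<omega> K M \<le> ereal (1 / 4)" for \<omega> K M
    proof -
      note KM = J[OF that(1)]
      have "2 * Z \<omega> K M \<le> 2 * ereal (1 / 4)" using that(2) by (intro ereal_mult_left_mono) auto
      then have "2 * Z \<omega> K M * ereal ((xs n x K M)\<^sup>2) \<le> 2 * ereal (1 / 4) * ereal ((xs n x K M)\<^sup>2)"
        by (intro ereal_mult_right_mono) auto
      also have "\<dots> = ereal (r n x K M / 2)"
        unfolding xs_sq[OF n x KM(1,3)] by simp
      also have "\<dots> \<le> ereal (A * x / real n) + ereal (pen n M K)"
      proof -
        have "\<rho> * \<Delta> K M * ln (real n) / real n \<le> pen n M K"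
          unfolding \<Delta>_def using pen KM by blast
        then show ?thesis unfolding r_def by (simp add: add_divide_distrib)
      qed
      finally show ?thesis by (simp add: ereal_minus_le_iff)
    qed
    have event: "{\<omega> \<in> space \<Omega>. (SUP (K, M)\<in>J. Z \<omega> K M) \<le> ereal (1 / 4) \<and>
        (SUP (K, M)\<in>J. 2 * Z \<omega> K M * ereal ((xs n x K M)\<^sup>2) - ereal (pen n M K)) \<le> ereal (A * x / real n)}
      = space \<Omega> - (\<Union>p\<in>J. bad p)"
    proof (intro equalityI subsetI)
      fix \<omega> assume "\<omega> \<in> {\<omega> \<in> space \<Omega>. (SUP (K, M)\<in>J. Z \<omega> K M) \<le> ereal (1 / 4) \<and>
        (SUP (K, M)\<in>J. 2 * Z \<omega> K M * ereal ((xs n x K M)\<^sup>2) - ereal (pen n M K)) \<le> ereal (A * x / real n)}"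
      then have \<omega>: "\<omega> \<in> space \<Omega>" and le: "(SUP (K, M)\<in>J. Z \<omega> K M) \<le> ereal (1 / 4)" by auto
      have "\<omega> \<notin> bad (K, M)" if "(K, M) \<in> J" for K M
      proof -
        have "Z \<omega> K M \<le> (SUP (K, M)\<in>J. Z \<omega> K M)" using SUP_upper[OF that, of "\<lambda>(K, M). Z \<omega> K M"] by simp
        then show ?thesis using Z_le[OF that \<omega>] le by (meson order_trans)
      qed
      then show "\<omega> \<in> space \<Omega> - (\<Union>p\<in>J. bad p)" using \<omega> by auto
    next
      fix \<omega> assume \<omega>: "\<omega> \<in> space \<Omega> - (\<Union>p\<in>J. bad p)"
      have le: "Z \<omega> K M \<le> ereal (1 / 4)" if "(K, M) \<in> J" for K M
        using Z_le[OF that, of \<omega>] \<omega> that by blast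
      have "(SUP (K, M)\<in>J. Z \<omega> K M) \<le> ereal (1 / 4)"
        by (rule SUP_least) (use le in auto)
      moreover have "(SUP (K, M)\<in>J. 2 * Z \<omega> K M * ereal ((xs n x K M)\<^sup>2) - ereal (pen n M K)) \<le> ereal (A * x / real n)"
        by (rule SUP_least) (use le second in auto)
      ultimately show "\<omega> \<in> {\<omega> \<in> space \<Omega>. (SUP (K, M)\<in>J. Z \<omega> K M) \<le> ereal (1 / 4) \<and>
        (SUP (K, M)\<in>J. 2 * Z \<omega> K M * ereal ((xs n x K M)\<^sup>2) - ereal (pen n M K)) \<le> ereal (A * x / real n)}"
        using \<omega> by blast
    qed
    have "measure \<Omega> (\<Union>p\<in>J. bad p) \<le> (\<Sum>p\<in>J. measure \<Omega> (bad p))"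
      using fin bad by (intro \<Omega>.finite_measure_subadditive_finite) auto
    also have "\<dots> \<le> real (card J) * q" using sum_bounded_above[of J "\<lambda>p. measure \<Omega> (bad p)" q] bad(2) by simp
    also have "\<dots> \<le> (real n)\<^sup>2 * q" using card_J by (intro mult_right_mono) (auto simp: q_def)
    also have "\<dots> = 6 / (real n)\<^sup>2 * exp (- x)"
      using n3 by (simp add: q_def powr_minus powr_numeral field_simps power2_eq_square eval_nat_numeral)
    also have "\<dots> < exp (- x)"
    proof -
      have "3 ^ 2 \<le> (real n)\<^sup>2" using n3 by (intro power_mono) auto
      then have "6 / (real n)\<^sup>2 < 1" by (simp add: divide_less_eq)
      then have "6 / (real n)\<^sup>2 * exp (- x) < 1 * exp (- x)" by (rule mult_strict_right_mono) simp
      then show ?thesis by (simp only: mult_1)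
    qed
    finally have "measure \<Omega> (\<Union>p\<in>J. bad p) < exp (- x)" .
    moreover have "measure \<Omega> (space \<Omega> - (\<Union>p\<in>J. bad p)) = 1 - measure \<Omega> (\<Union>p\<in>J. bad p)"
      using fin bad(1) by (intro \<Omega>.prob_compl sets.finite_UN) auto
    ultimately have "1 - exp (- x) < measure \<Omega> (space \<Omega> - (\<Union>p\<in>J. bad p))" by linarith
    then show "let Z = \<lambda>\<omega> K M. normalized_sup \<mu> L true_density n (\<lambda>j. Y j \<omega>)
          (hmm_model L K (\<F> \<inter> P M)) (s K M) (xs n x K M)
      in 1 - exp (- x) < measure \<Omega> {\<omega> \<in> space \<Omega>.
          (SUP (K, M)\<in>{1..n} \<times> {M\<in>\<M>. M \<le> n}. Z \<omega> K M) \<le> ereal (1 / 4) \<and>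
          (SUP (K, M)\<in>{1..n} \<times> {M\<in>\<M>. M \<le> n}.
            2 * Z \<omega> K M * ereal ((xs n x K M)\<^sup>2) - ereal (pen n M K)) \<le> ereal (A * x / real n)}"
      unfolding Let_def event[unfolded Z_def J_def, symmetric] J_def .
  qed
qed

end
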